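(* Let $\Omega=U\times V\subset\mathbb{C}^2$, where each of $U$ and $V$ is an annulus or a disk in $\mathbb{C}$, and let $\phi,\psi\in C(\overline{\Omega})$. Assume that the restrictions of $\phi$ and $\psi$ to any disk or annulus in the boundary of $\Omega$ are of the form $f+\overline{h}$, where $f$ and $h$ are holomorphic on that disk or annulus and continuous up to its boundary. If $H_{\psi}^*H_{\phi}$ is compact on $A^2(\Omega)$, then for any holomorphic function $g:\mathbb{D}\to\partial\Omega$, either $\phi\circ g$ or $\psi\circ g$ is holomorphic.
   Context: $\mathbb{D}$ is the open unit disk in $\mathbb{C}$. Disks are open disks $\{|z-a|<R\}$ with $0<R<\infty$, and annuli are sets $\{r<|z-a|<R\}$ with $0<r<R<\infty$. The disks or annuli in the boundary of $\Omega=U\times V$ lie in the sets $\{\xi\}\times V$ with $\xi\in\partial U$ and $U\times\{\eta\}$ with $\eta\in\partial V$ (these sets themselves included); functions on them are regarded as functions of the one non-constant complex variable. The pair $f,h$ may depend on the symbol and on the boundary disk or annulus. A holomorphic function $g:\mathbb{D}\to\partial\Omega$ is a holomorphic map $g:\mathbb{D}\to\mathbb{C}^2$ whose image is contained in the topological boundary $\partial\Omega$. Symbols are complex-valued. For a domain $\Omega\subset\mathbb{C}^n$ with Lebesgue volume measure $dV$, the Bergman space $A^2(\Omega)$ is the closed subspace of $L^2(\Omega,dV)$ consisting of holomorphic functions, and $P:L^2(\Omega)\to A^2(\Omega)$ is the orthogonal projection. For $\phi\in L^\infty(\Omega)$, the Hankel operator $H_\phi:A^2(\Omega)\to A^2(\Omega)^\perp$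 is $H_\phi f=(I-P)(\phi f)$, and $H_\phi^*$ is its Hilbert space adjoint. *)

theory Defs
  imports "HOL-Complex_Analysis.Complex_Analysis"
begin

definition disk :: "complex set \<Rightarrow> bool" where
  "disk W \<longleftrightarrow> (\<exists>a R. 0 < R \<and> W = {z. cmod (z - a) < R})"

definition annulus :: "complex set \<Rightarrow> bool" where
  "annulus W \<longleftrightarrow> (\<exists>a r R. 0 < r \<and> r < R \<and> W = {z. r < cmod (z - a) \<and> cmod (z - a) < R})"

text \<open>
  Holomorphy of scalar functions of two complex variables (intended for open sets): real
  Frechet differentiability with a complex-linear derivative.
\<close>

definition holomorphic2_on :: "(complex \<times> complex \<Rightarrow> complex) \<Rightarrow> (complex \<times> complex) set \<Rightarrow> bool"
    (infixl "holomorphic2'_on" 50) where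
  "f holomorphic2_on S \<longleftrightarrow>
     (\<forall>z\<in>S. \<exists>a b. (f has_derivative (\<lambda>v. a * fst v + b * snd v)) (at z within S))"

text \<open>
  Square-integrable functions are handled as honest functions, not as classes modulo null sets;
  only their values on \<open>\<Omega>\<close> matter for the integrals below.
\<close>

definition L2 :: "(complex \<times> complex) set \<Rightarrow> (complex \<times> complex \<Rightarrow> complex) set" where
  "L2 \<Omega> = {f. f \<in> borel_measurable (lebesgue_on \<Omega>) \<and>
               integrable (lebesgue_on \<Omega>) (\<lambda>z. (cmod (f z))\<^sup>2)}"

definition L2_inner ::
    "(complex \<times> complex) set \<Rightarrow> (complex \<times> complex \<Rightarrow> complex) \<Rightarrow> (complex \<times> complex \<Rightarrow> complex) \<Rightarrow> complex"
  where "L2_inner \<Omega> f g = (LINT z|lebesgue_on \<Omega>. f z * cnj (g z))"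

definition L2_norm :: "(complex \<times> complex) set \<Rightarrow> (complex \<times> complex \<Rightarrow> complex) \<Rightarrow> real" where
  "L2_norm \<Omega> f = sqrt (LINT z|lebesgue_on \<Omega>. (cmod (f z))\<^sup>2)"

text \<open>
  Elements of the Bergman space are normalised to vanish off \<open>\<Omega>\<close>.  For open \<open>\<Omega>\<close>, two
  holomorphic functions that agree almost everywhere agree on \<open>\<Omega>\<close>, so with this normalisation
  every class modulo null sets has exactly one representative, and the definite descriptions
  below are well defined.
\<close>

definition bergman_space :: "(complex \<times> complex) set \<Rightarrow> (complex \<times> complex \<Rightarrow> complex) set" where
  "bergman_space \<Omega> = {f \<in> L2 \<Omega>. f holomorphic2_on \<Omega> \<and> (\<forall>z. z \<notin> \<Omega> \<longrightarrow> f z = 0)}"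

definition bergman_projection ::
    "(complex \<times> complex) set \<Rightarrow> (complex \<times> complex \<Rightarrow> complex) \<Rightarrow> complex \<times> complex \<Rightarrow> complex" where
  "bergman_projection \<Omega> f =
     (THE p. p \<in> bergman_space \<Omega> \<and>
             (\<forall>u\<in>bergman_space \<Omega>. L2_inner \<Omega> (\<lambda>z. f z - p z) u = 0))"

definition hankel ::
    "(complex \<times> complex) set \<Rightarrow> (complex \<times> complex \<Rightarrow> complex) \<Rightarrow>
     (complex \<times> complex \<Rightarrow> complex) \<Rightarrow> complex \<times> complex \<Rightarrow> complex" where
  "hankel \<Omega> \<phi> f = (\<lambda>z. \<phi> z * f z - bergman_projection \<Omega> (\<lambda>w. \<phi> w * f w) z)"

text \<open>
  The Hilbert space adjoint of \<open>hankel \<Omega> \<psi>\<close>, to be applied to elements of the orthogonal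
  complement of the Bergman space in \<open>L2 \<Omega>\<close>.
\<close>

definition hankel_adjoint ::
    "(complex \<times> complex) set \<Rightarrow> (complex \<times> complex \<Rightarrow> complex) \<Rightarrow>
     (complex \<times> complex \<Rightarrow> complex) \<Rightarrow> complex \<times> complex \<Rightarrow> complex" where
  "hankel_adjoint \<Omega> \<psi> k =
     (THE u. u \<in> bergman_space \<Omega> \<and>
             (\<forall>f\<in>bergman_space \<Omega>. L2_inner \<Omega> (hankel \<Omega> \<psi> f) k = L2_inner \<Omega> f u))"

text \<open>
  The self-map condition guarantees that the norms in the last line are norms of genuine elements
  of \<open>L2 \<Omega>\<close>; the Bochner integral of a non-integrable function is 0 by convention.
\<close>

definition compact_on_bergman ::
    "(complex \<times> complex) set \<Rightarrow>
     ((complex \<times> complex \<Rightarrow> complex) \<Rightarrow> complex \<times> complex \<Rightarrow> complex) \<Rightarrow> bool" where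
  "compact_on_bergman \<Omega> T \<longleftrightarrow>
     T ` bergman_space \<Omega> \<subseteq> bergman_space \<Omega> \<and>
     (\<forall>F :: nat \<Rightarrow> complex \<times> complex \<Rightarrow> complex.
        range F \<subseteq> bergman_space \<Omega> \<longrightarrow> (\<exists>C. \<forall>n. L2_norm \<Omega> (F n) \<le> C) \<longrightarrow>
        (\<exists>u\<in>bergman_space \<Omega>. \<exists>r :: nat \<Rightarrow> nat. strict_mono r \<and>
           (\<lambda>n. L2_norm \<Omega> (\<lambda>z. T (F (r n)) z - u z)) \<longlonglongrightarrow> 0))"

definition holo_plus_antiholo_on :: "(complex \<Rightarrow> complex) \<Rightarrow> complex set \<Rightarrow> bool" where
  "holo_plus_antiholo_on q W \<longleftrightarrow>
     (\<exists>f h. f holomorphic_on W \<and> continuous_on (closure W) f \<and>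
            h holomorphic_on W \<and> continuous_on (closure W) h \<and>
            (\<forall>w\<in>W. q w = f w + cnj (h w)))"

text \<open>
  The disks and annuli in the boundary of \<open>U \<times> V\<close> are the sets \<open>{\<xi>} \<times> W\<close> with
  \<open>\<xi> \<in> frontier U\<close>, \<open>W \<subseteq> V\<close>, and \<open>W \<times> {\<eta>}\<close> with \<open>\<eta> \<in> frontier V\<close>, \<open>W \<subseteq> U\<close>.
\<close>

definition boundary_condition ::
    "complex set \<Rightarrow> complex set \<Rightarrow> (complex \<times> complex \<Rightarrow> complex) \<Rightarrow> bool" where
  "boundary_condition U V \<phi> \<longleftrightarrow>
     (\<forall>\<xi>\<in>frontier U. \<forall>W. W \<subseteq> V \<and> (disk W \<or> annulus W) \<longrightarrow>
        holo_plus_antiholo_on (\<lambda>w. \<phi> (\<xi>, w)) W) \<and>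
     (\<forall>\<eta>\<in>frontier V. \<forall>W. W \<subseteq> U \<and> (disk W \<or> annulus W) \<longrightarrow>
        holo_plus_antiholo_on (\<lambda>w. \<phi> (w, \<eta>)) W)"

end

theory Submission
  imports Defs
begin

text \<open>
  Let \<open>\<xi>\<close> be a boundary point of \<open>U\<close>.  Normalised powers \<open>k\<^sub>n\<close> of a function peaking at \<open>\<xi>\<close> tend
  weakly to zero, so compactness of the Hankel product forces
  \<open>\<langle>H\<^sub>\<phi> F\<^sub>n, H\<^sub>\<psi> F\<^sub>n\<rangle> \<rightarrow> 0\<close> for \<open>F\<^sub>n(z, w) = k\<^sub>n(z) e(w)\<close>.  In the limit the symbols are frozen at
  \<open>z = \<xi>\<close>, where they are \<open>f\<^sub>i + cnj h\<^sub>i\<close>.  If \<open>e\<close> is a reproducing kernel at \<open>v \<in> V\<close>, the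
  limit relation is \<open>\<integral> (h\<^sub>2 - h\<^sub>2(v)) cnj (h\<^sub>1 - h\<^sub>1(v)) |e|\<^sup>2 = 0\<close>; hence \<open>u = h\<^sub>2 \<cdot> cnj h\<^sub>1\<close> is fixed by the
  Berezin transform of \<open>V\<close>.

  The Berezin transform commutes with rotations of \<open>V\<close>, so every rotational Fourier rotation_mode of \<open>u\<close> is
  fixed too.  For \<open>d \<noteq> 0\<close> the boundary values of the \<open>d\<close>-th rotation_mode are those of some
  \<open>A z^d + B cnj (z^(-d))\<close>, and the maximum principle for the Berezin transform makes the two agree
  on \<open>V\<close>.  Only the rotation_mode \<open>d = 0\<close> may fail to be harmonic (on an annulus \<open>log |z|\<close> is not fixed), so
  the Laplacian \<open>h\<^sub>2' \<cdot> cnj h\<^sub>1'\<close> of \<open>u\<close> is radial.  This makes \<open>h\<^sub>1'\<close> and \<open>h\<^sub>2'\<close> linearly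
  dependent, and then the integral relation forces \<open>h\<^sub>1\<close> or \<open>h\<^sub>2\<close> to be constant.
\<close>

section \<open>Lebesgue integrals on complex domains\<close>

text \<open>Reproducing kernels enter because the projection of \<open>cnj h * e\<close> is
  \<open>cnj (h v) * e\<close>: in a pairing with \<open>g\<close> the factor \<open>h\<close> moves
  to the other side and is evaluated at \<open>v\<close>. The Hankel image of \<open>F n\<close> is
  therefore \<open>k n\<close> times \<open>(cnj h - cnj (h v)) * e\<close>, up to an error that
  tends to zero in norm.

  The annulus is the obstacle. Only sums of holomorphic and conjugate-holomorphic functions are
  available as fixed functions to compare with. A mode has one free number on each boundary circle;
  for d nonzero the coefficients A and B match both, because R^(2d) and r^(2d) differ, while for d =
  0 the two powers coincide. Continuity of \<open>h\<close> up to the boundary is what lets the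
  maximum principle act.

  Knowledge mode by mode suits means better than derivatives, so the Laplacian appears as the
  increment of means over circles of radius e|z|, which rotations carry into each other.

  Linear dependence has a rigidity behind it: for unimodular w, F(wz)/F(z) is holomorphic and
  conjugate-holomorphic at once, hence a constant, and its modulus is one because |F| has a maximum
  on each circle.\<close>

abbreviation lb :: "'a::euclidean_space set \<Rightarrow> 'a measure" where
  "lb S \<equiv> restrict_space lborel S"

text \<open>
  The library has the invariance of Lebesgue measure under orthogonal maps only for
  \<open>real ^ 'n\<close>, hence the detour through \<open>real ^ 2\<close>.
\<close>

definition vec2 :: "complex \<Rightarrow> real ^ 2" where
  "vec2 z = vector [Re z, Im z]"

definition cplx2 :: "real ^ 2 \<Rightarrow> complex" where
  "cplx2 x = Complex (x $ 1) (x $ 2)"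

lemma vec2_cplx2 [simp]: "vec2 (cplx2 x) = x" "cplx2 (vec2 z) = z"
  by (simp_all add: vec2_def cplx2_def vec_eq_iff forall_2 complex_eq_iff)

lemma borel_measurable_cplx2 [measurable]: "cplx2 \<in> borel_measurable borel"
  and borel_measurable_vec2 [measurable]: "vec2 \<in> borel_measurable borel"
proof -
  have "continuous_on UNIV cplx2"
    unfolding cplx2_def Complex_eq by (intro continuous_intros)
  then show "cplx2 \<in> borel_measurable borel" by (rule borel_measurable_continuous_onI)
  have "continuous_on UNIV vec2"
    by (intro linear_continuous_on linear_linear[THEN iffD2] linearI)
      (simp_all add: vec2_def vec_eq_iff forall_2)
  then show "vec2 \<in> borel_measurable borel" by (rule borel_measurable_continuous_onI)
qed

lemma distr_lborel_cplx2: "distr lborel borel cplx2 = (lborel :: complex measure)"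
proof (rule sym, rule lborel_eqI)
  fix l u :: complex assume le: "\<And>b. b \<in> Basis \<Longrightarrow> l \<bullet> b \<le> u \<bullet> b"
  have "cplx2 -` box l u = box (vec2 l) (vec2 u)"
    by (auto simp: box_def cplx2_def vec2_def Basis_complex_def Basis_vec_def inner_axis forall_2)
  moreover have "\<And>b. b \<in> Basis \<Longrightarrow> vec2 l \<bullet> b \<le> vec2 u \<bullet> b"
    using le[of 1] le[of "\<i>"]
    by (auto simp: vec2_def Basis_complex_def Basis_vec_def inner_axis UNIV_2)
  ultimately show "emeasure (distr lborel borel cplx2) (box l u) = ennreal (\<Prod>b\<in>Basis. (u - l) \<bullet> b)"
    apply (simp add: emeasure_distr emeasure_lborel_box)
    apply (simp add: Basis_complex_def Basis_vec_def vec2_def inner_diff_left UNIV_2)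
    apply (subst prod.insert)
    apply (auto simp: inner_axis axis_eq_axis complex_eq_iff mult.commute)
    done
qed simp

text \<open>It suffices to measure boxes. The preimage of a box is its image under the inverse map,
  which is again orthogonal, and orthogonal maps preserve the measure of measurable sets.\<close>

lemma distr_lborel_orthogonal:
  fixes f :: "real ^ 'n::{finite,wellorder} \<Rightarrow> real ^ 'n::_"
  assumes f: "orthogonal_transformation f"
  shows "distr lborel borel f = lborel"
proof (rule sym, rule lborel_eqI)
  fix l u :: "real ^ 'n::{finite,wellorder}" assume le: "\<And>b. b \<in> Basis \<Longrightarrow> l \<bullet> b \<le> u \<bullet> b"
  define g where "g = inv f"
  have g: "orthogonal_transformation g"
    unfolding g_def using f by (rule orthogonal_transformation_inv)
  have [measurable]: "f \<in> borel_measurable borel"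
    by (intro borel_measurable_continuous_onI linear_continuous_on linear_linear[THEN iffD2]
        orthogonal_transformation_linear f)
  have bij: "bij f" using f by (rule orthogonal_transformation_bij)
  have eq: "f -` box l u = g ` box l u"
    unfolding g_def using bij by (simp add: bij_vimage_eq_inv_image)
  have lm: "box l u \<in> lmeasurable" by simp
  have sb: "f -` box l u \<in> sets borel"
    using measurable_sets[of f borel borel "box l u"] by simp
  have "emeasure (distr lborel borel f) (box l u) = emeasure lebesgue (g ` box l u)"
    using sb by (simp add: emeasure_distr eq)
  also have "\<dots> = ennreal (measure lebesgue (g ` box l u))"
    using measurable_orthogonal_image[OF g lm] by (simp add: emeasure_eq_measure2)
  also have "\<dots> = ennreal (measure lebesgue (box l u))"
    using measure_orthogonal_image[OF g lm] by simp
  also have "\<dots> = (\<Prod>b\<in>Basis. (u - l) \<bullet> b)"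
    using le by (simp add: measure_lborel_box)
  finally show "emeasure (distr lborel borel f) (box l u) = ennreal (\<Prod>b\<in>Basis. (u - l) \<bullet> b)" .
qed simp

text \<open>In the coordinates \<open>vec2\<close> multiplication by a unimodular number is a linear
  isometry; its invariance is carried over along \<open>cplx2\<close>.\<close>

lemma distr_lborel_rotation:
  fixes w :: complex
  assumes w: "cmod w = 1"
  shows "distr lborel borel ((*) w) = lborel"
proof -
  define f where "f = (\<lambda>x. vec2 (w * cplx2 x))"
  have lin: "linear f"
    by (auto intro!: linearI simp: f_def vec2_def cplx2_def vec_eq_iff forall_2 algebra_simps)
  have "norm (vec2 z) = cmod z" for z
    by (simp add: vec2_def norm_vec_def L2_set_def UNIV_2 cmod_def)
  then have nf: "norm (f x) = norm x" for x
    by (metis f_def mult_1 norm_mult vec2_cplx2(1) w)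
  have "orthogonal_transformation f"
    using lin nf by (simp add: orthogonal_transformation)
  then have "distr lborel borel f = lborel" by (rule distr_lborel_orthogonal)
  then have "distr (distr lborel borel f) borel cplx2 = distr lborel borel cplx2" by simp
  moreover have [measurable]: "f \<in> borel_measurable borel"
    unfolding f_def by measurable
  ultimately have "distr lborel borel (cplx2 \<circ> f) = (lborel :: complex measure)"
    by (simp add: distr_distr distr_lborel_cplx2)
  moreover have "cplx2 \<circ> f = ((*) w) \<circ> cplx2" by (auto simp: f_def)
  ultimately have "distr (distr lborel borel cplx2) borel ((*) w) = (lborel :: complex measure)"
    by (simp add: distr_distr)
  then show ?thesis by (simp add: distr_lborel_cplx2)
qed

section \<open>Integrals over Borel sets: rotations, translations, products\<close>

lemma integral_lb:
  fixes f :: "'a::euclidean_space \<Rightarrow> 'b::{banach,second_countable_topology}"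
  assumes "S \<in> sets borel"
  shows "integral\<^sup>L (lb S) f = integral\<^sup>L lborel (\<lambda>x. indicator S x *\<^sub>R f x)"
  using assms by (simp add: integral_restrict_space)

lemma integral_rotation:
  fixes f :: "complex \<Rightarrow> 'b::{banach,second_countable_topology}"
  assumes w: "cmod w = 1" and S: "S \<in> sets borel" and inv: "\<And>z. w * z \<in> S \<longleftrightarrow> z \<in> S"
    and f: "f \<in> borel_measurable (lb S)"
  shows "integral\<^sup>L (lb S) (\<lambda>z. f (w * z)) = integral\<^sup>L (lb S) f"
    and "integrable (lb S) (\<lambda>z. f (w * z)) \<longleftrightarrow> integrable (lb S) f"
proof -
  have m: "(\<lambda>x. indicator S x *\<^sub>R f x) \<in> borel_measurable borel"
    using f S by (subst (asm) borel_measurable_restrict_space_iff) auto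
  have i: "indicator S (w * x) = (indicator S x :: real)" for x
    using inv by (simp add: indicator_def)
  have "integral\<^sup>L lborel (\<lambda>x. indicator S x *\<^sub>R f x)
     = integral\<^sup>L (distr lborel borel ((*) w)) (\<lambda>x. indicator S x *\<^sub>R f x)"
    by (simp add: distr_lborel_rotation[OF w])
  also have "\<dots> = integral\<^sup>L lborel (\<lambda>x. indicator S (w * x) *\<^sub>R f (w * x))"
    by (rule integral_distr) (use m in auto)
  finally show "integral\<^sup>L (lb S) (\<lambda>z. f (w * z)) = integral\<^sup>L (lb S) f"
    using S by (simp add: integral_restrict_space i)
  have "integrable lborel (\<lambda>x. indicator S x *\<^sub>R f x)
     = integrable (distr lborel borel ((*) w)) (\<lambda>x. indicator S x *\<^sub>R f x)"
    by (simp add: distr_lborel_rotation[OF w])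
  also have "\<dots> = integrable lborel (\<lambda>x. indicator S (w * x) *\<^sub>R f (w * x))"
    by (rule integrable_distr_eq) (use m in auto)
  finally show "integrable (lb S) (\<lambda>z. f (w * z)) \<longleftrightarrow> integrable (lb S) f"
    using S by (simp add: integrable_restrict_space i)
qed

lemma integral_lb_translation:
  fixes f :: "'a::euclidean_space \<Rightarrow> 'b::{banach,second_countable_topology}"
  assumes S: "S \<in> sets borel" and T: "\<And>z. a + z \<in> S \<longleftrightarrow> z \<in> T" "T \<in> sets borel"
    and f: "f \<in> borel_measurable (lb S)"
  shows "integral\<^sup>L (lb T) (\<lambda>z. f (a + z)) = integral\<^sup>L (lb S) f"
    and "integrable (lb T) (\<lambda>z. f (a + z)) \<longleftrightarrow> integrable (lb S) f"
proof -
  have m: "(\<lambda>x. indicator S x *\<^sub>R f x) \<in> borel_measurable borel"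
    using f S by (subst (asm) borel_measurable_restrict_space_iff) auto
  have i: "indicator S (a + x) = (indicator T x :: real)" for x
    using T by (simp add: indicator_def)
  have "integral\<^sup>L lborel (\<lambda>x. indicator S x *\<^sub>R f x)
     = integral\<^sup>L (distr lborel borel ((+) a)) (\<lambda>x. indicator S x *\<^sub>R f x)"
    by (simp add: lborel_distr_plus)
  also have "\<dots> = integral\<^sup>L lborel (\<lambda>x. indicator S (a + x) *\<^sub>R f (a + x))"
    by (rule integral_distr) (use m in auto)
  finally show "integral\<^sup>L (lb T) (\<lambda>z. f (a + z)) = integral\<^sup>L (lb S) f"
    using S T by (simp add: integral_restrict_space i)
  have "integrable lborel (\<lambda>x. indicator S x *\<^sub>R f x)
     = integrable (distr lborel borel ((+) a)) (\<lambda>x. indicator S x *\<^sub>R f x)"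
    by (simp add: lborel_distr_plus)
  also have "\<dots> = integrable lborel (\<lambda>x. indicator S (a + x) *\<^sub>R f (a + x))"
    by (rule integrable_distr_eq) (use m in auto)
  finally show "integrable (lb T) (\<lambda>z. f (a + z)) \<longleftrightarrow> integrable (lb S) f"
    using S T by (simp add: integrable_restrict_space i)
qed

lemma borel_measurable_lb:
  fixes f :: "'a::euclidean_space \<Rightarrow> 'b::topological_space"
  assumes "continuous_on S f" shows "f \<in> borel_measurable (lb S)"
  using borel_measurable_continuous_on_restrict[OF assms]
  by (simp add: measurable_def space_restrict_space sets_restrict_space)

text \<open>The definitions integrate against completed Lebesgue measure, but a product of completed
  measures need not be complete. The argument therefore runs on Borel measure, where Fubini applies
  directly, and this lemma translates between the two.\<close>

lemma lebesgue_on_eq_lb: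
  fixes f :: "'a::euclidean_space \<Rightarrow> 'b::{banach,second_countable_topology}"
  assumes S: "S \<in> sets borel" and f: "f \<in> borel_measurable (lb S)"
  shows "f \<in> borel_measurable (lebesgue_on S)"
    and "integral\<^sup>L (lebesgue_on S) f = integral\<^sup>L (lb S) f"
    and "integrable (lebesgue_on S) f \<longleftrightarrow> integrable (lb S) f"
proof -
  have m: "(\<lambda>x. indicator S x *\<^sub>R f x) \<in> borel_measurable borel"
    using f S by (subst (asm) borel_measurable_restrict_space_iff) auto
  then have m2: "(\<lambda>x. indicator S x *\<^sub>R f x) \<in> borel_measurable lborel" by simp
  have "(\<lambda>x. indicator S x *\<^sub>R f x) \<in> borel_measurable lebesgue"
    using m2 by (rule measurable_completion)
  then show "f \<in> borel_measurable (lebesgue_on S)"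
    using S by (subst borel_measurable_restrict_space_iff) auto
  show "integral\<^sup>L (lebesgue_on S) f = integral\<^sup>L (lb S) f"
    using S m2 by (simp add: integral_restrict_space integral_completion)
  show "integrable (lebesgue_on S) f \<longleftrightarrow> integrable (lb S) f"
    using S m2 by (simp add: integrable_restrict_space integrable_completion)
qed

lemma finite_measure_lb:
  assumes "bounded S" "S \<in> sets borel" shows "finite_measure (lb S)"
proof
  have "emeasure lborel S < \<infinity>" using assms(1) by (rule emeasure_bounded_finite)
  then show "emeasure (lb S) (space (lb S)) \<noteq> \<infinity>"
    using assms by (simp add: emeasure_restrict_space space_restrict_space)
qed

lemma sigma_finite_lb:
  assumes "S \<in> sets borel" shows "sigma_finite_measure (lb S)"
  using assms by (intro sigma_finite_measure_restrict_space) (auto intro: lborel.sigma_finite_measure_axioms)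

text \<open>All uses of Fubini on \<open>U \<times> V\<close> rest on this. Only the measurable sets
  need care: the identity is measurable from the product into the restricted Borel space, so every
  set of the latter is its own preimage.\<close>

lemma pair_lb:
  fixes U :: "'a::euclidean_space set" and V :: "'b::euclidean_space set"
  assumes U: "U \<in> sets borel" and V: "V \<in> sets borel"
  shows "lb U \<Otimes>\<^sub>M lb V = lb (U \<times> V)"
proof (rule pair_measure_eqI)
  show "sigma_finite_measure (lb U)" "sigma_finite_measure (lb V)"
    using U V by (auto intro: sigma_finite_lb)
  have UV: "U \<times> V \<in> sets (borel :: ('a \<times> 'b) measure)"
    using U V by (rule borel_Times)
  show "sets (lb U \<Otimes>\<^sub>M lb V) = sets (lb (U \<times> V))"
  proof
    show "sets (lb U \<Otimes>\<^sub>M lb V) \<subseteq> sets (lb (U \<times> V))"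
      using U V UV by (subst sets_pair_measure, intro sets.sigma_sets_subset')
        (auto simp: sets_restrict_space_iff space_restrict_space intro: borel_Times)
    have idU: "(\<lambda>x. x) \<in> lb U \<rightarrow>\<^sub>M lborel" and idV: "(\<lambda>x. x) \<in> lb V \<rightarrow>\<^sub>M lborel"
      by (auto intro: measurable_restrict_space1)
    have "(\<lambda>x. x) \<in> lb U \<Otimes>\<^sub>M lb V \<rightarrow>\<^sub>M lborel \<Otimes>\<^sub>M lborel"
      using measurable_compose[OF measurable_fst[of "lb U" "lb V"] idU]
        measurable_compose[OF measurable_snd[of "lb U" "lb V"] idV]
      by (auto intro!: measurable_pair simp: comp_def)
    then have "(\<lambda>x. x) \<in> lb U \<Otimes>\<^sub>M lb V \<rightarrow>\<^sub>M (lborel :: ('a \<times> 'b) measure)"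
      by (simp add: lborel_prod)
    then have "(\<lambda>x. x) \<in> lb U \<Otimes>\<^sub>M lb V \<rightarrow>\<^sub>M lb (U \<times> V)"
      by (rule measurable_restrict_space2[rotated]) (auto simp: space_pair_measure space_restrict_space)
    note * = measurable_sets[OF this]
    show "sets (lb (U \<times> V)) \<subseteq> sets (lb U \<Otimes>\<^sub>M lb V)"
    proof (intro subsetI)
      fix A assume A: "A \<in> sets (lb (U \<times> V))"
      then have "A \<subseteq> U \<times> V" using sets.sets_into_space by (fastforce simp: space_restrict_space)
      then have "(\<lambda>x. x) -` A \<inter> space (lb U \<Otimes>\<^sub>M lb V) = A"
        by (auto simp: space_pair_measure space_restrict_space)
      with *[OF A] show "A \<in> sets (lb U \<Otimes>\<^sub>M lb V)" by metis
    qed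
  qed
  fix A B assume "A \<in> sets (lb U)" "B \<in> sets (lb V)"
  then have AB: "A \<subseteq> U" "B \<subseteq> V" "A \<in> sets lborel" "B \<in> sets lborel"
    using U V by (auto simp: sets_restrict_space_iff)
  have "emeasure (lborel \<Otimes>\<^sub>M lborel) (A \<times> B) = emeasure lborel A * emeasure lborel B"
    using AB by (intro lborel.emeasure_pair_measure_Times) auto
  then show "emeasure (lb U) A * emeasure (lb V) B = emeasure (lb (U \<times> V)) (A \<times> B)"
    using AB U V UV emeasure_restrict_space[of "U \<times> V" lborel "A \<times> B"] Sigma_mono[of A U "\<lambda>_. B" "\<lambda>_. V"]
    by (auto simp: emeasure_restrict_space lborel_prod)
qed

section \<open>Square-integrable functions\<close>

definition l2 :: "'a measure \<Rightarrow> ('a \<Rightarrow> complex) set" where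
  "l2 M = {f \<in> borel_measurable M. integrable M (\<lambda>x. (cmod (f x))\<^sup>2)}"

definition ip :: "'a measure \<Rightarrow> ('a \<Rightarrow> complex) \<Rightarrow> ('a \<Rightarrow> complex) \<Rightarrow> complex" where
  "ip M f g = (LINT x|M. f x * cnj (g x))"

definition sq_norm :: "'a measure \<Rightarrow> ('a \<Rightarrow> complex) \<Rightarrow> real" where
  "sq_norm M f = (LINT x|M. (cmod (f x))\<^sup>2)"

lemma l2_measurable: "f \<in> l2 M \<Longrightarrow> f \<in> borel_measurable M"
  and l2_integrable: "f \<in> l2 M \<Longrightarrow> integrable M (\<lambda>x. (cmod (f x))\<^sup>2)"
  by (auto simp: l2_def)

lemma two_mult_le_squares: "2 * (a * b) \<le> a\<^sup>2 + (b::real)\<^sup>2"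
  using sum_squares_bound[of a b] by (simp add: algebra_simps)

lemma l2_abs_product_integrable:
  assumes f: "f \<in> l2 M" and g: "g \<in> l2 M"
  shows "integrable M (\<lambda>x. cmod (f x) * cmod (g x))"
proof (rule Bochner_Integration.integrable_bound)
  show "integrable M (\<lambda>x. (cmod (f x))\<^sup>2 + (cmod (g x))\<^sup>2)"
    using f g by (auto simp: l2_def)
  show "(\<lambda>x. cmod (f x) * cmod (g x)) \<in> borel_measurable M"
    using l2_measurable[OF f] l2_measurable[OF g] by measurable
  show "AE x in M. norm (cmod (f x) * cmod (g x)) \<le> norm ((cmod (f x))\<^sup>2 + (cmod (g x))\<^sup>2)"
  proof (rule AE_I2)
    fix x
    have "0 \<le> cmod (f x) * cmod (g x)" by simp
    then show "norm (cmod (f x) * cmod (g x)) \<le> norm ((cmod (f x))\<^sup>2 + (cmod (g x))\<^sup>2)"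
      using two_mult_le_squares[of "cmod (f x)" "cmod (g x)"] by (simp del: mult_nonneg_nonneg)
  qed
qed

lemma l2_product_integrable:
  assumes f: "f \<in> l2 M" and g: "g \<in> l2 M"
  shows "integrable M (\<lambda>x. f x * cnj (g x))"
  using l2_abs_product_integrable[OF assms]
proof (rule Bochner_Integration.integrable_bound)
  have "(\<lambda>x. cnj (g x)) \<in> borel_measurable M"
    using borel_measurable_continuous_on[OF continuous_on_cnj[OF continuous_on_id] l2_measurable[OF g]] .
  then show "(\<lambda>x. f x * cnj (g x)) \<in> borel_measurable M"
    using l2_measurable[OF f] by (intro borel_measurable_times)
qed (auto simp: norm_mult)

lemma l2_add:
  assumes f: "f \<in> l2 M" and g: "g \<in> l2 M"
  shows "(\<lambda>x. f x + g x) \<in> l2 M"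
proof -
  have [measurable]: "f \<in> borel_measurable M" "g \<in> borel_measurable M"
    using f g by (auto simp: l2_def)
  have "integrable M (\<lambda>x. (cmod (f x + g x))\<^sup>2)"
  proof (rule Bochner_Integration.integrable_bound)
    show "integrable M (\<lambda>x. (cmod (f x))\<^sup>2 + (cmod (g x))\<^sup>2 + 2 * (cmod (f x) * cmod (g x)))"
      using f g l2_abs_product_integrable[OF f g] by (auto simp: l2_def)
    show "AE x in M. norm ((cmod (f x + g x))\<^sup>2)
        \<le> norm ((cmod (f x))\<^sup>2 + (cmod (g x))\<^sup>2 + 2 * (cmod (f x) * cmod (g x)))"
    proof (rule AE_I2)
      fix x
      have "(cmod (f x + g x))\<^sup>2 \<le> (cmod (f x) + cmod (g x))\<^sup>2"
        by (intro power_mono norm_triangle_ineq) auto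
      then show "norm ((cmod (f x + g x))\<^sup>2)
        \<le> norm ((cmod (f x))\<^sup>2 + (cmod (g x))\<^sup>2 + 2 * (cmod (f x) * cmod (g x)))"
        by (simp add: power2_sum)
    qed
  qed measurable
  then show ?thesis by (simp add: l2_def)
qed

lemma l2_bounded_mult:
  assumes f: "f \<in> l2 M" and h: "h \<in> borel_measurable M"
    and b: "\<And>x. x \<in> space M \<Longrightarrow> cmod (h x) \<le> B"
  shows "(\<lambda>x. h x * f x) \<in> l2 M"
proof -
  have [measurable]: "f \<in> borel_measurable M" "h \<in> borel_measurable M"
    using f h by (auto simp: l2_def)
  have "integrable M (\<lambda>x. (cmod (h x * f x))\<^sup>2)"
  proof (rule Bochner_Integration.integrable_bound)
    show "integrable M (\<lambda>x. B\<^sup>2 * (cmod (f x))\<^sup>2)"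
      using f by (auto simp: l2_def)
    show "AE x in M. norm ((cmod (h x * f x))\<^sup>2) \<le> norm (B\<^sup>2 * (cmod (f x))\<^sup>2)"
    proof (rule AE_I2)
      fix x assume "x \<in> space M"
      then have "(cmod (h x))\<^sup>2 \<le> B\<^sup>2" using b by (intro power_mono) auto
      then show "norm ((cmod (h x * f x))\<^sup>2) \<le> norm (B\<^sup>2 * (cmod (f x))\<^sup>2)"
        by (simp add: norm_mult power_mult_distrib mult_right_mono)
    qed
  qed measurable
  then show ?thesis by (simp add: l2_def)
qed

lemma l2_scale: "f \<in> l2 M \<Longrightarrow> (\<lambda>x. c * f x) \<in> l2 M"
  by (rule l2_bounded_mult[where B="cmod c"]) auto

lemma l2_diff:
  assumes "f \<in> l2 M" "g \<in> l2 M" shows "(\<lambda>x. f x - g x) \<in> l2 M"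
  using l2_add[OF assms(1) l2_scale[OF assms(2), of "-1"]] by simp

lemma l2_zero [simp]: "(\<lambda>x. 0) \<in> l2 M"
  by (simp add: l2_def)

lemma ip_add_left:
  assumes "f \<in> l2 M" "g \<in> l2 M" "h \<in> l2 M"
  shows "ip M (\<lambda>x. f x + g x) h = ip M f h + ip M g h"
  using assms by (simp add: ip_def distrib_right l2_product_integrable)

lemma ip_diff_left:
  assumes "f \<in> l2 M" "g \<in> l2 M" "h \<in> l2 M"
  shows "ip M (\<lambda>x. f x - g x) h = ip M f h - ip M g h"
  using assms by (simp add: ip_def left_diff_distrib l2_product_integrable)

lemma ip_scale_left: "ip M (\<lambda>x. c * f x) h = c * ip M f h"
  by (simp add: ip_def mult.assoc)

lemma ip_commute: "ip M f g = cnj (ip M g f)"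
proof -
  have "cnj (ip M g f) = (LINT x|M. cnj (g x * cnj (f x)))"
    unfolding ip_def by (rule Bochner_Integration.integral_cnj[symmetric])
  then show ?thesis by (simp add: ip_def mult.commute)
qed

lemma ip_add_right:
  assumes "f \<in> l2 M" "g \<in> l2 M" "h \<in> l2 M"
  shows "ip M h (\<lambda>x. f x + g x) = ip M h f + ip M h g"
  using assms by (simp add: ip_def distrib_left l2_product_integrable)

lemma ip_diff_right:
  assumes "f \<in> l2 M" "g \<in> l2 M" "h \<in> l2 M"
  shows "ip M h (\<lambda>x. f x - g x) = ip M h f - ip M h g"
  using assms by (simp add: ip_def right_diff_distrib l2_product_integrable)

lemma ip_scale_right: "ip M h (\<lambda>x. c * f x) = cnj c * ip M h f"
  using ip_commute[of M h "\<lambda>x. c * f x"] ip_commute[of M f h] by (simp add: ip_scale_left)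

lemma ip_self: "ip M f f = of_real (sq_norm M f)"
  by (simp add: ip_def sq_norm_def complex_norm_square[symmetric] del: of_real_power)

lemma sq_norm_nonneg [simp]: "0 \<le> sq_norm M f"
  by (simp add: sq_norm_def)

lemma sq_norm_minus_commute: "sq_norm M (\<lambda>x. f x - g x) = sq_norm M (\<lambda>x. g x - f x)"
  by (simp add: sq_norm_def norm_minus_commute)

lemma sq_norm_scale: "sq_norm M (\<lambda>x. c * f x) = (cmod c)\<^sup>2 * sq_norm M f"
  by (simp add: sq_norm_def norm_mult power_mult_distrib)

lemma sq_norm_add:
  assumes "f \<in> l2 M" "g \<in> l2 M"
  shows "sq_norm M (\<lambda>x. f x + g x) = sq_norm M f + sq_norm M g + 2 * Re (ip M f g)"
proof -
  have "complex_of_real (sq_norm M (\<lambda>x. f x + g x)) = ip M f f + ip M g g + (ip M f g + ip M g f)"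
    unfolding ip_self[symmetric] using assms by (simp add: ip_add_left ip_add_right l2_add)
  also have "ip M f g + ip M g f = of_real (2 * Re (ip M f g))"
    unfolding ip_commute[of M g f] by (rule complex_add_cnj)
  finally have "complex_of_real (sq_norm M (\<lambda>x. f x + g x))
      = of_real (sq_norm M f + sq_norm M g + 2 * Re (ip M f g))"
    by (simp only: ip_self of_real_add)
  then show ?thesis by (simp only: of_real_eq_iff)
qed

lemma sq_norm_diff:
  assumes "f \<in> l2 M" "g \<in> l2 M"
  shows "sq_norm M (\<lambda>x. f x - g x) = sq_norm M f + sq_norm M g - 2 * Re (ip M f g)"
  using sq_norm_add[OF assms(1) l2_scale[OF assms(2), of "-1"]]
  by (simp only: ip_scale_right sq_norm_scale) simp

lemma parallelogram:
  assumes "f \<in> l2 M" "g \<in> l2 M"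
  shows "sq_norm M (\<lambda>x. f x + g x) + sq_norm M (\<lambda>x. f x - g x) = 2 * sq_norm M f + 2 * sq_norm M g"
  using assms by (simp add: sq_norm_add sq_norm_diff)

lemma sq_norm_add_le:
  assumes "f \<in> l2 M" "g \<in> l2 M"
  shows "sq_norm M (\<lambda>x. f x + g x) \<le> 2 * sq_norm M f + 2 * sq_norm M g"
  using parallelogram[OF assms] sq_norm_nonneg[of M "\<lambda>x. f x - g x"] by linarith

text \<open>The right-hand side \<open>t * a + b / t\<close> has minimum
  \<open>2 * sqrt (a * b)\<close>, attained at the square root of \<open>b / a\<close>. If
  \<open>a\<close> or \<open>b\<close> vanishes there is no minimiser, and a sufficiently large or
  small \<open>t\<close> is used instead.\<close>

lemma le_sqrt_mult_sqrt:
  fixes I a b :: real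
  assumes *: "\<And>t. 0 < t \<Longrightarrow> 2 * I \<le> t * a + b / t" and "0 \<le> a" "0 \<le> b"
  shows "I \<le> sqrt a * sqrt b"
proof (cases "a = 0 \<or> b = 0")
  case True
  have "I \<le> 0"
  proof (rule ccontr)
    assume "\<not> I \<le> 0"
    then have I: "0 < I" by simp
    show False
    proof (cases "a = 0")
      case a: True
      \<comment> \<open>With \<open>a = 0\<close> only \<open>b / t\<close> remains, and this large
        \<open>t\<close> pushes it below \<open>I\<close>.\<close>
      have pos: "0 < b / I + 1" using I \<open>0 \<le> b\<close> by (simp add: add_nonneg_pos)
      have "b / (b / I + 1) < I" using pos I by (simp add: field_simps)
      then show False using *[OF pos] a I by simp
    next
      case False
      with True have b: "b = 0" by simp
      \<comment> \<open>With \<open>b = 0\<close> only \<open>t * a\<close> remains, and this small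
        \<open>t\<close> pushes it below \<open>I\<close>.\<close>
      have pos: "0 < I / (a + 1)" using I \<open>0 \<le> a\<close> by simp
      have "I / (a + 1) * a < I" using I \<open>0 \<le> a\<close> by (simp add: field_simps)
      then show False using *[OF pos] b I by simp
    qed
  qed
  with assms show ?thesis by (meson mult_nonneg_nonneg order_trans real_sqrt_ge_zero)
next
  case False
  then have ab: "0 < a" "0 < b" using assms by auto
  have "2 * I \<le> (sqrt b / sqrt a) * a + b / (sqrt b / sqrt a)" using ab by (intro *) auto
  also have "(sqrt b / sqrt a) * a = sqrt a * sqrt b"
    using ab by (simp add: field_simps)
  also have "b / (sqrt b / sqrt a) = sqrt a * sqrt b"
    using ab by (simp add: field_simps)
  finally show ?thesis by simp
qed

text \<open>Cauchy-Schwarz from the weighted inequality between arithmetic and geometric mean,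
  integrated with a free weight \<open>t\<close> and then optimised.\<close>

lemma integral_abs_product_le:
  assumes f: "f \<in> l2 M" and g: "g \<in> l2 M"
  shows "(LINT x|M. cmod (f x) * cmod (g x)) \<le> sqrt (sq_norm M f) * sqrt (sq_norm M g)"
proof (rule le_sqrt_mult_sqrt)
  fix t :: real assume t: "0 < t"
  have "(LINT x|M. 2 * (cmod (f x) * cmod (g x))) \<le> (LINT x|M. t * (cmod (f x))\<^sup>2 + (cmod (g x))\<^sup>2 / t)"
  proof (rule integral_mono)
    fix x
    have "2 * ((sqrt t * cmod (f x)) * (cmod (g x) / sqrt t)) \<le> (sqrt t * cmod (f x))\<^sup>2 + (cmod (g x) / sqrt t)\<^sup>2"
      by (rule two_mult_le_squares)
    then show "2 * (cmod (f x) * cmod (g x)) \<le> t * (cmod (f x))\<^sup>2 + (cmod (g x))\<^sup>2 / t"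
      using t by (simp add: power_mult_distrib power_divide)
  qed (use l2_abs_product_integrable[OF f g] f g in \<open>auto simp: l2_def\<close>)
  then show "2 * (LINT x|M. cmod (f x) * cmod (g x)) \<le> t * sq_norm M f + sq_norm M g / t"
    using f g by (simp add: sq_norm_def l2_def)
qed auto

lemma cauchy_schwarz:
  assumes f: "f \<in> l2 M" and g: "g \<in> l2 M"
  shows "cmod (ip M f g) \<le> sqrt (sq_norm M f) * sqrt (sq_norm M g)"
proof -
  have "cmod (ip M f g) \<le> (LINT x|M. cmod (f x * cnj (g x)))"
    unfolding ip_def by (rule integral_norm_bound)
  then show ?thesis using integral_abs_product_le[OF assms] by (simp add: norm_mult)
qed

lemma ip_tendsto:
  assumes x: "\<And>n. x n \<in> l2 M" and y: "\<And>n. y n \<in> l2 M"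
    and lim: "(\<lambda>n. sq_norm M (x n)) \<longlonglongrightarrow> 0" and bnd: "\<And>n. sq_norm M (y n) \<le> C"
  shows "(\<lambda>n. ip M (x n) (y n)) \<longlonglongrightarrow> 0"
proof (rule Lim_null_comparison)
  show "(\<lambda>n. sqrt (sq_norm M (x n)) * sqrt C) \<longlonglongrightarrow> 0"
    using tendsto_mult_left_zero[OF tendsto_real_sqrt[OF lim, simplified]] by simp
  show "\<forall>\<^sub>F n in sequentially. cmod (ip M (x n) (y n)) \<le> sqrt (sq_norm M (x n)) * sqrt C"
  proof (rule always_eventually, rule allI)
    fix n
    have "cmod (ip M (x n) (y n)) \<le> sqrt (sq_norm M (x n)) * sqrt (sq_norm M (y n))"
      by (rule cauchy_schwarz[OF x y])
    also have "\<dots> \<le> sqrt (sq_norm M (x n)) * sqrt C"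
      using bnd by (intro mult_left_mono) auto
    finally show "cmod (ip M (x n) (y n)) \<le> sqrt (sq_norm M (x n)) * sqrt C" .
  qed
qed

lemma sq_norm_add_tendsto:
  assumes a: "a \<in> l2 M" and b: "\<And>n. b n \<in> l2 M" and lim: "(\<lambda>n. sq_norm M (b n)) \<longlonglongrightarrow> 0"
  shows "(\<lambda>n. sq_norm M (\<lambda>x. a x + b n x)) \<longlonglongrightarrow> sq_norm M a"
proof -
  have "(\<lambda>n. ip M (b n) a) \<longlonglongrightarrow> 0"
    by (rule ip_tendsto[OF b a lim order_refl])
  from tendsto_Re[OF tendsto_cnj[OF this]] have "(\<lambda>n. Re (ip M a (b n))) \<longlonglongrightarrow> 0"
    by (simp flip: ip_commute)
  from tendsto_add[OF tendsto_add[OF tendsto_const[of "sq_norm M a"] lim] tendsto_mult_left[OF this, of 2]]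
  show ?thesis using a b by (simp add: sq_norm_add)
qed

section \<open>Orthogonal projection and limits\<close>

lemma ip_zero_of_minimal:
  assumes f: "f \<in> l2 M" and u: "u \<in> l2 M"
    and min: "\<And>c. sq_norm M f \<le> sq_norm M (\<lambda>x. f x + c * u x)"
  shows "ip M f u = 0"
proof (rule ccontr)
  assume nz: "ip M f u \<noteq> 0"
  \<comment> \<open>Moving \<open>f\<close> by \<open>c * u\<close> gains \<open>2 t\<close> and
    loses at most \<open>t * (t * sq_norm M u)\<close>, both times the squared modulus of
    \<open>ip M f u\<close>. This \<open>t\<close> keeps the loss below the gain, also when
    \<open>u\<close> has norm zero.\<close>
  define t where "t = 1 / (sq_norm M u + 1)"
  have t: "0 < t" "t * sq_norm M u < 1"
    using sq_norm_nonneg[of M u] by (auto simp: t_def add_nonneg_pos divide_less_eq)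
  define c where "c = - (of_real t * ip M f u)"
  have "sq_norm M (\<lambda>x. f x + c * u x) = sq_norm M f + (cmod c)\<^sup>2 * sq_norm M u + 2 * Re (cnj c * ip M f u)"
    using f u by (simp add: sq_norm_add l2_scale sq_norm_scale ip_scale_right)
  also have "(cmod c)\<^sup>2 = t * t * (cmod (ip M f u))\<^sup>2"
    using t by (simp add: c_def norm_mult power_mult_distrib power2_eq_square)
  also have "cnj c * ip M f u = of_real (- t * (cmod (ip M f u))\<^sup>2)"
    by (simp add: c_def complex_norm_square mult.commute mult.left_commute del: of_real_power)
  finally have "sq_norm M (\<lambda>x. f x + c * u x)
      = sq_norm M f - t * (cmod (ip M f u))\<^sup>2 * (2 - t * sq_norm M u)"
    by (simp add: algebra_simps)
  moreover have "0 < t * (cmod (ip M f u))\<^sup>2 * (2 - t * sq_norm M u)"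
    using t nz by auto
  ultimately show False using min[of c] by simp
qed

text \<open>The nearest point of \<open>S\<close> is the projection. Completeness is assumed for
  \<open>S\<close> itself: its elements are functions, not classes, and the limit has to be produced
  as an honest member of \<open>S\<close>.\<close>

lemma projection_exists:
  assumes S: "S \<subseteq> l2 M" and zero: "(\<lambda>x. 0) \<in> S"
    and add: "\<And>f g. f \<in> S \<Longrightarrow> g \<in> S \<Longrightarrow> (\<lambda>x. f x + g x) \<in> S"
    and scale: "\<And>c f. f \<in> S \<Longrightarrow> (\<lambda>x. c * f x) \<in> S"
    and complete: "\<And>F. (\<And>n::nat. F n \<in> S) \<Longrightarrow>
       (\<And>e. 0 < e \<Longrightarrow> \<exists>N. \<forall>m\<ge>N. \<forall>n\<ge>N. sq_norm M (\<lambda>x. F m x - F n x) < e) \<Longrightarrow>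
       \<exists>p\<in>S. (\<lambda>n. sq_norm M (\<lambda>x. F n x - p x)) \<longlonglongrightarrow> 0"
    and f: "f \<in> l2 M"
  shows "\<exists>p\<in>S. \<forall>u\<in>S. ip M (\<lambda>x. f x - p x) u = 0"
proof -
  define d where "d = (INF p\<in>S. sq_norm M (\<lambda>x. f x - p x))"
  have bdd: "bdd_below ((\<lambda>p. sq_norm M (\<lambda>x. f x - p x)) ` S)" by (rule bdd_belowI2[of _ 0]) auto
  have d_le: "d \<le> sq_norm M (\<lambda>x. f x - p x)" if "p \<in> S" for p
    unfolding d_def using bdd that by (rule cINF_lower)
  have "\<exists>p\<in>S. sq_norm M (\<lambda>x. f x - p x) < d + 1 / Suc n" for n
    using zero bdd unfolding d_def by (subst cINF_less_iff[symmetric]) auto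
  then obtain P where P: "\<And>n. P n \<in> S" "\<And>n. sq_norm M (\<lambda>x. f x - P n x) < d + 1 / Suc n"
    by metis
  have l2P [simp]: "P n \<in> l2 M" for n using P S by auto
  \<comment> \<open>A minimising sequence is Cauchy: the midpoint of two members lies in
    \<open>S\<close> and is no closer than \<open>d\<close>, so the parallelogram law bounds their
    difference by the two excesses over \<open>d\<close>.\<close>
  have est: "sq_norm M (\<lambda>x. P m x - P n x) < 2 / Suc m + 2 / Suc n" for m n
  proof -
    have "(\<lambda>x. (1/2) * (P m x + P n x)) \<in> S" by (intro scale add P)
    from d_le[OF this] have "4 * d \<le> 4 * sq_norm M (\<lambda>x. f x - (1/2) * (P m x + P n x))" by simp
    also have "\<dots> = sq_norm M (\<lambda>x. 2 * (f x - (1/2) * (P m x + P n x)))"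
      by (simp only: sq_norm_scale) simp
    also have "(\<lambda>x. 2 * (f x - (1/2) * (P m x + P n x))) = (\<lambda>x. (f x - P n x) + (f x - P m x))"
      by (auto simp: algebra_simps)
    finally have "4 * d \<le> sq_norm M (\<lambda>x. (f x - P n x) + (f x - P m x))" .
    moreover have "sq_norm M (\<lambda>x. (f x - P n x) + (f x - P m x)) + sq_norm M (\<lambda>x. (f x - P n x) - (f x - P m x))
        = 2 * sq_norm M (\<lambda>x. f x - P n x) + 2 * sq_norm M (\<lambda>x. f x - P m x)"
      by (rule parallelogram) (auto intro: l2_diff f)
    moreover have "(\<lambda>x. (f x - P n x) - (f x - P m x)) = (\<lambda>x. P m x - P n x)" by auto
    ultimately show ?thesis using P(2)[of m] P(2)[of n] by simp
  qed
  have "\<exists>N. \<forall>m\<ge>N. \<forall>n\<ge>N. sq_norm M (\<lambda>x. P m x - P n x) < e" if e: "0 < e" for e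
  proof -
    obtain N where N: "4 / e < real (Suc N)"
      using reals_Archimedean2[of "4 / e"] by (meson less_trans lessI of_nat_less_iff)
    have "sq_norm M (\<lambda>x. P m x - P n x) < e" if "m \<ge> N" "n \<ge> N" for m n
    proof -
      have "2 / real (Suc m) \<le> 2 / Suc N" "2 / real (Suc n) \<le> 2 / Suc N"
        using that by (auto simp: frac_le)
      moreover have "4 / real (Suc N) < e" using N e by (simp add: field_simps)
      ultimately show ?thesis using est[of m n] by linarith
    qed
    then show ?thesis by blast
  qed
  from complete[OF P(1) this] obtain p where p: "p \<in> S"
    and lim: "(\<lambda>n. sq_norm M (\<lambda>x. P n x - p x)) \<longlonglongrightarrow> 0" by auto
  have l2p: "p \<in> l2 M" using p S by auto
  have "(\<lambda>n. sq_norm M (\<lambda>x. (f x - p x) + (p x - P n x))) \<longlonglongrightarrow> sq_norm M (\<lambda>x. f x - p x)"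
    using lim by (intro sq_norm_add_tendsto l2_diff f l2p l2P) (simp add: sq_norm_minus_commute)
  moreover have "(\<lambda>n. d + 1 / Suc n) \<longlonglongrightarrow> d + 0"
    using LIMSEQ_inverse_real_of_nat by (intro tendsto_intros) (simp add: inverse_eq_divide)
  ultimately have "sq_norm M (\<lambda>x. f x - p x) \<le> d + 0"
    by (rule LIMSEQ_le) (use P(2) less_imp_le in auto)
  then have min: "sq_norm M (\<lambda>x. f x - p x) \<le> sq_norm M (\<lambda>x. f x - q x)" if "q \<in> S" for q
    using d_le[OF that] by simp
  have "ip M (\<lambda>x. f x - p x) u = 0" if u: "u \<in> S" for u
  proof (rule ip_zero_of_minimal)
    fix c
    have "(\<lambda>x. p x + (- c) * u x) \<in> S" by (intro add scale p u)
    from min[OF this] show "sq_norm M (\<lambda>x. f x - p x) \<le> sq_norm M (\<lambda>x. f x - p x + c * u x)"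
      by (simp add: algebra_simps)
  qed (use u S f l2p in \<open>auto intro: l2_diff\<close>)
  with p show ?thesis by blast
qed

text \<open>Fatou's lemma in the second index: the distance from \<open>F n\<close> to the pointwise
  limit is at most the lower limit of the distances from \<open>F n\<close> to \<open>F m\<close>.
  Convergence at every point is assumed because holomorphic functions will provide it.\<close>

lemma l2_limit:
  assumes F: "\<And>n::nat. F n \<in> l2 M"
    and cauchy: "\<And>e. 0 < e \<Longrightarrow> \<exists>N. \<forall>m\<ge>N. \<forall>n\<ge>N. sq_norm M (\<lambda>x. F m x - F n x) < e"
    and lim: "\<And>x. x \<in> space M \<Longrightarrow> (\<lambda>n. F n x) \<longlonglongrightarrow> p x"
  shows "p \<in> l2 M" and "(\<lambda>n. sq_norm M (\<lambda>x. F n x - p x)) \<longlonglongrightarrow> 0"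
proof -
  have Fm [measurable]: "F n \<in> borel_measurable M" for n using F by (auto simp: l2_def)
  have [measurable]: "p \<in> borel_measurable M"
    by (rule borel_measurable_LIMSEQ_metric[OF Fm lim])
  have est: "(\<integral>\<^sup>+x. ennreal ((cmod (F n x - p x))\<^sup>2) \<partial>M) \<le> ennreal e"
    if N: "\<forall>m\<ge>N. \<forall>n\<ge>N. sq_norm M (\<lambda>x. F m x - F n x) < e" and n: "n \<ge> N" for n N e
  proof -
    have "(\<integral>\<^sup>+x. ennreal ((cmod (F n x - p x))\<^sup>2) \<partial>M)
        = (\<integral>\<^sup>+x. liminf (\<lambda>m. ennreal ((cmod (F n x - F m x))\<^sup>2)) \<partial>M)"
    proof (rule nn_integral_cong)
      fix x assume "x \<in> space M"
      then have "(\<lambda>m. ennreal ((cmod (F n x - F m x))\<^sup>2)) \<longlonglongrightarrow> ennreal ((cmod (F n x - p x))\<^sup>2)"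
        by (intro tendsto_intros lim tendsto_ennrealI)
      then show "ennreal ((cmod (F n x - p x))\<^sup>2) = liminf (\<lambda>m. ennreal ((cmod (F n x - F m x))\<^sup>2))"
        by (intro lim_imp_Liminf[symmetric] trivial_limit_sequentially)
    qed
    also have "\<dots> \<le> liminf (\<lambda>m. \<integral>\<^sup>+x. ennreal ((cmod (F n x - F m x))\<^sup>2) \<partial>M)"
      by (rule nn_integral_liminf) measurable
    also have "\<dots> \<le> ennreal e"
    proof (rule Liminf_le)
      show "\<forall>\<^sub>F m in sequentially. (\<integral>\<^sup>+x. ennreal ((cmod (F n x - F m x))\<^sup>2) \<partial>M) \<le> ennreal e"
      proof (rule eventually_sequentiallyI[of N])
        fix m assume "N \<le> m"
        have "(\<integral>\<^sup>+x. ennreal ((cmod (F n x - F m x))\<^sup>2) \<partial>M) = ennreal (sq_norm M (\<lambda>x. F n x - F m x))"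
          unfolding sq_norm_def by (rule nn_integral_eq_integral) (auto intro!: l2_integrable l2_diff F)
        also have "\<dots> \<le> ennreal e"
          using N \<open>N \<le> m\<close> n by (intro ennreal_leI) (auto intro: less_imp_le)
        finally show "(\<integral>\<^sup>+x. ennreal ((cmod (F n x - F m x))\<^sup>2) \<partial>M) \<le> ennreal e" .
      qed
    qed simp
    finally show ?thesis .
  qed
  have l2d: "(\<lambda>x. F n x - p x) \<in> l2 M" and le: "sq_norm M (\<lambda>x. F n x - p x) \<le> e"
    if N: "\<forall>m\<ge>N. \<forall>n\<ge>N. sq_norm M (\<lambda>x. F m x - F n x) < e" and n: "n \<ge> N" and e: "0 < e" for n N e
  proof -
    have "(\<integral>\<^sup>+x. ennreal ((cmod (F n x - p x))\<^sup>2) \<partial>M) < \<infinity>"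
      using est[OF N n] by (rule le_less_trans) simp
    then have i: "integrable M (\<lambda>x. (cmod (F n x - p x))\<^sup>2)"
      by (intro integrableI_bounded) auto
    then show "(\<lambda>x. F n x - p x) \<in> l2 M" by (simp add: l2_def)
    have "ennreal (sq_norm M (\<lambda>x. F n x - p x)) \<le> ennreal e"
      using est[OF N n] i unfolding sq_norm_def by (subst nn_integral_eq_integral[symmetric]) auto
    then show "sq_norm M (\<lambda>x. F n x - p x) \<le> e" using e by simp
  qed
  obtain N where N: "\<forall>m\<ge>N. \<forall>n\<ge>N. sq_norm M (\<lambda>x. F m x - F n x) < 1" using cauchy[of 1] by auto
  from l2_diff[OF F l2d[OF N order_refl zero_less_one], of N] show "p \<in> l2 M" by simp
  show "(\<lambda>n. sq_norm M (\<lambda>x. F n x - p x)) \<longlonglongrightarrow> 0"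
  proof (rule LIMSEQ_I)
    fix r :: real assume r: "0 < r"
    then obtain N where N: "\<forall>m\<ge>N. \<forall>n\<ge>N. sq_norm M (\<lambda>x. F m x - F n x) < r / 2"
      using cauchy[of "r / 2"] by auto
    have "norm (sq_norm M (\<lambda>x. F n x - p x) - 0) < r" if "n \<ge> N" for n
      using le[OF N that] r by simp
    then show "\<exists>no. \<forall>n\<ge>no. norm (sq_norm M (\<lambda>x. F n x - p x) - 0) < r" by blast
  qed
qed

text \<open>The hypothesis says that \<open>- b\<close> is the orthogonal projection of
  \<open>y\<close> onto the line through \<open>b\<close>. It will bound an unknown Bergman
  component by a known small function.\<close>

lemma sq_norm_minus_orthogonal_le:
  assumes y: "y \<in> l2 M" and b: "b \<in> l2 M" and orth: "ip M (\<lambda>x. y x + b x) b = 0"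
  shows "sq_norm M b \<le> sq_norm M y"
proof -
  have e: "ip M y b + ip M b b = 0" using orth y b by (simp add: ip_add_left)
  have "0 \<le> sq_norm M (\<lambda>x. y x + b x)" by simp
  also have "\<dots> = sq_norm M y + sq_norm M b + 2 * Re (ip M y b)" using y b by (rule sq_norm_add)
  also have "ip M y b = of_real (- sq_norm M b)" using e by (simp add: ip_self eq_neg_iff_add_eq_0)
  finally show ?thesis by simp
qed

section \<open>Circle means\<close>

abbreviation cis1 :: "real \<Rightarrow> complex" where
  "cis1 t \<equiv> cis (2 * pi * t)"

text \<open>Normalised arc length on the unit circle, written as a Lebesgue integral over a
  parameter so that it can be interchanged with area integrals.\<close>

definition circle_mean :: "(complex \<Rightarrow> complex) \<Rightarrow> complex" where
  "circle_mean f = (LINT t|lb {0..1}. f (cis1 t))"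

lemma continuous_on_cis1 [continuous_intros]: "continuous_on S cis1"
  by (intro continuous_intros)

lemma continuous_on_circle_compose:
  assumes "continuous_on (sphere 0 1) f" shows "continuous_on S (\<lambda>t. f (cis1 t))"
  by (rule continuous_on_compose2[OF assms continuous_on_cis1]) auto

lemma continuous_on_pair_compose:
  assumes "continuous_on (S \<times> T) (\<lambda>(x, y). f x y)" "continuous_on R g" "continuous_on R h"
    "\<And>x. x \<in> R \<Longrightarrow> g x \<in> S" "\<And>x. x \<in> R \<Longrightarrow> h x \<in> T"
  shows "continuous_on R (\<lambda>x. f (g x) (h x))"
  using continuous_on_compose2[OF assms(1) continuous_on_Pair[OF assms(2,3)]] assms(4,5) by auto

lemma circle_mean_integrable:
  fixes f :: "complex \<Rightarrow> complex"
  assumes "continuous_on (sphere 0 1) f" shows "integrable (lb {0..1}) (\<lambda>t. f (cis1 t))"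
  using borel_integrable_atLeastAtMost'[OF continuous_on_circle_compose[OF assms, of "{0..1}"]]
  by (simp add: set_integrable_def integrable_restrict_space)

lemma circle_mean_eq_integral:
  assumes "continuous_on (sphere 0 1) f"
  shows "circle_mean f = integral {0..1} (\<lambda>t. f (cis1 t))"
  using set_borel_integral_eq_integral(2)[OF
      borel_integrable_atLeastAtMost'[OF continuous_on_circle_compose[OF assms, of "{0..1}"]]]
  by (simp add: circle_mean_def integral_lb set_lebesgue_integral_def)

lemma circle_mean_add:
  assumes "continuous_on (sphere 0 1) f" "continuous_on (sphere 0 1) g"
  shows "circle_mean (\<lambda>w. f w + g w) = circle_mean f + circle_mean g"
  unfolding circle_mean_def using assms by (intro Bochner_Integration.integral_add circle_mean_integrable)

lemma circle_mean_diff: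
  assumes "continuous_on (sphere 0 1) f" "continuous_on (sphere 0 1) g"
  shows "circle_mean (\<lambda>w. f w - g w) = circle_mean f - circle_mean g"
  unfolding circle_mean_def using assms by (intro Bochner_Integration.integral_diff circle_mean_integrable)

lemma circle_mean_mult_left: "circle_mean (\<lambda>w. c * f w) = c * circle_mean f"
  unfolding circle_mean_def by simp

lemma circle_mean_mult_right: "circle_mean (\<lambda>w. f w * c) = circle_mean f * c"
  unfolding circle_mean_def by simp

lemma circle_mean_cnj: "circle_mean (\<lambda>w. cnj (f w)) = cnj (circle_mean f)"
  unfolding circle_mean_def by (rule Bochner_Integration.integral_cnj)

lemma circle_mean_cong: "(\<And>w. cmod w = 1 \<Longrightarrow> f w = g w) \<Longrightarrow> circle_mean f = circle_mean g"
  unfolding circle_mean_def by simp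

lemma circle_mean_const [simp]: "circle_mean (\<lambda>w. c) = c"
  unfolding circle_mean_def by (simp add: measure_restrict_space)

lemma circle_mean_uminus: "circle_mean (\<lambda>w. - f w) = - circle_mean f"
  unfolding circle_mean_def by simp

text \<open>A rotation shifts the parameter by \<open>s\<close>; the piece that leaves the unit
  interval is brought back by periodicity.\<close>

lemma circle_mean_rotate:
  assumes f: "continuous_on (sphere 0 1) f" and a: "cmod a = 1"
  shows "circle_mean (\<lambda>w. f (a * w)) = circle_mean f"
proof -
  define g where "g t = f (cis1 t)" for t
  have g: "continuous_on S g" for S
    unfolding g_def using f by (rule continuous_on_circle_compose)
  have per: "g (t + 1) = g t" for t
    by (simp add: g_def distrib_left cis_mult[symmetric])
  define s where "s = Arg2pi a / (2 * pi)"
  have s: "0 \<le> s" "s < 1" using Arg2pi[of a] by (auto simp: s_def)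
  have as: "a = cis1 s"
    using Arg2pi_eq[of a] a by (simp add: s_def cis_conv_exp)
  have "continuous_on (sphere 0 1) (\<lambda>w. f (a * w))"
    by (rule continuous_on_compose2[OF f]) (auto intro!: continuous_intros simp: norm_mult a)
  then have "circle_mean (\<lambda>w. f (a * w)) = integral {0..1} (\<lambda>t. f (a * cis1 t))"
    by (rule circle_mean_eq_integral)
  also have "\<dots> = integral {0..1} (\<lambda>t. g (t + s))"
    by (simp add: as g_def cis_mult distrib_left add.commute)
  also have "\<dots> = integral {s..1 + s} g"
    using integral_shift_real_ivl[of s s "1 + s" g] by simp
  also have "\<dots> = integral {s..1} g + integral {1..1 + s} g"
    by (rule Henstock_Kurzweil_Integration.integral_combine[symmetric])
      (use s g in \<open>auto intro: integrable_continuous_interval\<close>)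
  also have "integral {1..1 + s} g = integral {0..s} (\<lambda>t. g (t + 1))"
    using integral_shift_real_ivl[of 1 1 "1 + s" g] by simp
  also have "\<dots> = integral {0..s} g" by (simp add: per)
  also have "integral {s..1} g + integral {0..s} g = integral {0..1} g"
    by (subst add.commute, rule Henstock_Kurzweil_Integration.integral_combine)
      (use s g in \<open>auto intro: integrable_continuous_interval\<close>)
  also have "\<dots> = circle_mean f" using f by (simp add: circle_mean_eq_integral g_def[abs_def])
  finally show ?thesis .
qed

lemma continuous_on_circle_mean_param:
  fixes f :: "'a::topological_space \<Rightarrow> complex \<Rightarrow> complex"
  assumes f: "continuous_on (S \<times> sphere 0 1) (\<lambda>(x, w). f x w)"
  shows "continuous_on S (\<lambda>x. circle_mean (f x))"
proof -
  have c: "continuous_on (sphere 0 1) (f x)" if "x \<in> S" for x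
    by (rule continuous_on_pair_compose[OF f]) (auto intro!: continuous_intros that)
  have "continuous_on (S \<times> cbox 0 1) (\<lambda>(x, t). f x (cis1 t))"
    unfolding case_prod_beta
    by (rule continuous_on_pair_compose[OF f]) (auto intro!: continuous_intros)
  then have "continuous_on S (\<lambda>x. integral (cbox 0 1) (\<lambda>t. f x (cis1 t)))"
    by (rule integral_continuous_on_param)
  then show ?thesis
    by (rule continuous_on_eq) (simp add: circle_mean_eq_integral c cbox_interval)
qed

lemma circle_mean_swap:
  assumes f: "continuous_on (sphere 0 1 \<times> sphere 0 1) (\<lambda>(x, w). f x w)"
  shows "circle_mean (\<lambda>a. circle_mean (\<lambda>b. f a b)) = circle_mean (\<lambda>b. circle_mean (\<lambda>a. f a b))"
proof -
  have f': "continuous_on (sphere 0 1 \<times> sphere 0 1) (\<lambda>(b, a). f a b)"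
    unfolding case_prod_beta
    by (rule continuous_on_pair_compose[OF f]) (auto intro!: continuous_intros)
  have c: "continuous_on (sphere 0 1) (\<lambda>b. f a b)" if "cmod a = 1" for a
    by (rule continuous_on_pair_compose[OF f]) (auto intro!: continuous_intros simp: that)
  have c': "continuous_on (sphere 0 1) (\<lambda>a. f a b)" if "cmod b = 1" for b
    by (rule continuous_on_pair_compose[OF f]) (auto intro!: continuous_intros simp: that)
  have "continuous_on (cbox (0::real,0::real) (1,1)) (\<lambda>(s, t). f (cis1 s) (cis1 t))"
    unfolding case_prod_beta
    by (rule continuous_on_pair_compose[OF f]) (auto intro!: continuous_intros)
  from integral_swap_continuous[OF this]
  have "integral {0..1} (\<lambda>s. integral {0..1} (\<lambda>t. f (cis1 s) (cis1 t)))
      = integral {0..1} (\<lambda>t. integral {0..1} (\<lambda>s. f (cis1 s) (cis1 t)))"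
    by (simp add: cbox_interval)
  then show ?thesis
    by (simp add: circle_mean_eq_integral c c' continuous_on_circle_mean_param[OF f] continuous_on_circle_mean_param[OF f'])
qed

text \<open>Cauchy's formula evaluated at the centre, where the kernel \<open>1 / (u - z)\<close>
  cancels the velocity of the circle up to a constant.\<close>

lemma circle_mean_mean_value:
  assumes c: "continuous_on (cball z r) f" and h: "f holomorphic_on ball z r" and r: "0 < r"
  shows "circle_mean (\<lambda>w. f (z + of_real r * w)) = f z"
proof -
  have cc: "continuous_on (sphere 0 1) (\<lambda>w. f (z + of_real r * w))"
    by (rule continuous_on_compose2[OF c])
      (use r in \<open>auto intro!: continuous_intros simp: dist_norm norm_mult\<close>)
  have cp: "circlepath z r t = z + r * cis1 t"
    "vector_derivative (circlepath z r) (at t) = 2 * of_real pi * \<i> * r * cis1 t" for t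
    by (simp add: circlepath cis_conv_exp mult_ac) (simp add: vector_derivative_circlepath cis_conv_exp mult_ac)
  have "((\<lambda>u. f u / (u - z)) has_contour_integral (2 * of_real pi * \<i> * f z)) (circlepath z r)"
    using Cauchy_integral_circlepath[OF c h, of z] r by simp
  then have "((\<lambda>t. (f (z + r * cis1 t) / (r * cis1 t)) * (2 * of_real pi * \<i> * r * cis1 t))
      has_integral (2 * of_real pi * \<i> * f z)) {0..1}"
    by (simp add: has_contour_integral cp)
  then have "((\<lambda>t. (2 * of_real pi * \<i>) * f (z + r * cis1 t)) has_integral (2 * of_real pi * \<i> * f z)) {0..1}"
    by (rule has_integral_eq[rotated]) (use r in auto)
  from has_integral_mult_right[OF this, of "1 / (2 * of_real pi * \<i>)"]
  have "((\<lambda>t. f (z + r * cis1 t)) has_integral f z) {0..1}"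
    by simp
  then show ?thesis
    using cc by (simp add: circle_mean_eq_integral integral_unique)
qed

text \<open>Rotating by some \<open>a\<close> with \<open>a powi d = -1\<close> leaves the mean
  unchanged and changes its sign.\<close>

lemma circle_mean_powi:
  assumes "d \<noteq> 0" shows "circle_mean (\<lambda>w. w powi d) = 0"
proof -
  define a where "a = cis (pi / of_int d)"
  have ad: "a powi d = -1"
    using assms by (simp add: a_def cis_power_int)
  have c: "continuous_on (sphere 0 1) (\<lambda>w. w powi d :: complex)"
    by (intro continuous_intros) auto
  have "circle_mean (\<lambda>w. (a * w) powi d) = circle_mean (\<lambda>w. w powi d)"
    using c by (rule circle_mean_rotate) (simp add: a_def)
  then have "- circle_mean (\<lambda>w. w powi d) = circle_mean (\<lambda>w. w powi d)"
    by (simp add: power_int_mult_distrib circle_mean_mult_left circle_mean_uminus ad)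
  then show ?thesis by simp
qed

lemma borel_measurable_lb_pair:
  fixes S :: "'a::euclidean_space set" and T :: "'b::euclidean_space set"
    and f :: "'a \<times> 'b \<Rightarrow> complex"
  assumes "S \<in> sets borel" "T \<in> sets borel" "continuous_on (S \<times> T) f"
  shows "f \<in> borel_measurable (lb S \<Otimes>\<^sub>M lb T)"
  using assms by (simp add: pair_lb borel_measurable_lb)

text \<open>The circle has finite measure, so a bound on the integrals over \<open>S\<close> that is
  uniform in \<open>w\<close> already yields joint integrability.\<close>

lemma circle_mean_fubini:
  fixes S :: "'a::euclidean_space set"
  assumes S: "S \<in> sets borel"
    and f: "continuous_on (sphere 0 1 \<times> S) (\<lambda>(w, x). f w x)"
    and int: "\<And>w. cmod w = 1 \<Longrightarrow> integrable (lb S) (f w)"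
    and bnd: "\<And>w. cmod w = 1 \<Longrightarrow> (LINT x|lb S. cmod (f w x)) \<le> B"
  shows "circle_mean (\<lambda>w. LINT x|lb S. f w x) = (LINT x|lb S. circle_mean (\<lambda>w. f w x))"
    and "integrable (lb S) (\<lambda>x. circle_mean (\<lambda>w. f w x))"
proof -
  interpret I: finite_measure "lb {0..1::real}" by (rule finite_measure_lb) auto
  interpret S: sigma_finite_measure "lb S" using S by (rule sigma_finite_lb)
  interpret P: pair_sigma_finite "lb {0..1::real}" "lb S" ..
  have "continuous_on ({0..1} \<times> S) (\<lambda>(t, x). f (cis1 t) x)"
    unfolding case_prod_beta
    by (rule continuous_on_pair_compose[OF f]) (auto intro!: continuous_intros)
  then have meas [measurable]: "(\<lambda>(t, x). f (cis1 t) x) \<in> borel_measurable (lb {0..1} \<Otimes>\<^sub>M lb S)"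
    using S by (intro borel_measurable_lb_pair) auto
  have "integrable (lb {0..1}) (\<lambda>t. LINT x|lb S. norm ((\<lambda>(t, x). f (cis1 t) x) (t, x)))"
  proof (rule I.integrable_const_bound[where B=B])
    show "AE t in lb {0..1}. norm (LINT x|lb S. norm ((\<lambda>(t, x). f (cis1 t) x) (t, x))) \<le> B"
      using bnd by auto
  qed measurable
  then have int: "integrable (lb {0..1} \<Otimes>\<^sub>M lb S) (\<lambda>(t, x). f (cis1 t) x)"
    by (intro P.Fubini_integrable meas AE_I2) (simp_all add: int)
  from P.Fubini_integral[OF int] show "circle_mean (\<lambda>w. LINT x|lb S. f w x) = (LINT x|lb S. circle_mean (\<lambda>w. f w x))"
    by (simp add: circle_mean_def)
  from P.integrable_snd[OF int] show "integrable (lb S) (\<lambda>x. circle_mean (\<lambda>w. f w x))"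
    by (simp add: circle_mean_def)
qed

text \<open>Rotational averaging takes the place of polar coordinates: the integral over the centred
  ball is invariant under rotation, hence equals its own average over all rotations; after
  interchange the inner mean is the value at the centre.\<close>

lemma integral_ball_mean_value:
  assumes h: "f holomorphic_on ball a r" and r: "0 < r" and int: "integrable (lb (ball a r)) f"
  shows "integral\<^sup>L (lb (ball a r)) f = f a * measure lborel (ball a r)"
proof -
  define g where "g = (\<lambda>z. f (a + z))"
  have g: "g holomorphic_on ball 0 r"
  proof -
    have "f \<circ> (\<lambda>z. a + z) holomorphic_on ball 0 r"
      by (rule holomorphic_on_compose_gen[OF _ h]) (auto intro!: holomorphic_intros simp: dist_norm)
    then show ?thesis by (simp add: o_def g_def)
  qed
  have gc: "continuous_on (ball 0 r) g" using g by (rule holomorphic_on_imp_continuous_on)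
  have gm: "g \<in> borel_measurable (lb (ball 0 r))" using gc by (rule borel_measurable_lb)
  have fm: "f \<in> borel_measurable (lb (ball a r))"
    using h by (intro borel_measurable_lb holomorphic_on_imp_continuous_on)
  have gnm: "(\<lambda>z. cmod (g z)) \<in> borel_measurable (lb (ball 0 r))"
    using gm by measurable
  have tr: "integral\<^sup>L (lb (ball 0 r)) g = integral\<^sup>L (lb (ball a r)) f"
       and gi: "integrable (lb (ball 0 r)) g"
    using integral_lb_translation[OF _ _ _ fm, of a "ball 0 r"] int
    by (auto simp: g_def[abs_def] dist_norm)
  have gin: "integrable (lb (ball 0 r)) (\<lambda>z. cmod (g z))" using gi by simp
  have rot: "integral\<^sup>L (lb (ball 0 r)) (\<lambda>z. g (w * z)) = integral\<^sup>L (lb (ball 0 r)) g"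
    "integrable (lb (ball 0 r)) (\<lambda>z. g (w * z))"
    "(LINT z|lb (ball 0 r). cmod (g (w * z))) = (LINT z|lb (ball 0 r). cmod (g z))"
    if w: "cmod w = 1" for w
    using integral_rotation[OF w _ _ gm] gi
      integral_rotation(1)[OF w _ _ gnm]
    by (simp_all add: norm_mult w)
  have cont: "continuous_on (sphere 0 1 \<times> ball 0 r) (\<lambda>(w, z). g (w * z))"
    unfolding case_prod_beta
    by (rule continuous_on_compose2[OF gc]) (auto intro!: continuous_intros simp: norm_mult)
  have "circle_mean (\<lambda>w. LINT z|lb (ball 0 r). g (w * z)) = (LINT z|lb (ball 0 r). circle_mean (\<lambda>w. g (w * z)))"
    by (rule circle_mean_fubini(1)[OF _ cont rot(2)]) (auto simp: rot(3))
  also have "circle_mean (\<lambda>w. LINT z|lb (ball 0 r). g (w * z)) = circle_mean (\<lambda>w. integral\<^sup>L (lb (ball 0 r)) g)"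
    by (rule circle_mean_cong) (rule rot(1))
  also have "\<dots> = integral\<^sup>L (lb (ball 0 r)) g" by (rule circle_mean_const)
  also have "(LINT z|lb (ball 0 r). circle_mean (\<lambda>w. g (w * z))) = (LINT z|lb (ball 0 r :: complex set). g 0)"
  proof (rule Bochner_Integration.integral_cong[OF refl])
    fix z :: complex assume "z \<in> space (lb (ball 0 r))"
    then have z: "cmod z < r" by (simp add: space_restrict_space)
    show "circle_mean (\<lambda>w. g (w * z)) = g 0"
    proof (cases "z = 0")
      case False
      \<comment> \<open>The mean value property is stated for a real radius; the argument of
        \<open>z\<close> is absorbed by one more rotation.\<close>
      define b where "b = z / of_real (cmod z)"
      have b: "cmod b = 1" "of_real (cmod z) * b = z" using False by (auto simp: b_def norm_divide)
      have sub: "cball 0 (cmod z) \<subseteq> ball 0 r" using z by auto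
      have "circle_mean (\<lambda>w. g (0 + of_real (cmod z) * w)) = g 0"
        using False sub by (intro circle_mean_mean_value)
          (auto intro: continuous_on_subset[OF gc] holomorphic_on_subset[OF g subset_trans[OF ball_subset_cball sub]])
      moreover have "circle_mean (\<lambda>w. (\<lambda>w. g (of_real (cmod z) * w)) (b * w)) = circle_mean (\<lambda>w. g (of_real (cmod z) * w))"
        by (rule circle_mean_rotate[OF _ b(1)], rule continuous_on_compose2[OF gc])
          (use z in \<open>auto intro!: continuous_intros simp: norm_mult\<close>)
      moreover have "(\<lambda>w. (\<lambda>w. g (of_real (cmod z) * w)) (b * w)) = (\<lambda>w. g (w * z))"
        using b(2) by (auto simp: mult_ac)
      ultimately show ?thesis by simp
    qed simp
  qed
  also have "\<dots> = g 0 * measure lborel (ball 0 r :: complex set)"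
    by (simp add: measure_restrict_space space_restrict_space scaleR_conv_of_real)
  also have "measure lborel (ball 0 r :: complex set) = measure lborel (ball a r)"
    using r by (simp add: content_ball)
  finally show ?thesis using tr by (simp add: g_def)
qed

section \<open>Holomorphic functions of two variables and local estimates\<close>

lemma contour_integral_circlepath_circle_mean:
  assumes f: "continuous_on (sphere z r) f" and r: "0 < r"
  shows "contour_integral (circlepath z r) f = 2 * of_real pi * \<i> * r * circle_mean (\<lambda>w. f (z + of_real r * w) * w)"
proof -
  have cc: "continuous_on (sphere 0 1) (\<lambda>w. f (z + of_real r * w) * w)"
    by (intro continuous_intros continuous_on_compose2[OF f])
      (use r in \<open>auto simp: dist_norm norm_mult\<close>)
  have cp: "circlepath z r t = z + r * cis1 t"
    "vector_derivative (circlepath z r) (at t) = 2 * of_real pi * \<i> * r * cis1 t" for t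
    by (simp add: circlepath cis_conv_exp mult_ac) (simp add: vector_derivative_circlepath cis_conv_exp mult_ac)
  have "((\<lambda>t. f (z + r * cis1 t) * cis1 t) has_integral circle_mean (\<lambda>w. f (z + of_real r * w) * w)) {0..1}"
    unfolding circle_mean_eq_integral[OF cc]
    by (intro integrable_integral integrable_continuous_interval continuous_on_circle_compose[OF cc])
  from has_integral_mult_right[OF this, of "2 * of_real pi * \<i> * r"]
  have "(f has_contour_integral (2 * of_real pi * \<i> * r * circle_mean (\<lambda>w. f (z + of_real r * w) * w))) (circlepath z r)"
    by (simp add: has_contour_integral cp mult_ac)
  then show ?thesis by (rule contour_integral_unique)
qed

text \<open>Cauchy's formula on a circle that stays fixed while \<open>w\<close> varies. As a mean
  with parameters, the derivative inherits joint continuity from the integrand.\<close>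

lemma has_field_derivative_circle_mean:
  assumes c: "continuous_on (cball z r) f" and h: "f holomorphic_on ball z r" and w: "w \<in> ball z r"
  shows "(f has_field_derivative
      of_real r * circle_mean (\<lambda>u. f (z + of_real r * u) / (z + of_real r * u - w)\<^sup>2 * u)) (at w)"
proof -
  have r: "0 < r" using w zero_le_dist[of z w] by (simp del: zero_le_dist)
  have "continuous_on (sphere z r) (\<lambda>u. f u / (u - w)\<^sup>2)"
    using w by (intro continuous_intros continuous_on_subset[OF c]) (auto simp: dist_commute)
  from contour_integral_circlepath_circle_mean[OF this r] Cauchy_derivative_integral_circlepath(2)[OF c h w]
  show ?thesis by simp
qed

text \<open>A function whose first partial derivative exists at a point, and whose second exists
  nearby and is jointly continuous, is differentiable at that point. Joint continuity of the second
  one is read off from Cauchy's formula.\<close>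

lemma holomorphic2_onI:
  assumes S: "open S" and c: "continuous_on S f"
    and h1: "\<And>z w. (z, w) \<in> S \<Longrightarrow> (\<lambda>u. f (u, w)) field_differentiable at z"
    and h2: "\<And>z w. (z, w) \<in> S \<Longrightarrow> (\<lambda>v. f (z, v)) field_differentiable at w"
  shows "f holomorphic2_on S"
  unfolding holomorphic2_on_def
proof
  fix x assume "x \<in> S"
  obtain z0 w0 where x: "x = (z0, w0)" by fastforce
  obtain A B where AB': "open A" "open B" "x \<in> A \<times> B" "A \<times> B \<subseteq> S"
    by (rule open_prod_elim[OF S \<open>x \<in> S\<close>])
  then have AB: "open A" "open B" "z0 \<in> A" "w0 \<in> B" "A \<times> B \<subseteq> S"
    using x by auto
  obtain r1 where r1: "0 < r1" "cball z0 r1 \<subseteq> A" using AB open_contains_cball by blast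
  obtain r2 where r2: "0 < r2" "cball w0 r2 \<subseteq> B" using AB open_contains_cball by blast
  have sub: "cball z0 r1 \<times> cball w0 r2 \<subseteq> S" using AB r1 r2 by blast
  \<comment> \<open>The derivative in the second variable by Cauchy's formula on the circle of
    radius \<open>r2\<close> about \<open>w0\<close>, the same circle for all nearby points.\<close>
  define D where "D z w = of_real r2 * circle_mean (\<lambda>u. f (z, w0 + of_real r2 * u) / (w0 + of_real r2 * u - w)\<^sup>2 * u)"
    for z w
  have D: "((\<lambda>v. f (z, v)) has_field_derivative D z w) (at w)"
    if "z \<in> ball z0 r1" "w \<in> ball w0 r2" for z w
    unfolding D_def
  proof (rule has_field_derivative_circle_mean)
    show "continuous_on (cball w0 r2) (\<lambda>v. f (z, v))"
      by (rule continuous_on_compose2[OF c]) (use that in \<open>auto intro!: continuous_intros subsetD[OF sub]\<close>)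
    show "(\<lambda>v. f (z, v)) holomorphic_on ball w0 r2"
    proof (rule holomorphic_onI)
      fix v assume "v \<in> ball w0 r2"
      then have "(z, v) \<in> S" using that by (intro subsetD[OF sub]) auto
      then show "(\<lambda>v. f (z, v)) field_differentiable at v within ball w0 r2"
        by (rule field_differentiable_at_within[OF h2])
    qed
  qed fact
  have Dc: "continuous_on (ball z0 r1 \<times> ball w0 r2) (\<lambda>x. D (fst x) (snd x))"
    unfolding D_def
  proof (intro continuous_intros continuous_on_circle_mean_param)
    have nz: "w0 + of_real r2 * u - w \<noteq> 0" if "cmod u = 1" "dist w0 w < r2" for u w
    proof
      assume "w0 + of_real r2 * u - w = 0"
      then have "w - w0 = of_real r2 * u" by (simp add: algebra_simps)
      then have "cmod (w - w0) = r2" using that r2 by (simp only: norm_mult) simp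
      then have "dist w0 w = r2" by (simp only: dist_norm norm_minus_commute[of w0 w])
      with that show False by simp
    qed
    show "continuous_on ((ball z0 r1 \<times> ball w0 r2) \<times> sphere 0 1)
      (\<lambda>(x, u). f (fst x, w0 + of_real r2 * u) / (w0 + of_real r2 * u - snd x)\<^sup>2 * u)"
      unfolding case_prod_beta
      by (intro continuous_intros continuous_on_compose2[OF c])
        (use r2 nz in \<open>auto simp: dist_norm norm_mult intro!: subsetD[OF sub]\<close>)
  qed
  have in0: "z0 \<in> ball z0 r1" "w0 \<in> ball w0 r2" using r1 r2 by auto
  obtain a where a: "((\<lambda>u. f (u, w0)) has_field_derivative a) (at z0)"
    using h1[of z0 w0] \<open>x \<in> S\<close> x by (auto simp: field_differentiable_def)
  have "((\<lambda>(x, y). f (x, y)) has_derivative (\<lambda>(tx, ty). a * tx + blinfun_mult_right (D z0 w0) ty))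
      (at (z0, w0) within ball z0 r1 \<times> ball w0 r2)"
  proof (rule has_derivative_partialsI)
    show "((\<lambda>x. f (x, w0)) has_derivative (*) a) (at z0 within ball z0 r1)"
      using a by (auto simp: has_field_derivative_def intro: has_derivative_at_withinI)
    show "((\<lambda>y. f (x, y)) has_derivative blinfun_apply (blinfun_mult_right (D x y))) (at y within ball w0 r2)"
      if "x \<in> ball z0 r1" "y \<in> ball w0 r2" for x y
      using D[OF that] by (auto simp: has_field_derivative_def blinfun_mult_right.rep_eq
          intro: has_derivative_at_withinI)
    have "continuous_on (ball z0 r1 \<times> ball w0 r2) (\<lambda>(x, y). blinfun_mult_right (D x y))"
      using Dc unfolding case_prod_beta
      by (intro bounded_linear.continuous_on[OF bounded_linear_blinfun_mult_right])
    then show "continuous (at (z0, w0) within ball z0 r1 \<times> ball w0 r2) (\<lambda>(x, y). blinfun_mult_right (D x y))"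
      using in0 unfolding continuous_on_eq_continuous_within by auto
  qed (use in0 in auto)
  then have "(f has_derivative (\<lambda>v. a * fst v + D z0 w0 * snd v)) (at (z0, w0) within ball z0 r1 \<times> ball w0 r2)"
    by (simp add: case_prod_beta' blinfun_mult_right.rep_eq)
  then have "(f has_derivative (\<lambda>v. a * fst v + D z0 w0 * snd v)) (at (z0, w0))"
    using in0 by (subst (asm) at_within_open) (auto intro: open_Times)
  then show "\<exists>a b. (f has_derivative (\<lambda>v. a * fst v + b * snd v)) (at x within S)"
    unfolding x by (blast intro: has_derivative_at_withinI)
qed

lemma holomorphic2_on_imp_continuous_on:
  assumes "f holomorphic2_on S" shows "continuous_on S f"
  using assms unfolding holomorphic2_on_def continuous_on_eq_continuous_within
  by (blast intro: has_derivative_continuous)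

lemma holomorphic2_on_imp_field_differentiable:
  assumes f: "f holomorphic2_on S" and S: "open S" and zw: "(z, w) \<in> S"
  shows "(\<lambda>u. f (u, w)) field_differentiable at z"
    and "(\<lambda>v. f (z, v)) field_differentiable at w"
proof -
  obtain a b where "(f has_derivative (\<lambda>v. a * fst v + b * snd v)) (at (z, w) within S)"
    using f zw unfolding holomorphic2_on_def by blast
  then have d: "(f has_derivative (\<lambda>v. a * fst v + b * snd v)) (at (z, w))"
    by (simp only: at_within_open[OF zw S])
  have "((\<lambda>u. (u, w)) has_derivative (\<lambda>t. (t, 0))) (at z)"
    by (auto intro!: derivative_eq_intros)
  from has_derivative_compose[OF this d] have "((\<lambda>u. f (u, w)) has_field_derivative a) (at z)"
    by (simp add: has_field_derivative_def)
  then show "(\<lambda>u. f (u, w)) field_differentiable at z" by (auto simp: field_differentiable_def)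
  have "((\<lambda>v. (z, v)) has_derivative (\<lambda>t. (0, t))) (at w)"
    by (auto intro!: derivative_eq_intros)
  from has_derivative_compose[OF this d] have "((\<lambda>v. f (z, v)) has_field_derivative b) (at w)"
    by (simp add: has_field_derivative_def)
  then show "(\<lambda>v. f (z, v)) field_differentiable at w" by (auto simp: field_differentiable_def)
qed

lemma l2_subset:
  fixes S T :: "'a::euclidean_space set"
  assumes f: "f \<in> l2 (lb T)" and S: "S \<subseteq> T" "S \<in> sets borel" and T: "T \<in> sets borel"
  shows "f \<in> l2 (lb S)" and "sq_norm (lb S) f \<le> sq_norm (lb T) f"
proof -
  have "(\<lambda>x. indicator T x *\<^sub>R f x) \<in> borel_measurable borel"
    using l2_measurable[OF f] T by (subst (asm) borel_measurable_restrict_space_iff) auto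
  then have "(\<lambda>x. indicator S x *\<^sub>R (indicator T x *\<^sub>R f x)) \<in> borel_measurable borel"
    by (rule borel_measurable_scaleR[rotated]) (use S in auto)
  also have "(\<lambda>x. indicator S x *\<^sub>R (indicator T x *\<^sub>R f x)) = (\<lambda>x. indicator S x *\<^sub>R f x)"
    by (rule ext) (use S in \<open>auto split: split_indicator\<close>)
  finally have m: "f \<in> borel_measurable (lb S)"
    using S by (subst borel_measurable_restrict_space_iff) auto
  have iT: "integrable lborel (\<lambda>x. indicator T x *\<^sub>R (cmod (f x))\<^sup>2)"
    using l2_integrable[OF f] T by (simp add: integrable_restrict_space)
  have "integrable lborel (\<lambda>x. indicator S x *\<^sub>R (indicator T x *\<^sub>R (cmod (f x))\<^sup>2))"
    using S by (intro integrable_mult_indicator iT) auto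
  also have "(\<lambda>x. indicator S x *\<^sub>R (indicator T x *\<^sub>R (cmod (f x))\<^sup>2)) = (\<lambda>x. indicator S x *\<^sub>R (cmod (f x))\<^sup>2)"
    by (rule ext) (use S in \<open>auto split: split_indicator\<close>)
  finally have iS: "integrable lborel (\<lambda>x. indicator S x *\<^sub>R (cmod (f x))\<^sup>2)" .
  then show "f \<in> l2 (lb S)" using m S by (simp add: l2_def integrable_restrict_space)
  show "sq_norm (lb S) f \<le> sq_norm (lb T) f"
    unfolding sq_norm_def integral_lb[OF S(2)] integral_lb[OF T]
    by (rule integral_mono[OF iS iT]) (use S in \<open>auto simp: indicator_def\<close>)
qed

lemma l2_bounded_continuous:
  fixes S :: "'a::euclidean_space set"
  assumes S: "bounded S" "S \<in> sets borel" and f: "continuous_on S f" and B: "\<And>x. x \<in> S \<Longrightarrow> cmod (f x) \<le> B"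
  shows "f \<in> l2 (lb S)"
proof -
  interpret finite_measure "lb S" using S by (rule finite_measure_lb)
  have [measurable]: "f \<in> borel_measurable (lb S)" using f by (rule borel_measurable_lb)
  have "integrable (lb S) (\<lambda>x. (cmod (f x))\<^sup>2)"
    by (rule integrable_const_bound[where B="B\<^sup>2"])
      (use B in \<open>auto simp: space_restrict_space intro!: power_mono\<close>)
  then show ?thesis by (simp add: l2_def)
qed

lemma l2_const:
  fixes S :: "'a::euclidean_space set"
  assumes "bounded S" "S \<in> sets borel" shows "(\<lambda>x. c) \<in> l2 (lb S)"
  using assms by (intro l2_bounded_continuous[where B="cmod c"]) auto

lemma l2_integrable1:
  fixes S :: "'a::euclidean_space set"
  assumes "bounded S" "S \<in> sets borel" "f \<in> l2 (lb S)" shows "integrable (lb S) f"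
  using l2_product_integrable[OF assms(3) l2_const[OF assms(1,2), of 1]] by simp

lemma integral_cmod_le_sq_norm:
  fixes S :: "'a::euclidean_space set"
  assumes "bounded S" "S \<in> sets borel" "f \<in> l2 (lb S)"
  shows "(LINT x|lb S. cmod (f x)) \<le> sqrt (measure lborel S) * sqrt (sq_norm (lb S) f)"
proof -
  have "sq_norm (lb S) (\<lambda>x. 1) = measure lborel S"
    using assms by (simp add: sq_norm_def measure_restrict_space space_restrict_space)
  with integral_abs_product_le[OF l2_const[OF assms(1,2), of 1] assms(3)] show ?thesis by simp
qed

text \<open>A local bound of values by the norm turns Cauchy sequences in norm into locally
  uniformly convergent ones. The last premise of \<open>closed\<close> also speaks of points outside
  \<open>X\<close>, which is how the vanishing of Bergman functions off their domain passes to the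
  limit.\<close>

lemma complete_of_local_bound:
  fixes X :: "'a::euclidean_space set"
  assumes X: "open X" and S: "S \<subseteq> l2 (lb X)"
    and diff: "\<And>f g. f \<in> S \<Longrightarrow> g \<in> S \<Longrightarrow> (\<lambda>x. f x - g x) \<in> S"
    and bound: "\<And>x. x \<in> X \<Longrightarrow> \<exists>e>0. \<exists>C. \<forall>f\<in>S. \<forall>y\<in>ball x e. cmod (f y) \<le> C * sqrt (sq_norm (lb X) f)"
    and closed: "\<And>F p. (\<And>n::nat. F n \<in> S) \<Longrightarrow> p \<in> l2 (lb X) \<Longrightarrow>
       (\<And>x. x \<in> X \<Longrightarrow> \<exists>e>0. uniform_limit (ball x e) F p sequentially) \<Longrightarrow>
       (\<And>x. convergent (\<lambda>n. F n x) \<Longrightarrow> (\<lambda>n. F n x) \<longlonglongrightarrow> p x) \<Longrightarrow> p \<in> S"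
    and F: "\<And>n::nat. F n \<in> S"
    and cauchy: "\<And>e. 0 < e \<Longrightarrow> \<exists>N. \<forall>m\<ge>N. \<forall>n\<ge>N. sq_norm (lb X) (\<lambda>x. F m x - F n x) < e"
  shows "\<exists>p\<in>S. (\<lambda>n. sq_norm (lb X) (\<lambda>x. F n x - p x)) \<longlonglongrightarrow> 0"
proof -
  define p where "p = (\<lambda>x. lim (\<lambda>n. F n x))"
  have lim: "(\<lambda>n. F n x) \<longlonglongrightarrow> p x" if "convergent (\<lambda>n. F n x)" for x
    using that by (simp add: p_def convergent_LIMSEQ_iff)
  have ul: "\<exists>e>0. uniform_limit (ball x e) F p sequentially" if "x \<in> X" for x
  proof -
    obtain e C where e: "e > 0" and C: "\<And>f y. f \<in> S \<Longrightarrow> y \<in> ball x e \<Longrightarrow> cmod (f y) \<le> C * sqrt (sq_norm (lb X) f)"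
      using bound[OF \<open>x \<in> X\<close>] by blast
    have "uniformly_Cauchy_on (ball x e) F"
    proof (rule uniformly_Cauchy_onI)
      fix d :: real assume d: "0 < d"
      define C' where "C' = max C 1"
      have C': "0 < C'" "C \<le> C'" by (auto simp: C'_def)
      have "0 < (d / C')\<^sup>2" using d C' by simp
      then obtain N where N: "\<forall>m\<ge>N. \<forall>n\<ge>N. sq_norm (lb X) (\<lambda>x. F m x - F n x) < (d / C')\<^sup>2"
        using cauchy by blast
      have "dist (F m y) (F n y) < d" if "y \<in> ball x e" "m \<ge> N" "n \<ge> N" for y m n
      proof -
        have "dist (F m y) (F n y) \<le> C * sqrt (sq_norm (lb X) (\<lambda>x. F m x - F n x))"
          unfolding dist_norm by (rule C[OF diff[OF F F] that(1)])
        also have "\<dots> \<le> C' * sqrt (sq_norm (lb X) (\<lambda>x. F m x - F n x))"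
          using C' by (intro mult_right_mono) auto
        also have "\<dots> < C' * (d / C')"
        proof (rule mult_strict_left_mono)
          have "sqrt (sq_norm (lb X) (\<lambda>x. F m x - F n x)) < sqrt ((d / C')\<^sup>2)"
            using N that by (intro real_sqrt_less_mono) auto
          then show "sqrt (sq_norm (lb X) (\<lambda>x. F m x - F n x)) < d / C'"
            using d C' by simp
        qed (use C' in auto)
        finally show ?thesis using C' by simp
      qed
      then show "\<exists>M. \<forall>y\<in>ball x e. \<forall>m\<ge>M. \<forall>n\<ge>M. dist (F m y) (F n y) < d" by blast
    qed
    then have "uniform_limit (ball x e) F p sequentially"
      unfolding p_def by (intro uniformly_convergent_uniform_limit_iff[THEN iffD1] Cauchy_uniformly_convergent)
    with e show ?thesis by blast
  qed
  have ptw: "(\<lambda>n. F n x) \<longlonglongrightarrow> p x" if "x \<in> X" for x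
    using ul[OF that] tendsto_uniform_limitI by (metis centre_in_ball)
  have l2F: "F n \<in> l2 (lb X)" for n using F S by auto
  have *: "p \<in> l2 (lb X)" "(\<lambda>n. sq_norm (lb X) (\<lambda>x. F n x - p x)) \<longlonglongrightarrow> 0"
    using l2_limit[OF l2F cauchy] ptw by (auto simp: space_restrict_space)
  have "p \<in> S" by (rule closed[OF F *(1) ul lim])
  with * show ?thesis by blast
qed

section \<open>Bergman spaces\<close>

text \<open>Values off \<open>V\<close> are left free here; \<open>tensor\<close> restores the
  vanishing that \<open>bergman_space\<close> demands.\<close>

definition bergman1 :: "complex set \<Rightarrow> (complex \<Rightarrow> complex) set" where
  "bergman1 V = {f \<in> l2 (lb V). f holomorphic_on V}"

text \<open>The value at \<open>a\<close> is the average over the ball, and Cauchy-Schwarz bounds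
  that average by the norm.\<close>

lemma bergman1_bound:
  assumes f: "f \<in> bergman1 V" and V: "open V" and a: "ball a r \<subseteq> V" and r: "0 < r"
  shows "cmod (f a) \<le> 1 / sqrt (measure lborel (ball a r)) * sqrt (sq_norm (lb V) f)"
proof -
  let ?m = "measure lborel (ball a r)"
  have m: "0 < ?m" using r by (simp add: content_ball_pos)
  have fl: "f \<in> l2 (lb (ball a r))" and fle: "sq_norm (lb (ball a r)) f \<le> sq_norm (lb V) f"
    using l2_subset[OF _ a, of f] f V by (auto simp: bergman1_def)
  have "f a * ?m = integral\<^sup>L (lb (ball a r)) f"
    using f r a fl by (intro integral_ball_mean_value[symmetric] l2_integrable1)
      (auto simp: bergman1_def intro: holomorphic_on_subset)
  then have "cmod (f a) * ?m = cmod (integral\<^sup>L (lb (ball a r)) f)"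
    using m by (metis abs_of_pos norm_mult norm_of_real)
  also have "\<dots> \<le> (LINT x|lb (ball a r). cmod (f x))"
    by (rule integral_norm_bound)
  also have "\<dots> \<le> sqrt ?m * sqrt (sq_norm (lb (ball a r)) f)"
    by (rule integral_cmod_le_sq_norm[OF _ _ fl]) auto
  also have "\<dots> \<le> sqrt ?m * sqrt (sq_norm (lb V) f)"
    using fle by (intro mult_left_mono) auto
  finally have "cmod (f a) * (sqrt ?m * sqrt ?m) \<le> sqrt ?m * sqrt (sq_norm (lb V) f)"
    using m by simp
  then have "sqrt ?m * (cmod (f a) * sqrt ?m) \<le> sqrt ?m * sqrt (sq_norm (lb V) f)"
    by (simp only: mult_ac)
  then have "cmod (f a) * sqrt ?m \<le> sqrt (sq_norm (lb V) f)"
    using m by (simp only: mult_le_cancel_left_pos real_sqrt_gt_0_iff)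
  then show ?thesis using m by (simp add: pos_le_divide_eq)
qed

lemma bergman_spaceD:
  assumes f: "f \<in> bergman_space \<Omega>" and \<Omega>: "open \<Omega>"
  shows "f \<in> l2 (lb \<Omega>)" "f holomorphic2_on \<Omega>" "\<And>z. z \<notin> \<Omega> \<Longrightarrow> f z = 0" "continuous_on \<Omega> f"
proof -
  show h: "f holomorphic2_on \<Omega>" "\<And>z. z \<notin> \<Omega> \<Longrightarrow> f z = 0"
    using f by (auto simp: bergman_space_def)
  show c: "continuous_on \<Omega> f" using h(1) by (rule holomorphic2_on_imp_continuous_on)
  have "(\<lambda>z. (cmod (f z))\<^sup>2) \<in> borel_measurable (lb \<Omega>)"
    by (intro borel_measurable_lb continuous_intros c)
  then show "f \<in> l2 (lb \<Omega>)"
    using f \<Omega> lebesgue_on_eq_lb(3)[of \<Omega> "\<lambda>z. (cmod (f z))\<^sup>2"] borel_measurable_lb[OF c]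
    by (simp add: bergman_space_def L2_def l2_def)
qed

lemma bergman_spaceI:
  assumes \<Omega>: "open \<Omega>" and f: "f \<in> l2 (lb \<Omega>)" "f holomorphic2_on \<Omega>" "\<And>z. z \<notin> \<Omega> \<Longrightarrow> f z = 0"
  shows "f \<in> bergman_space \<Omega>"
proof -
  have c: "continuous_on \<Omega> f" using f(2) by (rule holomorphic2_on_imp_continuous_on)
  have "(\<lambda>z. (cmod (f z))\<^sup>2) \<in> borel_measurable (lb \<Omega>)"
    by (intro borel_measurable_lb continuous_intros c)
  then have "integrable (lebesgue_on \<Omega>) (\<lambda>z. (cmod (f z))\<^sup>2)"
    using l2_integrable[OF f(1)] lebesgue_on_eq_lb(3)[of \<Omega> "\<lambda>z. (cmod (f z))\<^sup>2"] \<Omega> by simp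
  moreover have "f \<in> borel_measurable (lebesgue_on \<Omega>)"
    using lebesgue_on_eq_lb(1)[OF borel_open[OF \<Omega>] l2_measurable[OF f(1)]] .
  ultimately have "f \<in> L2 \<Omega>" unfolding L2_def by blast
  then show "f \<in> bergman_space \<Omega>"
    unfolding bergman_space_def using f(2,3) by blast
qed

text \<open>The area mean value property is applied in one variable after the other over a bidisk,
  followed by Cauchy-Schwarz.\<close>

lemma bergman_bound:
  assumes f: "f \<in> bergman_space \<Omega>" and \<Omega>: "open \<Omega>"
    and ab: "cball a r \<times> cball b r \<subseteq> \<Omega>" and r: "0 < r"
  shows "cmod (f (a, b)) \<le> 1 / measure lborel (ball a r) * sqrt (sq_norm (lb \<Omega>) f)"
proof -
  note D = bergman_spaceD[OF f \<Omega>]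
  let ?m = "measure lborel (ball a r)" and ?Q = "ball a r \<times> ball b r"
  have m: "0 < ?m" using r by (simp add: content_ball_pos)
  have mb: "measure lborel (ball b r) = ?m" using r by (simp add: content_ball)
  have mQ: "measure lborel ?Q = ?m * ?m"
  proof -
    have "measure (lborel \<Otimes>\<^sub>M lborel) ?Q = measure lborel (ball a r) * measure lborel (ball b r)"
      by (simp add: measure_def lborel.emeasure_pair_measure_Times enn2real_mult)
    then show ?thesis by (simp add: lborel_prod mb)
  qed
  have sub: "?Q \<subseteq> \<Omega>" using ab ball_subset_cball by blast
  have cf: "continuous_on (cball a r \<times> cball b r) f"
    using D(4) ab by (rule continuous_on_subset)
  have "compact (f ` (cball a r \<times> cball b r))"
    by (intro compact_continuous_image cf compact_Times compact_cball)
  then have "bounded (f ` (cball a r \<times> cball b r))" by (rule compact_imp_bounded)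
  \<comment> \<open>A bound on the closed bidisk makes every slice integrable, not merely almost
    every one.\<close>
  then obtain K where K: "\<And>x. x \<in> cball a r \<times> cball b r \<Longrightarrow> cmod (f x) \<le> K"
    unfolding bounded_iff by blast
  have bnd: "cmod (f x) \<le> K" if "x \<in> ?Q" for x using K[of x] that by auto
  have fl: "f \<in> l2 (lb ?Q)" and fle: "sq_norm (lb ?Q) f \<le> sq_norm (lb \<Omega>) f"
    using l2_subset[OF D(1) sub] \<Omega> by (auto intro!: borel_open open_Times)
  have bQ: "bounded ?Q" "?Q \<in> sets borel" by (auto intro!: bounded_Times borel_open open_Times)
  have fi: "integrable (lb ?Q) f" using bQ fl by (rule l2_integrable1)
  interpret A: sigma_finite_measure "lb (ball a r)" by (rule sigma_finite_lb) auto
  interpret B: sigma_finite_measure "lb (ball b r)" by (rule sigma_finite_lb) auto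
  interpret P: pair_sigma_finite "lb (ball a r)" "lb (ball b r)" ..
  have pl: "lb (ball a r) \<Otimes>\<^sub>M lb (ball b r) = lb ?Q" by (rule pair_lb) auto
  have "integral\<^sup>L (lb ?Q) f = (LINT z|lb (ball a r). LINT w|lb (ball b r). f (z, w))"
    using P.integral_fst'[of f] fi by (simp add: pl)
  also have "\<dots> = (LINT z|lb (ball a r). f (z, b) * ?m)"
  proof (rule Bochner_Integration.integral_cong[OF refl])
    fix z assume "z \<in> space (lb (ball a r))"
    then have z: "z \<in> ball a r" by (simp add: space_restrict_space)
    have h: "(\<lambda>w. f (z, w)) holomorphic_on ball b r"
    proof (rule holomorphic_onI)
      fix w assume "w \<in> ball b r"
      then have "(z, w) \<in> \<Omega>" using z sub by auto
      then show "(\<lambda>w. f (z, w)) field_differentiable at w within ball b r"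
        by (rule field_differentiable_at_within[OF holomorphic2_on_imp_field_differentiable(2)[OF D(2) \<Omega>]])
    qed
    have "(\<lambda>w. f (z, w)) \<in> l2 (lb (ball b r))"
      by (rule l2_bounded_continuous[where B=K])
        (use h z bnd in \<open>auto intro: holomorphic_on_imp_continuous_on\<close>)
    then have "integrable (lb (ball b r)) (\<lambda>w. f (z, w))" by (intro l2_integrable1) auto
    with h r have "(LINT w|lb (ball b r). f (z, w)) = f (z, b) * measure lborel (ball b r)"
      by (intro integral_ball_mean_value)
    then show "(LINT w|lb (ball b r). f (z, w)) = f (z, b) * ?m" by (simp add: mb)
  qed
  also have "\<dots> = (LINT z|lb (ball a r). f (z, b)) * ?m" by simp
  also have "(LINT z|lb (ball a r). f (z, b)) = f (a, b) * ?m"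
  proof -
    have h: "(\<lambda>z. f (z, b)) holomorphic_on ball a r"
    proof (rule holomorphic_onI)
      fix z assume "z \<in> ball a r"
      then have "(z, b) \<in> \<Omega>" using r sub by auto
      then show "(\<lambda>z. f (z, b)) field_differentiable at z within ball a r"
        by (rule field_differentiable_at_within[OF holomorphic2_on_imp_field_differentiable(1)[OF D(2) \<Omega>]])
    qed
    have "(\<lambda>z. f (z, b)) \<in> l2 (lb (ball a r))"
      by (rule l2_bounded_continuous[where B=K])
        (use h r bnd in \<open>auto intro: holomorphic_on_imp_continuous_on\<close>)
    then have "integrable (lb (ball a r)) (\<lambda>z. f (z, b))" by (intro l2_integrable1) auto
    with h r show ?thesis by (intro integral_ball_mean_value)
  qed
  finally have eq: "integral\<^sup>L (lb ?Q) f = f (a, b) * ?m * ?m" .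
  have "cmod (f (a, b)) * ?m * ?m = cmod (integral\<^sup>L (lb ?Q) f)"
    using m by (simp add: eq norm_mult)
  also have "\<dots> \<le> (LINT x|lb ?Q. cmod (f x))" by (rule integral_norm_bound)
  also have "\<dots> \<le> sqrt (?m * ?m) * sqrt (sq_norm (lb ?Q) f)"
    using integral_cmod_le_sq_norm[OF bQ fl] by (simp add: mQ)
  also have "\<dots> \<le> ?m * sqrt (sq_norm (lb \<Omega>) f)"
    using fle m by (simp add: real_sqrt_mult)
  finally have "cmod (f (a, b)) * ?m \<le> sqrt (sq_norm (lb \<Omega>) f)" using m by simp
  then show ?thesis using m by (simp add: field_simps)
qed

lemma bergman_space_subspace:
  assumes \<Omega>: "open \<Omega>"
  shows "(\<lambda>x. 0) \<in> bergman_space \<Omega>"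
    and "f \<in> bergman_space \<Omega> \<Longrightarrow> g \<in> bergman_space \<Omega> \<Longrightarrow> (\<lambda>x. f x + g x) \<in> bergman_space \<Omega>"
    and "f \<in> bergman_space \<Omega> \<Longrightarrow> (\<lambda>x. c * f x) \<in> bergman_space \<Omega>"
    and "f \<in> bergman_space \<Omega> \<Longrightarrow> g \<in> bergman_space \<Omega> \<Longrightarrow> (\<lambda>x. f x - g x) \<in> bergman_space \<Omega>"
proof -
  have fd1: "(\<lambda>u. f (u, w)) field_differentiable at z" "(\<lambda>v. f (z, v)) field_differentiable at w"
    if "f \<in> bergman_space \<Omega>" "(z, w) \<in> \<Omega>" for f z w
    using that \<Omega> by (auto intro: holomorphic2_on_imp_field_differentiable simp: bergman_space_def)
  note lD = bergman_spaceD(1)[OF _ \<Omega>] and vD = bergman_spaceD(3)[OF _ \<Omega>] and cD = bergman_spaceD(4)[OF _ \<Omega>]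
  show "(\<lambda>x. 0) \<in> bergman_space \<Omega>"
    by (intro bergman_spaceI holomorphic2_onI \<Omega>) auto
  show *: "(\<lambda>x. f x + g x) \<in> bergman_space \<Omega>" if "f \<in> bergman_space \<Omega>" "g \<in> bergman_space \<Omega>" for f g
  proof (rule bergman_spaceI[OF \<Omega>])
    show "(\<lambda>x. f x + g x) holomorphic2_on \<Omega>"
      using that by (intro holomorphic2_onI[OF \<Omega>] continuous_on_add field_differentiable_add fd1 cD)
  qed (simp_all add: that lD l2_add vD[OF that(1)] vD[OF that(2)])
  show **: "(\<lambda>x. c * f x) \<in> bergman_space \<Omega>" if "f \<in> bergman_space \<Omega>" for f c
  proof (rule bergman_spaceI[OF \<Omega>])
    show "(\<lambda>x. c * f x) holomorphic2_on \<Omega>"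
      using that by (intro holomorphic2_onI[OF \<Omega>] continuous_on_mult continuous_on_const
          field_differentiable_mult field_differentiable_const fd1 cD)
  qed (simp_all add: that lD l2_scale vD[OF that])
  show "(\<lambda>x. f x - g x) \<in> bergman_space \<Omega>" if "f \<in> bergman_space \<Omega>" "g \<in> bergman_space \<Omega>"
    using *[OF that(1) **[OF that(2), of "-1"]] by simp
qed

lemma uniform_limit_slice:
  assumes "uniform_limit A F p sequentially" "\<And>u. u \<in> B \<Longrightarrow> g u \<in> A"
  shows "uniform_limit B (\<lambda>n u. F n (g u)) (\<lambda>u. p (g u)) sequentially"
  using assms unfolding uniform_limit_iff by (fastforce elim: eventually_mono)

text \<open>Weierstrass' theorem on complex lines gives separate holomorphy, and the uniform limit
  is continuous; \<open>holomorphic2_onI\<close> combines the two.\<close>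

lemma holomorphic2_on_uniform_limit:
  assumes \<Omega>: "open \<Omega>" and F: "\<And>n::nat. F n holomorphic2_on \<Omega>"
    and lim: "\<And>x. x \<in> \<Omega> \<Longrightarrow> \<exists>e>0. uniform_limit (ball x e) F p sequentially"
  shows "p holomorphic2_on \<Omega>"
proof -
  have *: "\<exists>e>0. ball x e \<subseteq> \<Omega> \<and> uniform_limit (ball x e) F p sequentially" if x: "x \<in> \<Omega>" for x
  proof -
    obtain e1 where e1: "e1 > 0" "uniform_limit (ball x e1) F p sequentially" using lim[OF x] by blast
    obtain e2 where e2: "e2 > 0" "ball x e2 \<subseteq> \<Omega>" by (rule openE[OF \<Omega> x])
    show ?thesis
      using e1 e2 by (intro exI[of _ "min e1 e2"]) (auto intro: uniform_limit_on_subset)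
  qed
  \<comment> \<open>Here \<open>g\<close> stands for either isometric embedding of a coordinate
    line, so both variables are treated at once.\<close>
  have **: "(\<lambda>u. p (g u)) field_differentiable at z"
    if x: "g z \<in> \<Omega>" and g: "\<And>u. dist (g z) (g u) = dist z u"
      and fd: "\<And>u n. g u \<in> \<Omega> \<Longrightarrow> (\<lambda>u. F n (g u)) field_differentiable at u" for g :: "complex \<Rightarrow> complex \<times> complex" and z
  proof -
    obtain e where e: "e > 0" "ball (g z) e \<subseteq> \<Omega>" "uniform_limit (ball (g z) e) F p sequentially"
      using *[OF x] by blast
    have sub: "g u \<in> ball (g z) e" if "u \<in> ball z e" for u using g[of u] that by simp
    have ul: "uniform_limit (ball z e) (\<lambda>n u. F n (g u)) (\<lambda>u. p (g u)) sequentially"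
      using e(3) sub by (rule uniform_limit_slice)
    have "(\<lambda>u. p (g u)) holomorphic_on ball z e"
    proof (rule holomorphic_uniform_sequence[OF open_ball])
      show "(\<lambda>u. F n (g u)) holomorphic_on ball z e" for n
      proof (rule holomorphic_onI)
        fix u assume "u \<in> ball z e"
        then have "g u \<in> \<Omega>" using sub e by blast
        then show "(\<lambda>u. F n (g u)) field_differentiable at u within ball z e"
          by (rule field_differentiable_at_within[OF fd])
      qed
      show "\<exists>d>0. cball u d \<subseteq> ball z e \<and> uniform_limit (cball u d) (\<lambda>n u. F n (g u)) (\<lambda>u. p (g u)) sequentially"
        if "u \<in> ball z e" for u
        using open_contains_cball[THEN iffD1, OF open_ball] that ul
        by (meson uniform_limit_on_subset)
    qed
    then show ?thesis
      using e(1) by (auto intro: holomorphic_on_imp_differentiable_at)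
  qed
  show ?thesis
  proof (rule holomorphic2_onI[OF \<Omega>])
    show "continuous_on \<Omega> p"
      unfolding continuous_on_eq_continuous_at[OF \<Omega>]
    proof
      fix x assume "x \<in> \<Omega>"
      then obtain e where e: "e > 0" "ball x e \<subseteq> \<Omega>" "uniform_limit (ball x e) F p sequentially"
        using * by blast
      have "continuous_on (ball x e) p"
        by (rule uniform_limit_theorem[OF _ e(3)])
          (auto intro!: always_eventually continuous_on_subset[OF holomorphic2_on_imp_continuous_on[OF F] e(2)])
      then show "isCont p x" using e(1) by (simp add: continuous_on_eq_continuous_at)
    qed
    show "(\<lambda>u. p (u, w)) field_differentiable at z" if "(z, w) \<in> \<Omega>" for z w
      by (rule **[where g="\<lambda>u. (u, w)"])
        (use that in \<open>auto simp: dist_prod_def intro: holomorphic2_on_imp_field_differentiable[OF F \<Omega>]\<close>)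
    show "(\<lambda>v. p (z, v)) field_differentiable at w" if "(z, w) \<in> \<Omega>" for z w
      by (rule **[where g="\<lambda>v. (z, v)"])
        (use that in \<open>auto simp: dist_prod_def intro: holomorphic2_on_imp_field_differentiable[OF F \<Omega>]\<close>)
  qed
qed

lemma bergman_projection_exists:
  assumes \<Omega>: "open \<Omega>" and f: "f \<in> l2 (lb \<Omega>)"
  shows "\<exists>p\<in>bergman_space \<Omega>. \<forall>u\<in>bergman_space \<Omega>. ip (lb \<Omega>) (\<lambda>x. f x - p x) u = 0"
proof (rule projection_exists)
  show sub: "bergman_space \<Omega> \<subseteq> l2 (lb \<Omega>)" using bergman_spaceD[OF _ \<Omega>] by auto
  fix F assume F: "\<And>n::nat. F n \<in> bergman_space \<Omega>"
    and cauchy: "\<And>e. 0 < e \<Longrightarrow> \<exists>N. \<forall>m\<ge>N. \<forall>n\<ge>N. sq_norm (lb \<Omega>) (\<lambda>x. F m x - F n x) < e"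
  show "\<exists>p\<in>bergman_space \<Omega>. (\<lambda>n. sq_norm (lb \<Omega>) (\<lambda>x. F n x - p x)) \<longlonglongrightarrow> 0"
  proof (rule complete_of_local_bound[OF \<Omega> sub _ _ _ F cauchy])
    show "\<exists>e>0. \<exists>C. \<forall>f\<in>bergman_space \<Omega>. \<forall>y\<in>ball x e. cmod (f y) \<le> C * sqrt (sq_norm (lb \<Omega>) f)"
      if "x \<in> \<Omega>" for x
    proof -
      obtain e where e: "e > 0" "ball x e \<subseteq> \<Omega>" by (rule openE[OF \<Omega> \<open>x \<in> \<Omega>\<close>])
      \<comment> \<open>A bidisk of radius \<open>r\<close> about a point at distance below
        \<open>r\<close> from \<open>x\<close> stays at distance below \<open>3 * r\<close> from
        \<open>x\<close>, hence inside the ball of radius \<open>e\<close>.\<close>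
      define r where "r = e / 4"
      have r: "r > 0" using e by (simp add: r_def)
      have "cmod (f y) \<le> 1 / measure lborel (ball (0::complex) r) * sqrt (sq_norm (lb \<Omega>) f)"
        if f: "f \<in> bergman_space \<Omega>" and y: "y \<in> ball x r" for f y
      proof -
        have "cball (fst y) r \<times> cball (snd y) r \<subseteq> \<Omega>"
        proof
          fix q assume q: "q \<in> cball (fst y) r \<times> cball (snd y) r"
          have "dist y q \<le> dist (fst y) (fst q) + dist (snd y) (snd q)"
            unfolding dist_prod_def by (rule sqrt_sum_squares_le_sum) auto
          also have "\<dots> \<le> r + r" using q by (intro add_mono) auto
          finally have "dist x q < e"
            using y dist_triangle[of x q y] e by (simp add: r_def)
          then show "q \<in> \<Omega>" using e by auto
        qed
        from bergman_bound[OF f \<Omega> this r] show ?thesis using r by (simp add: content_ball)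
      qed
      then show ?thesis using r by blast
    qed
    show "p \<in> bergman_space \<Omega>"
      if "\<And>n. F n \<in> bergman_space \<Omega>" "p \<in> l2 (lb \<Omega>)"
        "\<And>x. x \<in> \<Omega> \<Longrightarrow> \<exists>e>0. uniform_limit (ball x e) F p sequentially"
        "\<And>x. convergent (\<lambda>n. F n x) \<Longrightarrow> (\<lambda>n. F n x) \<longlonglongrightarrow> p x" for F :: "nat \<Rightarrow> _" and p
    proof (rule bergman_spaceI[OF \<Omega> that(2)])
      show "p holomorphic2_on \<Omega>"
        by (rule holomorphic2_on_uniform_limit[OF \<Omega> bergman_spaceD(2)[OF that(1) \<Omega>] that(3)])
      fix z assume "z \<notin> \<Omega>"
      then have z: "F n z = 0" for n using bergman_spaceD(3)[OF that(1) \<Omega>] by blast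
      then have "(\<lambda>n. F n z) \<longlonglongrightarrow> p z" by (intro that(4)) (simp add: convergent_const)
      then show "p z = 0" by (simp add: z LIMSEQ_const_iff)
    qed
  qed (auto intro: bergman_space_subspace[OF \<Omega>])
qed (auto intro: bergman_space_subspace[OF \<Omega>] f)

text \<open>The Bergman kernel at \<open>v\<close> divided by its value at \<open>v\<close>.
  Normalised in this way, its squared norm is the reciprocal of the kernel on the diagonal, which
  explains the factor on the right.\<close>

definition representer :: "complex set \<Rightarrow> complex \<Rightarrow> (complex \<Rightarrow> complex) \<Rightarrow> bool" where
  "representer V v k \<longleftrightarrow> k \<in> bergman1 V \<and> k v = 1 \<and> (\<forall>g\<in>bergman1 V. ip (lb V) g k = g v * of_real (sq_norm (lb V) k))"

text \<open>The kernel is the component of the constant 1 orthogonal to the functions vanishing at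
  \<open>v\<close>. For any \<open>g\<close> the combination \<open>g - g v * k\<close> vanishes at
  \<open>v\<close>, hence is orthogonal to \<open>k\<close>, and this is the reproducing
  property.\<close>

lemma representer_exists:
  assumes V: "open V" "bounded V" and v: "v \<in> V"
  shows "\<exists>k. representer V v k"
proof -
  define S where "S = {f \<in> bergman1 V. f v = 0}"
  have "\<exists>p\<in>S. \<forall>u\<in>S. ip (lb V) (\<lambda>x. 1 - p x) u = 0"
  proof (rule projection_exists)
    show sub: "S \<subseteq> l2 (lb V)" by (auto simp: S_def bergman1_def)
    show one: "(\<lambda>x. 1) \<in> l2 (lb V)" using V by (intro l2_const) auto
    show "(\<lambda>x. 0) \<in> S" by (auto simp: S_def bergman1_def)
    show "(\<lambda>x. f x + g x) \<in> S" if "f \<in> S" "g \<in> S" for f g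
      using that by (auto simp: S_def bergman1_def intro!: l2_add holomorphic_intros)
    show "(\<lambda>x. c * f x) \<in> S" if "f \<in> S" for f c
      using that by (auto simp: S_def bergman1_def intro!: l2_scale holomorphic_intros)
    fix F assume F: "\<And>n::nat. F n \<in> S"
      and cauchy: "\<And>e. 0 < e \<Longrightarrow> \<exists>N. \<forall>m\<ge>N. \<forall>n\<ge>N. sq_norm (lb V) (\<lambda>x. F m x - F n x) < e"
    show "\<exists>p\<in>S. (\<lambda>n. sq_norm (lb V) (\<lambda>x. F n x - p x)) \<longlonglongrightarrow> 0"
    proof (rule complete_of_local_bound[OF V(1) sub _ _ _ F cauchy])
      show "(\<lambda>x. f x - g x) \<in> S" if "f \<in> S" "g \<in> S" for f g
        using that by (auto simp: S_def bergman1_def intro!: l2_diff holomorphic_intros)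
      show "\<exists>e>0. \<exists>C. \<forall>f\<in>S. \<forall>y\<in>ball x e. cmod (f y) \<le> C * sqrt (sq_norm (lb V) f)"
        if "x \<in> V" for x
      proof -
        obtain e where e: "e > 0" "ball x e \<subseteq> V" by (rule openE[OF V(1) \<open>x \<in> V\<close>])
        have r: "e / 2 > 0" using e by simp
        have "cmod (f y) \<le> 1 / sqrt (measure lborel (ball (0::complex) (e / 2))) * sqrt (sq_norm (lb V) f)"
          if f: "f \<in> S" and y: "y \<in> ball x (e / 2)" for f y
        proof -
          have "ball y (e / 2) \<subseteq> V"
          proof
            fix q assume "q \<in> ball y (e / 2)"
            then have "dist x q < e" using y dist_triangle[of x q y] by simp
            then show "q \<in> V" using e by auto
          qed
          from bergman1_bound[OF _ V(1) this r, of f] f show ?thesis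
            using r by (simp add: content_ball S_def)
        qed
        then show ?thesis using r by blast
      qed
      show "p \<in> S"
        if FS: "\<And>n. F n \<in> S" and pl: "p \<in> l2 (lb V)"
          and ul: "\<And>x. x \<in> V \<Longrightarrow> \<exists>e>0. uniform_limit (ball x e) F p sequentially"
          and lim: "\<And>x. convergent (\<lambda>n. F n x) \<Longrightarrow> (\<lambda>n. F n x) \<longlonglongrightarrow> p x" for F :: "nat \<Rightarrow> _" and p
      proof -
        have "p holomorphic_on V"
        proof (rule holomorphic_uniform_sequence[OF V(1)])
          show "F n holomorphic_on V" for n using FS by (auto simp: S_def bergman1_def)
          show "\<exists>d>0. cball x d \<subseteq> V \<and> uniform_limit (cball x d) F p sequentially" if x: "x \<in> V" for x
          proof -
            obtain e1 where e1: "e1 > 0" "uniform_limit (ball x e1) F p sequentially" using ul[OF x] by blast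
            obtain e2 where e2: "e2 > 0" "cball x e2 \<subseteq> V" using V x open_contains_cball by blast
            show ?thesis
              using e1 e2 by (intro exI[of _ "min (e1 / 2) e2"]) (auto intro!: uniform_limit_on_subset[OF e1(2)])
          qed
        qed
        moreover have "F n v = 0" for n using FS by (auto simp: S_def)
        then have "p v = 0" using lim[of v] by (simp add: convergent_const LIMSEQ_const_iff)
        ultimately show ?thesis using pl by (simp add: S_def bergman1_def)
      qed
    qed
  qed
  then obtain p where p: "p \<in> S" and orth: "\<And>u. u \<in> S \<Longrightarrow> ip (lb V) (\<lambda>x. 1 - p x) u = 0" by blast
  define k where "k = (\<lambda>x. 1 - p x)"
  have k: "k \<in> bergman1 V" "k v = 1"
    using p V by (auto simp: k_def S_def bergman1_def intro!: l2_diff l2_const holomorphic_intros)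
  have "ip (lb V) g k = g v * of_real (sq_norm (lb V) k)" if g: "g \<in> bergman1 V" for g
  proof -
    have "(\<lambda>x. g x - g v * k x) \<in> S"
      using g k by (auto simp: S_def bergman1_def intro!: l2_diff l2_scale holomorphic_intros)
    from orth[OF this] have "ip (lb V) (\<lambda>x. g x - g v * k x) k = 0"
      by (subst ip_commute) (simp add: k_def)
    then show ?thesis
      using g k by (simp add: ip_diff_left l2_scale ip_scale_left bergman1_def ip_self)
  qed
  with k show ?thesis unfolding representer_def by blast
qed

section \<open>Berezin-fixed functions and Fourier coefficients\<close>

text \<open>The set where \<open>f\<close> differs from zero is open and null, hence empty.\<close>

lemma continuous_nonneg_integral_zero:
  fixes f :: "'a::euclidean_space \<Rightarrow> real"
  assumes S: "open S" and c: "continuous_on S f" and nn: "\<And>x. x \<in> S \<Longrightarrow> 0 \<le> f x"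
    and i: "integrable (lb S) f" and z: "integral\<^sup>L (lb S) f = 0" and x: "x \<in> S"
  shows "f x = 0"
proof -
  have "AE x in lb S. f x = 0"
    using z by (subst (asm) integral_nonneg_eq_0_iff_AE[OF i]) (auto simp: space_restrict_space nn)
  then have "AE x in lborel. x \<in> S \<longrightarrow> f x = 0"
    using S by (subst (asm) AE_restrict_space_iff) auto
  then have "AE x in lborel. x \<in> S \<longrightarrow> x \<in> - (S \<inter> f -` (- {0}))"
    by (rule AE_mp) (simp add: vimage_def)
  then have ae: "AE x \<in> S in lebesgue. x \<in> - (S \<inter> f -` (- {0}))"
    by (rule AE_completion)
  have "open (S \<inter> f -` (- {0}))"
    by (rule continuous_open_preimage[OF c S]) (simp add: open_Compl)
  then have "closed (- (S \<inter> f -` (- {0})))" by (rule closed_Compl)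
  from mem_closed_if_AE_lebesgue_open[OF S this ae x]
  have "x \<in> - (S \<inter> f -` (- {0}))" .
  with x show ?thesis by auto
qed

text \<open>The Berezin transform of \<open>s\<close> at \<open>v\<close> averages \<open>s\<close>
  against \<open>(cmod (k z))\<^sup>2\<close> over \<open>V\<close>, and the equation is cleared of
  the normalising denominator. A representer is determined on \<open>V\<close> only, so the
  condition ranges over all of them.\<close>

definition berezin_fixed :: "complex set \<Rightarrow> (complex \<Rightarrow> complex) \<Rightarrow> bool" where
  "berezin_fixed V s \<longleftrightarrow> (\<forall>v k. v \<in> V \<longrightarrow> representer V v k \<longrightarrow>
     (LINT z|lb V. s z * of_real ((cmod (k z))\<^sup>2)) = s v * of_real (sq_norm (lb V) k))"

lemma bounded_of_closure:
  fixes s :: "'a::euclidean_space \<Rightarrow> complex"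
  assumes "bounded V" "continuous_on (closure V) s"
  shows "\<exists>B. \<forall>z\<in>closure V. cmod (s z) \<le> B"
proof -
  have "bounded (s ` closure V)"
    using assms by (intro compact_imp_bounded compact_continuous_image) auto
  then show ?thesis unfolding bounded_iff by blast
qed

lemma integrable_weighted:
  fixes V :: "'a::euclidean_space set"
    and s k :: "'a \<Rightarrow> complex"
  assumes V: "bounded V" and s: "continuous_on (closure V) s" and k: "k \<in> l2 (lb V)"
  shows "integrable (lb V) (\<lambda>z. s z * of_real ((cmod (k z))\<^sup>2))"
proof -
  obtain B where B: "\<And>z. z \<in> closure V \<Longrightarrow> cmod (s z) \<le> B"
    using bounded_of_closure[OF V s] by blast
  have "s \<in> borel_measurable (lb V)"
    using continuous_on_subset[OF s closure_subset] by (rule borel_measurable_lb)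
  then have "(\<lambda>z. s z * k z) \<in> l2 (lb V)"
    using B closure_subset[of V] by (intro l2_bounded_mult[OF k, where B=B]) (auto simp: space_restrict_space)
  from l2_product_integrable[OF this k] show ?thesis
    by (simp add: complex_norm_square mult.assoc del: of_real_power)
qed

lemma berezin_fixed_diff:
  assumes V: "bounded V" and "continuous_on (closure V) s" "continuous_on (closure V) t" "berezin_fixed V s" "berezin_fixed V t"
  shows "berezin_fixed V (\<lambda>z. s z - t z)"
  unfolding berezin_fixed_def
proof (intro allI impI)
  fix v k assume v: "v \<in> V" and k: "representer V v k"
  then have kl: "k \<in> l2 (lb V)" by (auto simp: representer_def bergman1_def)
  show "(LINT z|lb V. (s z - t z) * of_real ((cmod (k z))\<^sup>2)) = (s v - t v) * of_real (sq_norm (lb V) k)"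
    using assms v k by (simp add: left_diff_distrib integrable_weighted[OF V _ kl] berezin_fixed_def del: of_real_power)
qed

lemma berezin_fixed_cmul: "berezin_fixed V s \<Longrightarrow> berezin_fixed V (\<lambda>z. c * s z)"
  by (simp add: berezin_fixed_def mult.assoc del: of_real_power)

lemma berezin_fixed_cnj:
  assumes "berezin_fixed V s" shows "berezin_fixed V (\<lambda>z. cnj (s z))"
  unfolding berezin_fixed_def
proof (intro allI impI)
  fix v k assume vk: "v \<in> V" "representer V v k"
  have "(LINT z|lb V. cnj (s z) * of_real ((cmod (k z))\<^sup>2)) = (LINT z|lb V. cnj (s z * of_real ((cmod (k z))\<^sup>2)))"
    by simp
  also have "\<dots> = cnj (LINT z|lb V. s z * of_real ((cmod (k z))\<^sup>2))"
    by (rule Bochner_Integration.integral_cnj)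
  finally show "(LINT z|lb V. cnj (s z) * of_real ((cmod (k z))\<^sup>2)) = cnj (s v) * of_real (sq_norm (lb V) k)"
    using assms vk by (simp add: berezin_fixed_def del: of_real_power)
qed

lemma bergman1_bounded_mult:
  assumes V: "bounded V" and s: "continuous_on (closure V) s" "s holomorphic_on V" and k: "k \<in> bergman1 V"
  shows "(\<lambda>z. s z * k z) \<in> bergman1 V"
proof -
  obtain B where B: "\<And>z. z \<in> closure V \<Longrightarrow> cmod (s z) \<le> B"
    using bounded_of_closure[OF V s(1)] by blast
  have "s \<in> borel_measurable (lb V)"
    using continuous_on_subset[OF s(1) closure_subset] by (rule borel_measurable_lb)
  then have "(\<lambda>z. s z * k z) \<in> l2 (lb V)"
    using B closure_subset[of V] k
    by (intro l2_bounded_mult[where B=B]) (auto simp: space_restrict_space bergman1_def)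
  then show ?thesis using s k by (auto simp: bergman1_def intro: holomorphic_on_mult)
qed

text \<open>The reproducing property for the Bergman function \<open>s * k\<close>, whose value at
  \<open>v\<close> is \<open>s v\<close>.\<close>

lemma berezin_fixed_holomorphic:
  assumes V: "bounded V" and s: "continuous_on (closure V) s" "s holomorphic_on V"
  shows "berezin_fixed V s"
  unfolding berezin_fixed_def
proof (intro allI impI)
  fix v k assume v: "v \<in> V" and k: "representer V v k"
  then have kb: "k \<in> bergman1 V" and kv: "k v = 1" by (auto simp: representer_def)
  have "(\<lambda>z. s z * k z) \<in> bergman1 V" by (rule bergman1_bounded_mult[OF V s kb])
  then have "ip (lb V) (\<lambda>z. s z * k z) k = (s v * k v) * of_real (sq_norm (lb V) k)"
    using k unfolding representer_def by blast
  then show "(LINT z|lb V. s z * of_real ((cmod (k z))\<^sup>2)) = s v * of_real (sq_norm (lb V) k)"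
    by (simp add: ip_def kv complex_norm_square mult.assoc del: of_real_power)
qed

text \<open>If the maximum \<open>m\<close> of \<open>cmod s\<close> is attained at \<open>v\<close>
  inside \<open>V\<close>, averaging against the kernel can return \<open>m\<close> only if
  \<open>(m - cmod (s z)) * (cmod (k z))\<^sup>2\<close> vanishes throughout. Near the frontier the
  first factor is positive, so \<open>k\<close> vanishes there, and then everywhere, against
  \<open>k v = 1\<close>.\<close>

lemma berezin_fixed_maximum_principle:
  assumes V: "open V" "bounded V" "connected V"
    and s: "continuous_on (closure V) s" and b: "berezin_fixed V s" and z: "\<And>z. z \<in> frontier V \<Longrightarrow> s z = 0"
    and x: "x \<in> V"
  shows "s x = 0"
proof (rule ccontr)
  assume sx: "s x \<noteq> 0"
  have comp: "compact (closure V)" using V by simp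
  have ne: "closure V \<noteq> {}" using x closure_subset by blast
  obtain v where v: "v \<in> closure V" and mx: "\<And>y. y \<in> closure V \<Longrightarrow> cmod (s y) \<le> cmod (s v)"
    using continuous_attains_sup[OF comp ne, of "\<lambda>y. cmod (s y)"] s
    by (auto intro: continuous_on_norm)
  define m where "m = cmod (s v)"
  have m: "0 < m" using mx[of x] x closure_subset[of V] sx unfolding m_def
    by (smt (verit) subset_iff zero_less_norm_iff)
  have "s v \<noteq> 0" using m by (simp add: m_def)
  then have vV: "v \<in> V" using v z V(1) unfolding frontier_def by (metis DiffI interior_open)
  obtain k where k: "representer V v k" using representer_exists[OF V(1,2) vV] by blast
  have kb: "k \<in> l2 (lb V)" "k holomorphic_on V" "k v = 1" using k by (auto simp: representer_def bergman1_def)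
  have kc: "continuous_on V k" using kb by (intro holomorphic_on_imp_continuous_on)
  have sc: "continuous_on V s" using s closure_subset by (rule continuous_on_subset)
  note iw = integrable_weighted[OF V(2) s kb(1)]
  have ia: "integrable (lb V) (\<lambda>z. cmod (s z) * (cmod (k z))\<^sup>2)"
    using Bochner_Integration.integrable_norm[OF iw] by (simp add: norm_mult norm_power)
  have ik: "integrable (lb V) (\<lambda>z. m * (cmod (k z))\<^sup>2)" using kb by (simp add: l2_def)
  have id: "integrable (lb V) (\<lambda>z. (m - cmod (s z)) * (cmod (k z))\<^sup>2)"
    using Bochner_Integration.integrable_diff[OF ik ia] by (simp add: left_diff_distrib)
  have "m * sq_norm (lb V) k = cmod (LINT z|lb V. s z * of_real ((cmod (k z))\<^sup>2))"
    using b vV k by (simp add: berezin_fixed_def norm_mult m_def del: of_real_power)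
  also have "\<dots> \<le> (LINT z|lb V. cmod (s z) * (cmod (k z))\<^sup>2)"
    using integral_norm_bound[of "lb V" "\<lambda>z. s z * of_real ((cmod (k z))\<^sup>2)"] by (simp add: norm_mult norm_power)
  finally have "(LINT z|lb V. (m - cmod (s z)) * (cmod (k z))\<^sup>2) \<le> 0"
    using Bochner_Integration.integral_diff[OF ik ia] by (simp add: left_diff_distrib sq_norm_def)
  moreover have nn: "0 \<le> (m - cmod (s z)) * (cmod (k z))\<^sup>2" if "z \<in> V" for z
    using mx[of z] that closure_subset[of V] by (auto simp: m_def)
  then have "0 \<le> (LINT z|lb V. (m - cmod (s z)) * (cmod (k z))\<^sup>2)"
    by (intro Bochner_Integration.integral_nonneg) (simp add: space_restrict_space)
  ultimately have zero: "(LINT z|lb V. (m - cmod (s z)) * (cmod (k z))\<^sup>2) = 0" by simp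
  have pw: "(m - cmod (s z)) * (cmod (k z))\<^sup>2 = 0" if "z \<in> V" for z
    by (rule continuous_nonneg_integral_zero[OF V(1) _ nn id zero that])
      (intro continuous_intros sc kc, simp_all)
  have "frontier V \<noteq> {}"
    using V vV by (metis empty_iff frontier_eq_empty not_bounded_UNIV)
  then obtain q where q: "q \<in> frontier V" by blast
  have "continuous (at q within closure V) s"
    using s q by (auto simp: continuous_on_eq_continuous_within frontier_def)
  then obtain d where d: "d > 0" "\<And>y. y \<in> closure V \<Longrightarrow> dist y q < d \<Longrightarrow> dist (s y) (s q) < m"
    using m unfolding continuous_within_eps_delta by blast
  define N where "N = V \<inter> ball q d"
  have "q \<in> closure V" using q by (simp add: frontier_def)
  then obtain y where "y \<in> V" "dist y q < d" using d(1) unfolding closure_approachable by blast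
  then have "y \<in> N" by (simp add: N_def dist_commute)
  then have "N \<noteq> {}" by blast
  \<comment> \<open>The kernel may have zeros, so \<open>cmod s = m\<close> cannot be concluded
    everywhere; instead a frontier point supplies an open set on which \<open>cmod s\<close> lies
    below \<open>m\<close>.\<close>
  have kN: "k z = 0" if zN: "z \<in> N" for z
  proof -
    have zV: "z \<in> V" and dz: "dist z q < d" using zN by (auto simp: N_def dist_commute)
    have "dist (s z) (s q) < m" using d(2)[of z] zV dz closure_subset[of V] by blast
    then have "cmod (s z) < m" using z[OF q] by simp
    then show ?thesis using pw[OF zV] by simp
  qed
  have oN: "open N" "N \<subseteq> V" using V(1) by (auto simp: N_def)
  have "k v = (\<lambda>_. 0) v"
    by (rule analytic_continuation_open[OF oN(1) V(1) \<open>N \<noteq> {}\<close> V(3) oN(2) kb(2) holomorphic_on_const kN vV])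
  then show False using kb(3) by simp
qed

section \<open>Uniqueness of Fourier coefficients on the circle\<close>

lemma circle_mean_norm_le:
  assumes f: "continuous_on (sphere 0 1) f" and B: "\<And>w. cmod w = 1 \<Longrightarrow> cmod (f w) \<le> B"
  shows "cmod (circle_mean f) \<le> B"
proof -
  have "cmod (circle_mean f) \<le> (LINT t|lb {0..1}. cmod (f (cis1 t)))"
    unfolding circle_mean_def by (rule integral_norm_bound)
  also have "\<dots> \<le> (LINT t|lb {0..1::real}. B)"
    using circle_mean_integrable[OF f] finite_measure_lb[of "{0..1::real}"]
    by (intro integral_mono) (auto simp: B finite_measure.integrable_const)
  also have "\<dots> = B" by (simp add: measure_restrict_space)
  finally show ?thesis .
qed

lemma circle_mean_norm_square_eq_0:
  assumes p: "continuous_on (sphere 0 1) p" and z: "circle_mean (\<lambda>w. p w * cnj (p w)) = 0" and w: "cmod w = 1"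
  shows "p w = 0"
proof -
  have c: "continuous_on {0..1} (\<lambda>t. (cmod (p (cis1 t)))\<^sup>2)"
    by (intro continuous_intros continuous_on_circle_compose p)
  have "(LINT t|lb {0..1}. of_real ((cmod (p (cis1 t)))\<^sup>2) :: complex) = 0"
    using z by (simp add: circle_mean_def complex_norm_square del: of_real_power)
  then have "(LINT t|lb {0..1}. (cmod (p (cis1 t)))\<^sup>2) = 0"
    by (simp del: of_real_power)
  then have "integral {0..1} (\<lambda>t. (cmod (p (cis1 t)))\<^sup>2) = 0"
    using set_borel_integral_eq_integral(2)[OF borel_integrable_atLeastAtMost'[OF c]]
    by (simp add: integral_lb set_lebesgue_integral_def)
  then have *: "\<And>t. t \<in> {0..1} \<Longrightarrow> (cmod (p (cis1 t)))\<^sup>2 = 0"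
    by (subst (asm) integral_eq_0_iff[OF c]) auto
  define t where "t = Arg2pi w / (2 * pi)"
  have "w = cis1 t" "t \<in> {0..1}"
    using Arg2pi[of w] Arg2pi_eq[of w] w by (auto simp: t_def cis_conv_exp)
  with *[of t] show ?thesis by simp
qed

definition fourier_null :: "(complex \<Rightarrow> complex) \<Rightarrow> bool" where
  "fourier_null f \<longleftrightarrow> continuous_on (sphere 0 1) f \<and> (\<forall>d. circle_mean (\<lambda>w. f w * w powi d) = 0)"

text \<open>On the circle a real linear function is a combination of \<open>w\<close> and
  \<open>inverse w\<close>, so multiplication by it only shifts Fourier coefficients by one. Sums
  and products follow by structural induction with \<open>f\<close> arbitrary.\<close>

lemma fourier_null_mult_polynomial:
  assumes "real_polynomial_function g" "fourier_null f"
  shows "fourier_null (\<lambda>w. f w * of_real (g w))"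
  using assms
proof (induction g arbitrary: f)
  case (linear g)
  then have c: "continuous_on (sphere 0 1) f" and n: "\<And>d. circle_mean (\<lambda>w. f w * w powi d) = 0"
    by (auto simp: fourier_null_def)
  have cg: "continuous_on (sphere 0 1) (\<lambda>w. complex_of_real (g w))"
    using linear.hyps by (intro continuous_intros linear_continuous_on)
  have cp: "continuous_on (sphere 0 1) (\<lambda>w. f w * w powi d)" for d
    by (intro continuous_intros c) auto
  define A where "A = (of_real (g 1) - \<i> * of_real (g \<i>)) / 2"
  define B where "B = (of_real (g 1) + \<i> * of_real (g \<i>)) / 2"
  have g: "complex_of_real (g w) = A * w + B * inverse w" if "cmod w = 1" for w
  proof -
    have "w * cnj w = 1" using that by (simp add: complex_norm_square[symmetric])
    then have iw: "inverse w = cnj w" by (rule inverse_unique)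
    have "g w = g (Re w *\<^sub>R 1 + Im w *\<^sub>R \<i>)"
      by (rule arg_cong[of _ _ g]) (simp add: complex_eq_iff)
    also have "\<dots> = Re w * g 1 + Im w * g \<i>"
      using linear.hyps by (simp only: linear_simps) simp
    finally show ?thesis unfolding iw by (simp add: A_def B_def complex_eq_iff field_simps)
  qed
  have "circle_mean (\<lambda>w. f w * of_real (g w) * w powi d) = 0" for d
  proof -
    have "circle_mean (\<lambda>w. f w * of_real (g w) * w powi d)
        = circle_mean (\<lambda>w. A * (f w * w powi (d + 1)) + B * (f w * w powi (d - 1)))"
    proof (rule circle_mean_cong)
      fix w :: complex assume w: "cmod w = 1"
      then have "w \<noteq> 0" by auto
      then show "f w * of_real (g w) * w powi d = A * (f w * w powi (d + 1)) + B * (f w * w powi (d - 1))"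
        unfolding g[OF w] by (simp add: power_int_add power_int_diff field_simps)
    qed
    also have "\<dots> = A * circle_mean (\<lambda>w. f w * w powi (d + 1)) + B * circle_mean (\<lambda>w. f w * w powi (d - 1))"
      by (subst circle_mean_add) (auto intro!: continuous_on_mult continuous_on_const cp simp: circle_mean_mult_left)
    finally show ?thesis by (simp add: n)
  qed
  then show ?case using c cg by (auto simp: fourier_null_def intro!: continuous_on_mult)
next
  case (const c)
  then have "circle_mean (\<lambda>w. f w * of_real c * w powi d) = 0" for d
    using circle_mean_mult_right[of "\<lambda>w. f w * w powi d" "of_real c"] by (simp add: fourier_null_def mult_ac)
  with const show ?case by (auto simp: fourier_null_def intro!: continuous_intros)
next
  case (add g1 g2)
  have *: "fourier_null (\<lambda>w. f w * of_real (g1 w))" "fourier_null (\<lambda>w. f w * of_real (g2 w))"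
    using add by auto
  have "circle_mean (\<lambda>w. f w * of_real (g1 w + g2 w) * w powi d) = 0" for d
  proof -
    have cp: "continuous_on (sphere 0 1) (\<lambda>w. (f w * of_real (g w)) * w powi d)"
      if "fourier_null (\<lambda>w. f w * of_real (g w))" for g
    proof -
      have c: "continuous_on (sphere 0 1) (\<lambda>w. f w * of_real (g w))"
        using that unfolding fourier_null_def by blast
      have "continuous_on (sphere 0 1) (\<lambda>w. w powi d :: complex)"
        by (intro continuous_intros) auto
      with c show ?thesis by (rule continuous_on_mult)
    qed
    show ?thesis
      using circle_mean_add[OF cp[OF *(1)] cp[OF *(2)]] * by (simp add: fourier_null_def distrib_left distrib_right)
  qed
  with * show ?case
    unfolding fourier_null_def
    by (auto simp: distrib_left intro!: continuous_on_add)
next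
  case (mult g1 g2)
  have "fourier_null (\<lambda>w. (f w * of_real (g1 w)) * of_real (g2 w))"
    by (intro mult.IH(2) mult.IH(1) mult.prems)
  then show ?case by (simp add: mult.assoc)
qed

text \<open>Stone-Weierstrass approximates \<open>cnj p\<close> by polynomials, against each of
  which \<open>p\<close> has mean zero; hence the mean of \<open>p * cnj p\<close> vanishes.\<close>

lemma fourier_null_eq_0:
  assumes p: "fourier_null p" and w: "cmod w = 1"
  shows "p w = 0"
proof -
  have c: "continuous_on (sphere 0 1) p" using p by (simp add: fourier_null_def)
  have "bounded (p ` sphere 0 1)"
    by (intro compact_imp_bounded compact_continuous_image c compact_sphere)
  then obtain B where "\<forall>x\<in>p ` sphere 0 1. cmod x \<le> B"
    unfolding bounded_iff by blast
  then have B: "\<And>w. cmod w = 1 \<Longrightarrow> cmod (p w) \<le> B" by simp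
  have B0: "0 \<le> B" using B[OF w] norm_ge_zero order_trans by blast
  have cnj: "continuous_on (sphere 0 1) (\<lambda>w. cnj (p w))" by (intro continuous_intros c)
  have "cmod (circle_mean (\<lambda>w. p w * cnj (p w))) \<le> B * (2 * e)" if e: "0 < e" for e
  proof -
    obtain g1 where g1: "real_polynomial_function g1" "\<And>w. w \<in> sphere 0 1 \<Longrightarrow> \<bar>Re (p w) - g1 w\<bar> < e"
      using Stone_Weierstrass_real_polynomial_function[of "sphere 0 1" "\<lambda>w. Re (p w)" e] e c
      by (auto intro: continuous_on_Re)
    obtain g2 where g2: "real_polynomial_function g2" "\<And>w. w \<in> sphere 0 1 \<Longrightarrow> \<bar>Im (p w) - g2 w\<bar> < e"
      using Stone_Weierstrass_real_polynomial_function[of "sphere 0 1" "\<lambda>w. Im (p w)" e] e c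
      by (auto intro: continuous_on_Im)
    note n1 = fourier_null_mult_polynomial[OF g1(1) p] and n2 = fourier_null_mult_polynomial[OF g2(1) p]
    have c1: "continuous_on (sphere 0 1) (\<lambda>w. p w * of_real (g1 w))"
      and c2: "continuous_on (sphere 0 1) (\<lambda>w. p w * of_real (g2 w))"
      using n1 n2 by (auto simp: fourier_null_def)
    have z1: "circle_mean (\<lambda>w. p w * of_real (g1 w)) = 0" and z2: "circle_mean (\<lambda>w. p w * of_real (g2 w)) = 0"
      using n1 n2 unfolding fourier_null_def by (force dest: spec[of _ 0])+
    \<comment> \<open>The real polynomials \<open>g1\<close> and \<open>g2\<close> approximate real
      and imaginary part, so \<open>g1 - \<i> * g2\<close> approximates \<open>cnj p\<close>;
      subtracting its product with \<open>p\<close> does not change the mean.\<close>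
    have "circle_mean (\<lambda>w. p w * cnj (p w))
        = circle_mean (\<lambda>w. p w * cnj (p w) - (p w * of_real (g1 w) - \<i> * (p w * of_real (g2 w))))"
      by (simp add: circle_mean_diff circle_mean_mult_left c c1 c2 cnj continuous_on_mult continuous_on_diff z1 z2)
    also have "cmod \<dots> \<le> B * (2 * e)"
    proof (rule circle_mean_norm_le)
      show "continuous_on (sphere 0 1) (\<lambda>w. p w * cnj (p w) - (p w * of_real (g1 w) - \<i> * (p w * of_real (g2 w))))"
        by (intro continuous_on_diff continuous_on_mult continuous_on_const c cnj c1 c2)
      fix w :: complex assume w: "cmod w = 1"
      have "p w * cnj (p w) - (p w * of_real (g1 w) - \<i> * (p w * of_real (g2 w)))
          = p w * (Complex (Re (p w) - g1 w) (- (Im (p w) - g2 w)))"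
        by (simp add: complex_eq_iff algebra_simps)
      also have "cmod \<dots> \<le> B * (2 * e)"
        unfolding norm_mult
      proof (rule mult_mono)
        show "cmod (Complex (Re (p w) - g1 w) (- (Im (p w) - g2 w))) \<le> 2 * e"
          using cmod_le[of "Complex (Re (p w) - g1 w) (- (Im (p w) - g2 w))"] g1(2)[of w] g2(2)[of w] w by auto
      qed (use B[OF w] B0 in auto)
      finally show "cmod (p w * cnj (p w) - (p w * of_real (g1 w) - \<i> * (p w * of_real (g2 w)))) \<le> B * (2 * e)" .
    qed
    finally show ?thesis .
  qed
  note bound = this
  have "cmod (circle_mean (\<lambda>w. p w * cnj (p w))) \<le> 0"
  proof (rule field_le_epsilon)
    fix e :: real assume e: "0 < e"
    have "cmod (circle_mean (\<lambda>w. p w * cnj (p w))) \<le> B * (2 * (e / (2 * (B + 1))))"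
      using e B0 by (intro bound) auto
    also have "\<dots> \<le> e" using e B0 by (simp add: field_simps)
    finally show "cmod (circle_mean (\<lambda>w. p w * cnj (p w))) \<le> 0 + e" by simp
  qed
  then have "circle_mean (\<lambda>w. p w * cnj (p w)) = 0" by simp
  then show ?thesis using circle_mean_norm_square_eq_0[OF c _ w] by blast
qed

lemma fourier_unique_constant:
  assumes q: "continuous_on (sphere 0 1) q" and z: "\<And>d. d \<noteq> 0 \<Longrightarrow> circle_mean (\<lambda>w. q w * w powi d) = 0"
    and w: "cmod w = 1"
  shows "q w = circle_mean q"
proof -
  have cp: "continuous_on (sphere 0 1) (\<lambda>w. w powi d :: complex)" for d
    by (intro continuous_intros) auto
  have "circle_mean (\<lambda>w. (q w - circle_mean q) * w powi d) = 0" for d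
  proof (cases "d = 0")
    case True then show ?thesis using q by (simp add: circle_mean_diff)
  next
    case False
    have "circle_mean (\<lambda>w. (q w - circle_mean q) * w powi d) = circle_mean (\<lambda>w. q w * w powi d) - circle_mean q * circle_mean (\<lambda>w. w powi d)"
      unfolding left_diff_distrib
      by (subst circle_mean_diff) (auto intro!: continuous_on_mult continuous_on_const q cp simp: circle_mean_mult_left)
    then show ?thesis using False by (simp add: z circle_mean_powi)
  qed
  then have "fourier_null (\<lambda>w. q w - circle_mean q)"
    using q by (simp add: fourier_null_def continuous_on_diff)
  from fourier_null_eq_0[OF this w] show ?thesis by simp
qed

section \<open>Rotations of disks and annuli\<close>

text \<open>For \<open>r < 0\<close> this is a disk, for \<open>r > 0\<close> an annulus.\<close>

definition round_domain :: "real \<Rightarrow> real \<Rightarrow> complex set" where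
  "round_domain r R = {z. r < cmod z \<and> cmod z < R}"

lemma round_domain_open: "open (round_domain r R)"
  unfolding round_domain_def by (intro open_Collect_conj open_Collect_less continuous_intros)

lemma round_domain_bounded: "bounded (round_domain r R)"
  by (rule bounded_subset[OF bounded_ball[of 0 R]]) (auto simp: round_domain_def)

lemma round_domain_connected: "connected (round_domain r R)"
  using connected_annulus(1)[where a="0::complex" and ?r1.0=r and ?r2.0=R] by (simp add: round_domain_def)

lemma round_domain_rotate: "cmod w = 1 \<Longrightarrow> w * z \<in> round_domain r R \<longleftrightarrow> z \<in> round_domain r R"
  by (simp add: round_domain_def norm_mult)

lemma round_domain_closure_subset: "closure (round_domain r R) \<subseteq> {z. r \<le> cmod z \<and> cmod z \<le> R}"
  by (rule closure_minimal) (auto simp: round_domain_def intro!: closed_Collect_conj closed_Collect_le continuous_intros)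

lemma round_domain_frontier: "frontier (round_domain r R) \<subseteq> {z. cmod z = r \<or> cmod z = R}"
proof
  fix z assume z: "z \<in> frontier (round_domain r R)"
  then have "z \<in> closure (round_domain r R)" "z \<notin> round_domain r R"
    using round_domain_open[of r R] by (auto simp: frontier_def interior_open)
  then show "z \<in> {z. cmod z = r \<or> cmod z = R}"
    using round_domain_closure_subset[of r R] by (auto simp: round_domain_def)
qed

lemma round_domain_closure_rotate:
  assumes w: "cmod w = 1" and z: "z \<in> closure (round_domain r R)"
  shows "w * z \<in> closure (round_domain r R)"
proof -
  have "(*) w ` closure (round_domain r R) \<subseteq> closure ((*) w ` round_domain r R)"
    by (rule continuous_image_closure_subset[of UNIV]) (auto intro!: continuous_intros)
  also have "(*) w ` round_domain r R \<subseteq> round_domain r R" using round_domain_rotate[OF w] by auto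
  then have "closure ((*) w ` round_domain r R) \<subseteq> closure (round_domain r R)" by (rule closure_mono)
  finally show ?thesis using z by blast
qed

text \<open>The modes on a boundary circle are normalised by their value at its positive real point.
  The lower end \<open>max r 0\<close> of the segment covers the disk, where \<open>r\<close> is
  negative.\<close>

lemma round_domain_closure_real:
  assumes rR: "r < R" "0 < R" "r \<noteq> 0"
  shows "of_real R \<in> closure (round_domain r R)" and "0 < r \<Longrightarrow> of_real r \<in> closure (round_domain r R)"
proof -
  have *: "complex_of_real ` {max r 0<..<R} \<subseteq> round_domain r R" by (auto simp: round_domain_def)
  have "complex_of_real ` closure {max r 0<..<R} \<subseteq> closure (complex_of_real ` {max r 0<..<R})"
    by (rule continuous_image_closure_subset[of UNIV]) (auto intro!: continuous_intros)
  also have "\<dots> \<subseteq> closure (round_domain r R)" using * by (rule closure_mono)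
  finally have "complex_of_real ` {max r 0..R} \<subseteq> closure (round_domain r R)"
    using rR by (simp add: closure_greaterThanLessThan)
  then show "of_real R \<in> closure (round_domain r R)" "0 < r \<Longrightarrow> of_real r \<in> closure (round_domain r R)"
    using rR by auto
qed

section \<open>Rotations of kernels and Berezin-fixed functions\<close>

lemma representer_rotate:
  assumes a: "cmod a = 1" and S: "V \<in> sets borel" "open V" and inv: "\<And>w z. cmod w = 1 \<Longrightarrow> w * z \<in> V \<longleftrightarrow> z \<in> V"
    and k: "representer V (a * v) k"
  shows "representer V v (\<lambda>z. k (a * z))"
proof -
  have a0: "a \<noteq> 0" using a by auto
  have b: "cmod (inverse a) = 1" using a by (simp add: norm_inverse)
  have rot: "(\<lambda>z. f (w * z)) \<in> bergman1 V" and nr: "sq_norm (lb V) (\<lambda>z. f (w * z)) = sq_norm (lb V) f"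
    if f: "f \<in> bergman1 V" and w: "cmod w = 1" for f w
  proof -
    have fm: "f \<in> borel_measurable (lb V)" "f holomorphic_on V" using f by (auto simp: bergman1_def l2_def)
    have fm2: "(\<lambda>z. (cmod (f z))\<^sup>2) \<in> borel_measurable (lb V)" using fm by measurable
    have h: "(\<lambda>z. f (w * z)) holomorphic_on V"
      using holomorphic_on_compose_gen[of "\<lambda>z. w * z" V f V] fm inv[OF w]
      by (auto simp: o_def intro!: holomorphic_intros)
    show "(\<lambda>z. f (w * z)) \<in> bergman1 V"
      using integral_rotation(2)[OF w S(1) inv[OF w] fm2] f h
      by (auto simp: bergman1_def l2_def intro!: borel_measurable_lb holomorphic_on_imp_continuous_on)
    show "sq_norm (lb V) (\<lambda>z. f (w * z)) = sq_norm (lb V) f"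
      using integral_rotation(1)[OF w S(1) inv[OF w] fm2] by (simp add: sq_norm_def)
  qed
  have kb: "k \<in> bergman1 V" "k (a * v) = 1"
    and kr: "\<And>g. g \<in> bergman1 V \<Longrightarrow> ip (lb V) g k = g (a * v) * of_real (sq_norm (lb V) k)"
    using k by (auto simp: representer_def)
  have "ip (lb V) g (\<lambda>z. k (a * z)) = g v * of_real (sq_norm (lb V) k)" if g: "g \<in> bergman1 V" for g
  proof -
    \<comment> \<open>The substitution moves the rotation from the kernel to \<open>g\<close>, and
      the kernel at \<open>a * v\<close> then evaluates the rotated function to
      \<open>g v\<close>.\<close>
    have gb: "(\<lambda>z. g (inverse a * z)) \<in> bergman1 V" by (rule rot(1)[OF g b])
    then have m: "(\<lambda>z. g (inverse a * z) * cnj (k z)) \<in> borel_measurable (lb V)"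
      using kb by (intro borel_measurable_lb continuous_intros)
        (auto simp: bergman1_def intro: holomorphic_on_imp_continuous_on)
    have "ip (lb V) g (\<lambda>z. k (a * z)) = (LINT z|lb V. g (inverse a * (a * z)) * cnj (k (a * z)))"
      using a0 by (simp add: ip_def mult.assoc[symmetric])
    also have "\<dots> = ip (lb V) (\<lambda>z. g (inverse a * z)) k"
      unfolding ip_def by (rule integral_rotation(1)[OF a S(1) inv[OF a] m])
    also have "\<dots> = g v * of_real (sq_norm (lb V) k)"
      using a0 by (simp add: kr[OF gb] mult.assoc[symmetric])
    finally show ?thesis .
  qed
  then show ?thesis
    using rot(1)[OF kb(1) a] nr[OF kb(1) a] kb by (simp add: representer_def)
qed

text \<open>Rotating \<open>u\<close> is compensated by rotating the kernel the other way:
  \<open>k'\<close> represents evaluation at \<open>w * v\<close> and has the same norm.\<close>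

lemma berezin_fixed_rotate:
  assumes w: "cmod w = 1" and V: "open V" "bounded V" and inv: "\<And>w z. cmod w = 1 \<Longrightarrow> w * z \<in> V \<longleftrightarrow> z \<in> V"
    and u: "continuous_on V u" and b: "berezin_fixed V u"
  shows "berezin_fixed V (\<lambda>z. u (w * z))"
  unfolding berezin_fixed_def
proof (intro allI impI)
  fix v k assume v: "v \<in> V" and k: "representer V v k"
  have w0: "w \<noteq> 0" and iw: "cmod (inverse w) = 1" using w by (auto simp: norm_inverse)
  have S: "V \<in> sets borel" using V by simp
  define k' where "k' = (\<lambda>z. k (inverse w * z))"
  have "representer V (inverse w * (w * v)) k" using k w0 by (simp add: mult.assoc[symmetric])
  then have k': "representer V (w * v) k'"
    unfolding k'_def by (intro representer_rotate[OF iw S V(1)] inv)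
  have kc: "continuous_on V k" "continuous_on V k'" 
    using k k' by (auto simp: representer_def bergman1_def intro: holomorphic_on_imp_continuous_on)
  have m: "(\<lambda>z. u z * of_real ((cmod (k' z))\<^sup>2)) \<in> borel_measurable (lb V)"
    by (intro borel_measurable_lb continuous_intros u kc)
  have m2: "(\<lambda>z. (cmod (k' z))\<^sup>2) \<in> borel_measurable (lb V)"
    by (intro borel_measurable_lb continuous_intros kc)
  have kk: "k' (w * z) = k z" for z using w0 by (simp add: k'_def mult.assoc[symmetric])
  have "sq_norm (lb V) k = sq_norm (lb V) k'"
    using integral_rotation(1)[OF w S inv[OF w] m2] by (simp add: kk sq_norm_def)
  moreover have "(LINT z|lb V. u (w * z) * of_real ((cmod (k z))\<^sup>2)) = (LINT z|lb V. u z * of_real ((cmod (k' z))\<^sup>2))"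
    using integral_rotation(1)[OF w S inv[OF w] m] by (simp only: kk)
  moreover have "w * v \<in> V" using v inv[OF w] by simp
  ultimately show "(LINT z|lb V. u (w * z) * of_real ((cmod (k z))\<^sup>2)) = u (w * v) * of_real (sq_norm (lb V) k)"
    using b k' by (simp add: berezin_fixed_def del: of_real_power)
qed

text \<open>The component of \<open>u\<close> on which a rotation by \<open>a\<close> acts as
  multiplication by \<open>a powi d\<close>.\<close>

definition rotation_mode :: "int \<Rightarrow> (complex \<Rightarrow> complex) \<Rightarrow> complex \<Rightarrow> complex" where
  "rotation_mode d u z = circle_mean (\<lambda>w. u (w * z) * w powi (- d))"

lemma continuous_on_powi_sphere: "continuous_on (sphere 0 1) (\<lambda>w. w powi d :: complex)"
  by (intro continuous_intros) auto

lemma continuous_on_rotate: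
  assumes u: "continuous_on S u" and inv: "\<And>w z. cmod w = 1 \<Longrightarrow> z \<in> S \<Longrightarrow> w * z \<in> S"
  shows "continuous_on (S \<times> sphere 0 1) (\<lambda>(z, w). u (w * z) * w powi d)"
  unfolding case_prod_beta
  by (intro continuous_on_mult continuous_on_compose2[OF u] continuous_on_compose2[OF continuous_on_powi_sphere] continuous_intros)
    (auto simp: inv)

lemma continuous_on_rotation_mode:
  assumes u: "continuous_on S u" and inv: "\<And>w z. cmod w = 1 \<Longrightarrow> z \<in> S \<Longrightarrow> w * z \<in> S"
  shows "continuous_on S (rotation_mode d u)"
proof -
  have "continuous_on S (\<lambda>z. circle_mean (\<lambda>w. u (w * z) * w powi (- d)))"
    by (rule continuous_on_circle_mean_param[OF continuous_on_rotate[OF assms]])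
  then show ?thesis by (simp add: rotation_mode_def[abs_def])
qed

lemma rotation_mode_rotate:
  assumes u: "continuous_on S u" and inv: "\<And>w z. cmod w = 1 \<Longrightarrow> z \<in> S \<Longrightarrow> w * z \<in> S"
    and a: "cmod a = 1" and z: "z \<in> S"
  shows "rotation_mode d u (a * z) = a powi d * rotation_mode d u z"
proof -
  have a0: "a \<noteq> 0" using a by auto
  have c: "continuous_on (sphere 0 1) (\<lambda>w. a powi d * (u (w * z) * w powi (- d)))"
    by (intro continuous_on_mult continuous_on_const continuous_on_powi_sphere continuous_on_compose2[OF u] continuous_intros)
      (auto simp: inv z)
  have "rotation_mode d u (a * z) = circle_mean (\<lambda>w. a powi d * (u ((a * w) * z) * (a * w) powi (- d)))"
    unfolding rotation_mode_def
  proof (rule circle_mean_cong)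
    fix w :: complex
    have "a powi d * a powi (- d) = 1" using a0 by (simp add: power_int_minus)
    then show "u (w * (a * z)) * w powi - d = a powi d * (u (a * w * z) * (a * w) powi - d)"
      by (simp add: power_int_mult_distrib mult_ac)
  qed
  also have "\<dots> = circle_mean (\<lambda>w. a powi d * (u (w * z) * w powi (- d)))"
    by (rule circle_mean_rotate[OF c a])
  finally show ?thesis by (simp add: circle_mean_mult_left rotation_mode_def)
qed

text \<open>A mode is an average of rotated copies of \<open>u\<close>, each of them fixed. The
  integrands are dominated by \<open>B * (cmod (k z))\<^sup>2\<close> uniformly in the rotation, so
  the two averages may be interchanged.\<close>

lemma berezin_fixed_rotation_mode:
  assumes V: "open V" "bounded V" and inv: "\<And>w z. cmod w = 1 \<Longrightarrow> w * z \<in> V \<longleftrightarrow> z \<in> V"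
    and u: "continuous_on (closure V) u" and b: "berezin_fixed V u"
  shows "berezin_fixed V (rotation_mode d u)"
  unfolding berezin_fixed_def
proof (intro allI impI)
  fix v k assume v: "v \<in> V" and k: "representer V v k"
  have uV: "continuous_on V u" using u closure_subset by (rule continuous_on_subset)
  have kl: "k \<in> l2 (lb V)" and kc: "continuous_on V k"
    using k by (auto simp: representer_def bergman1_def intro: holomorphic_on_imp_continuous_on)
  obtain B where B: "\<And>z. z \<in> closure V \<Longrightarrow> cmod (u z) \<le> B"
    using bounded_of_closure[OF V(2) u] by blast
  define F where "F = (\<lambda>w z. (u (w * z) * w powi (- d)) * of_real ((cmod (k z))\<^sup>2))"
  have c1: "continuous_on (sphere 0 1 \<times> V) (\<lambda>(w, z). u (w * z) * w powi (- d))"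
    unfolding case_prod_beta
    by (rule continuous_on_pair_compose[OF continuous_on_rotate[OF uV]]) (auto simp: inv intro!: continuous_intros)
  have c2: "continuous_on (sphere 0 1 \<times> V) (\<lambda>(w, z). F w z)"
    unfolding F_def case_prod_beta
    by (intro continuous_on_mult c1[unfolded case_prod_beta] continuous_intros continuous_on_compose2[OF kc]) auto
  have bnd: "cmod (F w z) \<le> B * (cmod (k z))\<^sup>2" if w: "cmod w = 1" and z: "z \<in> V" for w z
  proof -
    have "cmod (u (w * z)) \<le> B" using B inv[OF w] z closure_subset by blast
    then show ?thesis
      using w by (simp add: F_def norm_mult norm_power norm_power_int mult_right_mono)
  qed
  have ik: "integrable (lb V) (\<lambda>z. B * (cmod (k z))\<^sup>2)" using kl by (simp add: l2_def)
  have iF: "integrable (lb V) (F w)" if w: "cmod w = 1" for w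
  proof (rule Bochner_Integration.integrable_bound[OF ik])
    have "continuous_on V (\<lambda>z. F w z)"
      by (rule continuous_on_pair_compose[OF c2]) (use w in \<open>auto intro!: continuous_intros\<close>)
    then show "F w \<in> borel_measurable (lb V)" by (rule borel_measurable_lb)
    show "AE z in lb V. norm (F w z) \<le> norm (B * (cmod (k z))\<^sup>2)"
      using bnd[OF w] by (intro AE_I2) (fastforce simp: space_restrict_space)
  qed
  have "(LINT z|lb V. rotation_mode d u z * of_real ((cmod (k z))\<^sup>2)) = (LINT z|lb V. circle_mean (\<lambda>w. F w z))"
    by (simp only: rotation_mode_def F_def circle_mean_mult_right)
  also have "\<dots> = circle_mean (\<lambda>w. LINT z|lb V. F w z)"
  proof (rule circle_mean_fubini(1)[symmetric, OF _ c2 iF])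
    show "V \<in> sets borel" using V by simp
    fix w :: complex assume w: "cmod w = 1"
    show "(LINT z|lb V. cmod (F w z)) \<le> (LINT z|lb V. B * (cmod (k z))\<^sup>2)"
      by (rule integral_mono[OF _ ik]) (use iF[OF w] bnd[OF w] in \<open>auto simp: space_restrict_space\<close>)
  qed
  also have "\<dots> = circle_mean (\<lambda>w. (u (w * v) * w powi (- d)) * of_real (sq_norm (lb V) k))"
  proof (rule circle_mean_cong)
    fix w :: complex assume w: "cmod w = 1"
    have "(LINT z|lb V. F w z) = w powi (- d) * (LINT z|lb V. u (w * z) * of_real ((cmod (k z))\<^sup>2))"
      unfolding F_def by (subst Bochner_Integration.integral_mult_right_zero[symmetric]) (simp add: mult_ac del: of_real_power)
    also have "(LINT z|lb V. u (w * z) * of_real ((cmod (k z))\<^sup>2)) = u (w * v) * of_real (sq_norm (lb V) k)"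
      using berezin_fixed_rotate[OF w V inv uV b] v k by (simp add: berezin_fixed_def del: of_real_power)
    finally show "(LINT z|lb V. F w z) = (u (w * v) * w powi (- d)) * of_real (sq_norm (lb V) k)"
      by (simp add: mult_ac)
  qed
  finally show "(LINT z|lb V. rotation_mode d u z * of_real ((cmod (k z))\<^sup>2)) = rotation_mode d u v * of_real (sq_norm (lb V) k)"
    by (simp only: circle_mean_mult_right rotation_mode_def)
qed

section \<open>Harmonic extension of the nonzero modes\<close>

lemma interpolate_powers:
  fixes x y :: real and p q :: complex
  assumes "x \<noteq> 0" "y \<noteq> 0" "x\<^sup>2 \<noteq> y\<^sup>2"
  shows "\<exists>A B. A * of_real x + B / of_real x = p \<and> A * of_real y + B / of_real y = q"
proof -
  define X Y where "X = complex_of_real x" and "Y = complex_of_real y"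
  have X: "X \<noteq> 0" "Y \<noteq> 0" "X * X - Y * Y \<noteq> 0"
    using assms by (auto simp: X_def Y_def power2_eq_square simp flip: of_real_mult)
  \<comment> \<open>Multiplying the two equations by \<open>X\<close> and \<open>Y\<close> turns
    them into a system linear in \<open>X * X\<close> and \<open>Y * Y\<close>; \<open>B\<close> is
    eliminated by subtraction.\<close>
  define A where "A = (X * p - Y * q) / (X * X - Y * Y)"
  define B where "B = X * p - A * (X * X)"
  have A: "A * (X * X - Y * Y) = X * p - Y * q" using X by (simp add: A_def)
  have "A * X + B / X = p" using X by (simp add: B_def field_simps)
  moreover have "A * Y + B / Y = q"
  proof -
    have "A * (Y * Y) + B = Y * q" using A by (simp add: B_def algebra_simps)
    then show ?thesis using X by (simp add: field_simps)
  qed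
  ultimately show ?thesis unfolding X_def Y_def by blast
qed

lemma powi_real_neq:
  fixes r R :: real
  assumes "0 < r" "r < R" "d \<noteq> 0" shows "(R powi d)\<^sup>2 \<noteq> (r powi d)\<^sup>2"
proof -
  have "R powi d \<noteq> r powi d"
  proof (cases "d > 0")
    case True
    then have "r ^ nat d < R ^ nat d" using assms by (intro power_strict_mono) auto
    then show ?thesis using True by (simp add: power_int_def)
  next
    case False
    then have "r ^ nat (- d) < R ^ nat (- d)" using assms by (intro power_strict_mono) auto
    then show ?thesis using False assms by (simp add: power_int_def power_inverse)
  qed
  then show ?thesis using assms by (simp add: power2_eq_iff_nonneg)
qed

text \<open>By equivariance a mode on a boundary circle is determined by its value at the positive
  real point. The function to be found is a combination of \<open>z powi d\<close> and
  \<open>cnj (z powi (- d))\<close>, which share this equivariance, so only the values at the one or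
  two radii have to be matched.\<close>

lemma rotation_mode_boundary:
  assumes rR: "r < R" "0 < R" "r \<noteq> 0" and u: "continuous_on (closure (round_domain r R)) u" and d: "d \<noteq> 0"
  shows "\<exists>f g. f holomorphic_on round_domain r R \<and> continuous_on (closure (round_domain r R)) f \<and>
    g holomorphic_on round_domain r R \<and> continuous_on (closure (round_domain r R)) g \<and>
    (\<forall>z\<in>frontier (round_domain r R). rotation_mode d u z = f z + cnj (g z))"
proof -
  let ?V = "round_domain r R"
  have eq: "rotation_mode d u (of_real t * a) = a powi d * rotation_mode d u (of_real t)"
    if "of_real t \<in> closure ?V" "cmod a = 1" for t a
    using rotation_mode_rotate[OF u round_domain_closure_rotate that(2,1)] by (simp add: mult.commute)
  have cl0: "z \<noteq> 0" if "0 < r" "z \<in> closure ?V" for z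
    using that round_domain_closure_subset[of r R] by auto
  have V0: "z \<noteq> 0" if "0 < r" "z \<in> ?V" for z
    using that by (auto simp: round_domain_def)
  have polar: "\<exists>a. cmod a = 1 \<and> z = of_real (cmod z) * a \<and> z \<noteq> 0" if "0 < cmod z" for z :: complex
    using that by (intro exI[of _ "z / of_real (cmod z)"]) (auto simp: norm_divide)
  \<comment> \<open>On the unit circle conjugation is inversion, so the conjugate of a power with
    exponent \<open>- d\<close> rotates like a power with exponent \<open>d\<close>.\<close>
  have unit: "cnj a powi (- d) = a powi d" if "cmod a = 1" for a d
  proof -
    have "a * cnj a = 1" using that by (simp add: complex_norm_square[symmetric])
    then have "cnj a = inverse a" using inverse_unique by metis
    then show ?thesis by (simp add: power_int_inverse power_int_minus)
  qed
  note RV = round_domain_closure_real[OF rR]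
  show ?thesis
  proof (cases "0 < r")
    case True
    \<comment> \<open>The unknowns are interpolated in the numbers \<open>R powi d\<close> and
      \<open>r powi d\<close>; their squares differ since \<open>d\<close> is nonzero.\<close>
    have "R powi d \<noteq> 0" "r powi d \<noteq> 0" using True rR by auto
    then obtain A B where A: "A * of_real (R powi d) + B / of_real (R powi d) = rotation_mode d u R"
      and B: "A * of_real (r powi d) + B / of_real (r powi d) = rotation_mode d u r"
      using interpolate_powers powi_real_neq[OF True rR(1) d] by blast
    define f where "f = (\<lambda>z. A * z powi d)"
    define g where "g = (\<lambda>z. cnj B * z powi (- d))"
    have "f holomorphic_on ?V" "g holomorphic_on ?V" "continuous_on (closure ?V) f" "continuous_on (closure ?V) g"
      unfolding f_def g_def using V0 cl0 True by (auto intro!: holomorphic_intros continuous_intros)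
    moreover have "rotation_mode d u z = f z + cnj (g z)" if z: "z \<in> frontier ?V" for z
    proof -
      have cz: "cmod z = r \<or> cmod z = R" using z round_domain_frontier by blast
      then have "0 < cmod z" using True rR by auto
      then obtain a where a: "cmod a = 1" "z = of_real (cmod z) * a" using polar by blast
      define t where "t = cmod z"
      have t: "t = r \<or> t = R" and zt: "z = of_real t * a" using cz a by (auto simp: t_def)
      have "of_real t \<in> closure ?V" using t RV True by auto
      then have "rotation_mode d u z = a powi d * rotation_mode d u (of_real t)" unfolding zt using a(1) by (rule eq)
      also have "rotation_mode d u (of_real t) = A * of_real (t powi d) + B / of_real (t powi d)"
        using t A B by auto
      also have "a powi d * (A * of_real (t powi d) + B / of_real (t powi d))
          = A * (of_real t powi d * a powi d) + B * (of_real t powi (- d) * a powi d)"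
        by (simp add: distrib_left power_int_minus field_simps)
      also have "A * (of_real t powi d * a powi d) = f z"
        by (simp add: f_def zt power_int_mult_distrib)
      also have "B * (of_real t powi (- d) * a powi d) = cnj (g z)"
        unfolding unit[OF a(1), symmetric] by (simp add: g_def zt power_int_mult_distrib)
      finally show ?thesis .
    qed
    ultimately show ?thesis by blast
  next
    case False
    then have r: "r < 0" using rR by simp
    have fr: "\<exists>a. cmod a = 1 \<and> z = of_real R * a" if z: "z \<in> frontier ?V" for z
    proof -
      have "cmod z = R" using z round_domain_frontier r norm_ge_zero[of z] by fastforce
      then show ?thesis using polar[of z] rR by auto
    qed
    have mR: "rotation_mode d u (of_real R * a) = a powi d * rotation_mode d u (of_real R)" if "cmod a = 1" for a
      using RV(1) that by (rule eq)
    have R0: "complex_of_real R \<noteq> 0" using rR by simp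
    show ?thesis
    \<comment> \<open>A disk has a single boundary circle, so one monomial suffices. The sign of
      \<open>d\<close> decides between a power and the conjugate of a power, so that the exponent
      stays nonnegative at the origin.\<close>
    proof (cases "0 < d")
      case True
      define n where "n = nat d"
      have dn: "d = int n" using True by (simp add: n_def)
      define f where "f = (\<lambda>z. rotation_mode d u (of_real R) / of_real R ^ n * z ^ n)"
      have "rotation_mode d u z = f z + cnj 0" if z: "z \<in> frontier ?V" for z
      proof -
        obtain a where a: "cmod a = 1" "z = of_real R * a" using fr[OF z] by blast
        have "a powi d = a ^ n" by (simp add: dn)
        then show ?thesis using R0 a by (simp add: mR f_def power_mult_distrib)
      qed
      moreover have "f holomorphic_on ?V" "continuous_on (closure ?V) f"
        unfolding f_def using rR(2) by (auto intro!: holomorphic_intros continuous_intros)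
      ultimately show ?thesis
        by (intro exI[of _ f] exI[of _ "\<lambda>_. 0"]) auto
    next
      case False
      define n where "n = nat (- d)"
      have dn: "d = - int n" using False by (simp add: n_def)
      define g where "g = (\<lambda>z. cnj (rotation_mode d u (of_real R)) / of_real R ^ n * z ^ n)"
      have "rotation_mode d u z = 0 + cnj (g z)" if z: "z \<in> frontier ?V" for z
      proof -
        obtain a where a: "cmod a = 1" "z = of_real R * a" using fr[OF z] by blast
        have "cnj a ^ n = a powi d" using unit[OF a(1), of d] by (simp add: dn)
        then show ?thesis using R0 a by (simp add: mR g_def power_mult_distrib)
      qed
      moreover have "g holomorphic_on ?V" "continuous_on (closure ?V) g"
        unfolding g_def using rR(2) by (auto intro!: holomorphic_intros continuous_intros)
      ultimately show ?thesis
        by (intro exI[of _ "\<lambda>_. 0"] exI[of _ g]) auto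
    qed
  qed
qed

lemma berezin_fixed_add:
  assumes V: "bounded V" and "continuous_on (closure V) s" "continuous_on (closure V) t" "berezin_fixed V s" "berezin_fixed V t"
  shows "berezin_fixed V (\<lambda>z. s z + t z)"
  using berezin_fixed_diff[OF V assms(2) _ assms(4) berezin_fixed_cmul[OF assms(5), of "-1"]] assms(3)
  by (simp add: continuous_on_minus)

text \<open>The mode and its candidate are both fixed and agree on the frontier; the maximum
  principle is applied to their difference.\<close>

lemma rotation_mode_harmonic:
  assumes rR: "r < R" "0 < R" "r \<noteq> 0" and u: "continuous_on (closure (round_domain r R)) u" and b: "berezin_fixed (round_domain r R) u"
    and d: "d \<noteq> 0"
  shows "\<exists>f g. f holomorphic_on round_domain r R \<and> g holomorphic_on round_domain r R \<and>
    (\<forall>z\<in>round_domain r R. rotation_mode d u z = f z + cnj (g z))"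
proof -
  let ?V = "round_domain r R"
  obtain f g where fg: "f holomorphic_on ?V" "continuous_on (closure ?V) f"
    "g holomorphic_on ?V" "continuous_on (closure ?V) g"
    and fr: "\<And>z. z \<in> frontier ?V \<Longrightarrow> rotation_mode d u z = f z + cnj (g z)"
    using rotation_mode_boundary[OF rR u d] by blast
  define s where "s = (\<lambda>z. rotation_mode d u z - (f z + cnj (g z)))"
  have cm: "continuous_on (closure ?V) (rotation_mode d u)"
    using u round_domain_closure_rotate by (rule continuous_on_rotation_mode)
  have cfg: "continuous_on (closure ?V) (\<lambda>z. f z + cnj (g z))"
    by (intro continuous_intros fg)
  have bm: "berezin_fixed ?V (rotation_mode d u)"
    by (rule berezin_fixed_rotation_mode[OF round_domain_open round_domain_bounded round_domain_rotate u b])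
  have bfg: "berezin_fixed ?V (\<lambda>z. f z + cnj (g z))"
    by (intro berezin_fixed_add berezin_fixed_cnj berezin_fixed_holomorphic round_domain_bounded fg continuous_on_cnj)
  have "s z = 0" if "z \<in> ?V" for z
  proof (rule berezin_fixed_maximum_principle[OF round_domain_open round_domain_bounded round_domain_connected _ _ _ that])
    show "continuous_on (closure ?V) s" unfolding s_def by (intro continuous_on_diff cm cfg)
    show "berezin_fixed ?V s" unfolding s_def by (rule berezin_fixed_diff[OF round_domain_bounded cm cfg bm bfg])
    show "s z = 0" if "z \<in> frontier ?V" for z using fr[OF that] by (simp add: s_def)
  qed
  then show ?thesis using fg(1,3) by (auto simp: s_def)
qed

section \<open>Berezin-fixed products on disks and annuli\<close>

lemma circle_mean_mean_value':
  assumes h: "h holomorphic_on V" and V: "open V" and sub: "cball z (cmod c) \<subseteq> V"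
  shows "circle_mean (\<lambda>a. h (z + c * a)) = h z"
proof (cases "c = 0")
  case False
  define b where "b = c / of_real (cmod c)"
  have b: "cmod b = 1" "c = of_real (cmod c) * b" using False by (auto simp: b_def norm_divide)
  have hc: "continuous_on V h" using h by (rule holomorphic_on_imp_continuous_on)
  have cc: "continuous_on (sphere 0 1) (\<lambda>a. h (z + of_real (cmod c) * a))"
    by (rule continuous_on_compose2[OF hc]) (auto intro!: continuous_intros subsetD[OF sub] simp: dist_norm norm_mult)
  have "circle_mean (\<lambda>a. h (z + c * a)) = circle_mean (\<lambda>a. h (z + of_real (cmod c) * (b * a)))"
    using b(2) by (simp add: mult.assoc[symmetric])
  also have "\<dots> = circle_mean (\<lambda>a. h (z + of_real (cmod c) * a))"
    by (rule circle_mean_rotate[OF cc b(1)])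
  also have "\<dots> = h z"
    using False
    by (intro circle_mean_mean_value continuous_on_subset[OF hc sub]
        holomorphic_on_subset[OF h subset_trans[OF ball_subset_cball sub]]) simp
  finally show ?thesis .
qed simp

text \<open>The value \<open>deriv h z\<close> at \<open>z\<close> removes the singularity, so that
  circles may shrink to the point.\<close>

definition diff_quotient :: "(complex \<Rightarrow> complex) \<Rightarrow> complex \<Rightarrow> complex \<Rightarrow> complex" where
  "diff_quotient h z y = (if y = z then deriv h z else (h y - h z) / (y - z))"

lemma diff_quotient_continuous:
  assumes "h holomorphic_on V" "open V" "z \<in> V" shows "continuous_on V (diff_quotient h z)"
proof -
  have "(\<lambda>y. if y = z then deriv h z else (h y - h z) / (y - z)) holomorphic_on V"
    using assms by (intro pole_lemma) (simp_all add: interior_open)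
  then show ?thesis unfolding diff_quotient_def[abs_def] by (rule holomorphic_on_imp_continuous_on)
qed

lemma diff_quotient_mult: "h y - h z = (y - z) * diff_quotient h z y"
  by (simp add: diff_quotient_def)

text \<open>A finite difference version of the Laplacian of \<open>h\<^sub>2 \<cdot> cnj h\<^sub>1\<close>.\<close>

lemma mean_increment:
  assumes h: "h1 holomorphic_on V" "h2 holomorphic_on V" and V: "open V" and sub: "cball z (cmod c) \<subseteq> V"
  shows "circle_mean (\<lambda>a. h2 (z + c * a) * cnj (h1 (z + c * a))) - h2 z * cnj (h1 z)
    = of_real ((cmod c)\<^sup>2) * circle_mean (\<lambda>a. diff_quotient h2 z (z + c * a) * cnj (diff_quotient h1 z (z + c * a)))"
proof -
  have cc: "continuous_on (sphere 0 1) (\<lambda>a. h (z + c * a))" if "h holomorphic_on V" for h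
    by (rule continuous_on_compose2[OF holomorphic_on_imp_continuous_on[OF that]])
      (auto intro!: continuous_intros subsetD[OF sub] simp: dist_norm norm_mult)
  note c1 = cc[OF h(1)] and c2 = cc[OF h(2)]
  note m1 = circle_mean_mean_value'[OF h(1) V sub] and m2 = circle_mean_mean_value'[OF h(2) V sub]
  \<comment> \<open>By the mean value property each mixed term and the constant term average to plus
    or minus \<open>h2 z * cnj (h1 z)\<close>; together they amount to subtracting this value
    once.\<close>
  have "circle_mean (\<lambda>a. (h2 (z + c * a) - h2 z) * cnj (h1 (z + c * a) - h1 z))
      = circle_mean (\<lambda>a. h2 (z + c * a) * cnj (h1 (z + c * a)) - h2 (z + c * a) * cnj (h1 z)
          - (h2 z * cnj (h1 (z + c * a)) - h2 z * cnj (h1 z)))"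
    by (simp add: algebra_simps)
  also have "\<dots> = circle_mean (\<lambda>a. h2 (z + c * a) * cnj (h1 (z + c * a))) - h2 z * cnj (h1 z)"
    by (subst circle_mean_diff circle_mean_diff circle_mean_diff)+
      (auto intro!: continuous_on_diff continuous_on_mult continuous_on_cnj continuous_on_const c1 c2
        simp: circle_mean_diff circle_mean_mult_left circle_mean_mult_right circle_mean_cnj m1 m2 continuous_on_mult continuous_on_cnj c1 c2)
  finally have "circle_mean (\<lambda>a. h2 (z + c * a) * cnj (h1 (z + c * a))) - h2 z * cnj (h1 z)
      = circle_mean (\<lambda>a. (h2 (z + c * a) - h2 z) * cnj (h1 (z + c * a) - h1 z))" by simp
  also have "\<dots> = circle_mean (\<lambda>a. of_real ((cmod c)\<^sup>2) * (diff_quotient h2 z (z + c * a) * cnj (diff_quotient h1 z (z + c * a))))"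
  proof (rule circle_mean_cong)
    fix a :: complex assume a: "cmod a = 1"
    have eq: "(c * a) * cnj (c * a) = of_real ((cmod c)\<^sup>2)"
      using a by (simp only: complex_norm_square[symmetric]) (simp add: norm_mult)
    have "(h2 (z + c * a) - h2 z) * cnj (h1 (z + c * a) - h1 z)
        = ((c * a) * cnj (c * a)) * (diff_quotient h2 z (z + c * a) * cnj (diff_quotient h1 z (z + c * a)))"
      unfolding diff_quotient_mult[of _ "z + c * a" z] by (simp only: add_diff_cancel_left' complex_cnj_mult mult_ac)
    then show "(h2 (z + c * a) - h2 z) * cnj (h1 (z + c * a) - h1 z)
        = of_real ((cmod c)\<^sup>2) * (diff_quotient h2 z (z + c * a) * cnj (diff_quotient h1 z (z + c * a)))"
      by (simp only: eq)
  qed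
  finally show ?thesis by (simp only: circle_mean_mult_left)
qed

text \<open>As a function of the rotation \<open>w\<close>, the increment has as Fourier
  coefficients the increments of the modes of \<open>u\<close>. The modes of nonzero index are
  harmonic, so these coefficients vanish and the increment is constant. The circle about
  \<open>z\<close> has radius \<open>e * cmod z\<close>, so rotating the centre rotates the whole
  circle.\<close>

lemma mean_increment_radial:
  assumes rR: "r < R" "0 < R" "r \<noteq> 0" and u: "continuous_on (closure (round_domain r R)) u" and b: "berezin_fixed (round_domain r R) u"
    and z: "z \<in> round_domain r R" and sub: "cball z (e * cmod z) \<subseteq> round_domain r R" and e: "0 \<le> e" and w: "cmod w = 1"
  shows "circle_mean (\<lambda>a. u (w * z + of_real e * (w * z) * a)) - u (w * z)
    = circle_mean (\<lambda>a. u (z + of_real e * z * a)) - u z"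
proof -
  let ?V = "round_domain r R"
  have uV: "continuous_on ?V u" using u closure_subset by (rule continuous_on_subset)
  have inV: "z + of_real e * z * a \<in> ?V" if "cmod a = 1" for a
    by (rule subsetD[OF sub]) (use that e in \<open>simp add: dist_norm norm_mult\<close>)
  define q where "q = (\<lambda>w. circle_mean (\<lambda>a. u (w * (z + of_real e * z * a))) - u (w * z))"
  have c2: "continuous_on (sphere 0 1 \<times> sphere 0 1) (\<lambda>(w, a). u (w * (z + of_real e * z * a)))"
    unfolding case_prod_beta
    by (rule continuous_on_compose2[OF uV]) (auto intro!: continuous_intros simp: round_domain_rotate inV)
  have c2': "continuous_on (sphere 0 1 \<times> sphere 0 1) (\<lambda>(w, a). u (w * (z + of_real e * z * a)) * w powi d)" for d
    unfolding case_prod_beta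
    by (intro continuous_on_mult c2[unfolded case_prod_beta] continuous_on_compose2[OF continuous_on_powi_sphere] continuous_intros)
      auto
  have cu: "continuous_on (sphere 0 1) (\<lambda>w. u (w * z))"
    by (rule continuous_on_compose2[OF uV]) (auto intro!: continuous_intros simp: round_domain_rotate z)
  have cq1: "continuous_on (sphere 0 1) (\<lambda>w. circle_mean (\<lambda>a. u (w * (z + of_real e * z * a))))"
    by (rule continuous_on_circle_mean_param[OF c2])
  have cq: "continuous_on (sphere 0 1) q"
    unfolding q_def by (intro continuous_on_diff cq1 cu)
  \<comment> \<open>The factor \<open>w powi d\<close> extracts the mode with index
    \<open>- d\<close>, which is why the harmonic representation is taken at that index.\<close>
  have "circle_mean (\<lambda>w. q w * w powi d) = 0" if d: "d \<noteq> 0" for d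
  proof -
    have d': "- d \<noteq> 0" using d by simp
    obtain f g where f: "f holomorphic_on ?V" and g: "g holomorphic_on ?V"
      and fg: "\<And>z. z \<in> ?V \<Longrightarrow> rotation_mode (- d) u z = f z + cnj (g z)"
      using rotation_mode_harmonic[OF rR u b d'] by blast
    have sub': "cball z (cmod (of_real e * z)) \<subseteq> ?V" using sub e by (simp add: norm_mult)
    have cf: "continuous_on (sphere 0 1) (\<lambda>a. f (z + of_real e * z * a))" if "f holomorphic_on ?V" for f
      by (rule continuous_on_compose2[OF holomorphic_on_imp_continuous_on[OF that]])
        (auto intro!: continuous_intros simp: inV)
    have "circle_mean (\<lambda>w. q w * w powi d)
        = circle_mean (\<lambda>w. circle_mean (\<lambda>a. u (w * (z + of_real e * z * a)) * w powi d) - u (w * z) * w powi d)"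
      by (simp only: q_def left_diff_distrib circle_mean_mult_right)
    also have "\<dots> = circle_mean (\<lambda>w. circle_mean (\<lambda>a. u (w * (z + of_real e * z * a)) * w powi d)) - rotation_mode (- d) u z"
      by (subst circle_mean_diff[OF continuous_on_circle_mean_param[OF c2']])
        (auto intro!: continuous_on_mult cu continuous_on_powi_sphere simp: rotation_mode_def)
    also have "circle_mean (\<lambda>w. circle_mean (\<lambda>a. u (w * (z + of_real e * z * a)) * w powi d))
        = circle_mean (\<lambda>a. circle_mean (\<lambda>w. u (w * (z + of_real e * z * a)) * w powi d))"
      by (rule circle_mean_swap[OF c2'])
    also have "\<dots> = circle_mean (\<lambda>a. f (z + of_real e * z * a) + cnj (g (z + of_real e * z * a)))"
      by (rule circle_mean_cong) (simp add: fg[OF inV, symmetric] rotation_mode_def)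
    also have "\<dots> = f z + cnj (g z)"
      by (simp only: circle_mean_add[OF cf[OF f] continuous_on_cnj[OF cf[OF g]]] circle_mean_cnj
          circle_mean_mean_value'[OF f round_domain_open sub'] circle_mean_mean_value'[OF g round_domain_open sub'])
    finally show ?thesis by (simp add: fg[OF z])
  qed
  from fourier_unique_constant[OF cq this w] fourier_unique_constant[OF cq this, of 1]
  have "q w = q 1" by simp
  then show ?thesis by (simp add: q_def distrib_left mult_ac)
qed

text \<open>Divided by the squared radius, the increment is a mean of difference quotients that
  extends continuously to radius zero, where it equals the product of the derivatives. At
  \<open>z = 0\<close> the circles would degenerate, but there both sides are the same
  expression.\<close>

lemma derivative_product_radial:
  assumes rR: "r < R" "0 < R" "r \<noteq> 0"
    and h1: "h1 holomorphic_on round_domain r R" "continuous_on (closure (round_domain r R)) h1"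
    and h2: "h2 holomorphic_on round_domain r R" "continuous_on (closure (round_domain r R)) h2"
    and b: "berezin_fixed (round_domain r R) (\<lambda>z. h2 z * cnj (h1 z))"
    and z: "z \<in> round_domain r R" and w: "cmod w = 1"
  shows "deriv h2 (w * z) * cnj (deriv h1 (w * z)) = deriv h2 z * cnj (deriv h1 z)"
proof (cases "z = 0")
  case False
  let ?V = "round_domain r R"
  have wz: "w * z \<in> ?V" using z round_domain_rotate[OF w] by simp
  obtain d where d: "0 < d" "cball z d \<subseteq> ?V" using round_domain_open z open_contains_cball by metis
  obtain d' where d': "0 < d'" "cball (w * z) d' \<subseteq> ?V" using round_domain_open wz open_contains_cball by metis
  \<comment> \<open>For \<open>e\<close> up to \<open>m\<close>, the disks of radius
    \<open>e * cmod z\<close> about \<open>z\<close> and about \<open>w * z\<close> both stay inside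
    the domain.\<close>
  define m where "m = min d d' / cmod z"
  have m: "0 < m" "m * cmod z = min d d'" using d d' False by (auto simp: m_def)
  have cwz: "cmod (w * z) = cmod z" using w by (simp add: norm_mult)
  have em: "e * cmod z \<le> d" "e * cmod z \<le> d'" if "e \<le> m" for e
    using mult_right_mono[OF that norm_ge_zero[of z]] m(2) by auto
  have sub: "cball z (e * cmod z) \<subseteq> ?V" "cball (w * z) (e * cmod z) \<subseteq> ?V" if "e \<le> m" for e
    using em[OF that] d d' subset_cball by (meson order_trans)+
  define E where "E y e = circle_mean (\<lambda>a. diff_quotient h2 y (y + of_real e * y * a) * cnj (diff_quotient h1 y (y + of_real e * y * a)))" for y e
  have Ec: "continuous_on {0..m} (E y)" if y: "y \<in> ?V" and sy: "\<And>e. e \<le> m \<Longrightarrow> cball y (e * cmod y) \<subseteq> ?V" for y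
  proof -
    have inV: "y + of_real e * y * a \<in> ?V" if "cmod a = 1" "0 \<le> e" "e \<le> m" for a e
      by (rule subsetD[OF sy[of e]]) (use that in \<open>simp_all add: dist_norm norm_mult\<close>)
    have "continuous_on {0..m} (\<lambda>e. circle_mean (\<lambda>a. diff_quotient h2 y (y + of_real e * y * a) * cnj (diff_quotient h1 y (y + of_real e * y * a))))"
    proof (rule continuous_on_circle_mean_param)
      show "continuous_on ({0..m} \<times> sphere 0 1)
        (\<lambda>(e, a). diff_quotient h2 y (y + of_real e * y * a) * cnj (diff_quotient h1 y (y + of_real e * y * a)))"
        unfolding case_prod_beta
        by (intro continuous_on_mult continuous_on_cnj continuous_on_compose2[OF diff_quotient_continuous[OF h1(1) round_domain_open y]]
            continuous_on_compose2[OF diff_quotient_continuous[OF h2(1) round_domain_open y]] continuous_intros)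
          (auto simp: inV)
    qed
    then show ?thesis by (simp add: E_def[abs_def])
  qed
  have Ez: "continuous_on {0..m} (E z)" by (rule Ec[OF z sub(1)])
  have Ewz: "continuous_on {0..m} (E (w * z))" by (rule Ec[OF wz]) (simp add: sub(2) cwz)
  have uc: "continuous_on (closure ?V) (\<lambda>z. h2 z * cnj (h1 z))" by (intro continuous_intros h1 h2)
  have eq: "E (w * z) e - E z e = 0" if e: "e \<in> {0<..<m}" for e
  proof -
    have e': "0 \<le> e" "e \<le> m" "0 < e" using e by auto
    have s1: "cball z (cmod (of_real e * z)) \<subseteq> ?V" "cball (w * z) (cmod (of_real e * (w * z))) \<subseteq> ?V"
      using sub[OF e'(2)] e' w by (simp_all add: norm_mult)
    have "of_real ((cmod (of_real e * (w * z)))\<^sup>2) * E (w * z) e = of_real ((cmod (of_real e * z))\<^sup>2) * E z e"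
      unfolding E_def mean_increment[OF h1(1) h2(1) round_domain_open s1(1), symmetric]
        mean_increment[OF h1(1) h2(1) round_domain_open s1(2), symmetric]
      by (rule mean_increment_radial[OF rR uc b z sub(1)[OF e'(2)] e'(1) w])
    moreover have "cmod (of_real e * (w * z)) = cmod (of_real e * z)" using cwz by (simp add: norm_mult)
    moreover have "cmod (of_real e * z) \<noteq> 0" using False e' by simp
    ultimately show ?thesis by simp
  qed
  have cl: "closure {0<..<m} = {0..m}" using m(1) by simp
  \<comment> \<open>Equality was obtained after dividing by the positive radius; continuity carries
    it to \<open>e = 0\<close>.\<close>
  have "E (w * z) 0 - E z 0 = 0"
    by (rule continuous_constant_on_closure[where S="{0<..<m}"])
      (use eq Ez Ewz m(1) in \<open>auto simp: cl intro!: continuous_on_diff\<close>)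
  then show ?thesis by (simp add: E_def diff_quotient_def)
qed simp

section \<open>Linear dependence from a radial product\<close>

lemma holomorphic_eq_cnj_holomorphic_constant:
  assumes S: "convex S" "open S" and f: "f holomorphic_on S" and g: "g holomorphic_on S"
    and eq: "\<And>z. z \<in> S \<Longrightarrow> f z = cnj (g z)"
  shows "\<exists>c. \<forall>z\<in>S. f z = c"
proof (rule has_field_derivative_zero_constant[OF S(1)])
  fix z assume z: "z \<in> S"
  have f': "(f has_derivative (*) (deriv f z)) (at z)"
    using holomorphic_derivI[OF f S(2) z] by (simp add: has_field_derivative_def)
  have g': "(g has_derivative (*) (deriv g z)) (at z)"
    using holomorphic_derivI[OF g S(2) z] by (simp add: has_field_derivative_def)
  have "((\<lambda>z. cnj (g z)) has_derivative (\<lambda>v. cnj (deriv g z * v))) (at z)"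
    by (rule bounded_linear.has_derivative[OF bounded_linear_cnj g'])
  then have "(f has_derivative (\<lambda>v. cnj (deriv g z * v))) (at z)"
    by (rule has_derivative_transform_within_open[OF _ S(2) z]) (simp add: eq)
  \<comment> \<open>The derivative is complex linear and conjugate linear at once; comparing the
    directions 1 and \<open>\<i>\<close> leaves only zero.\<close>
  from has_derivative_unique[OF f' this]
  have *: "deriv f z * v = cnj (deriv g z * v)" for v by metis
  from *[of 1] *[of \<i>] have "deriv f z = 0" by (simp add: complex_eq_iff)
  then show "(f has_field_derivative 0) (at z within S)"
    using holomorphic_derivI[OF f S(2) z] by (simp add: has_field_derivative_at_within)
qed

text \<open>For fixed \<open>w\<close> the radial identity makes \<open>F (w * z) / F z\<close>
  equal to the conjugate of \<open>G z / G (w * z)\<close>, hence a constant \<open>c\<close>. Once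
  \<open>cmod c = 1\<close>, both functions pick up the same factor under \<open>w\<close>; their
  ratio is then constant on the circle through \<open>z0\<close>, and the identity theorem spreads
  this over the domain.\<close>

lemma radial_product_dependent:
  assumes F: "F holomorphic_on round_domain r R" and G: "G holomorphic_on round_domain r R"
    and rad: "\<And>z w. z \<in> round_domain r R \<Longrightarrow> cmod w = 1 \<Longrightarrow> F (w * z) * cnj (G (w * z)) = F z * cnj (G z)"
  shows "(\<forall>z\<in>round_domain r R. F z = 0) \<or> (\<exists>l. \<forall>z\<in>round_domain r R. G z = l * F z)"
proof -
  let ?V = "round_domain r R"
  define W where "W = {z \<in> ?V. F z \<noteq> 0 \<and> G z \<noteq> 0}"
  have Fc: "continuous_on ?V F" and Gc: "continuous_on ?V G"
    using F G by (auto intro: holomorphic_on_imp_continuous_on)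
  have oF: "open (?V \<inter> F -` (- {0}))" by (rule continuous_open_preimage[OF Fc round_domain_open]) (simp add: open_Compl)
  have oG: "open (?V \<inter> G -` (- {0}))" by (rule continuous_open_preimage[OF Gc round_domain_open]) (simp add: open_Compl)
  have oW: "open W"
  proof -
    have "W = (?V \<inter> F -` (- {0})) \<inter> (?V \<inter> G -` (- {0}))" by (auto simp: W_def)
    then show ?thesis using open_Int[OF oF oG] by (simp only:)
  qed
  \<comment> \<open>If \<open>W\<close> is empty but \<open>F\<close> is nonzero somewhere, then
    \<open>G\<close> vanishes on an open set and therefore identically.\<close>
  consider (F0) "\<forall>z\<in>?V. F z = 0" | (G0) "\<forall>z\<in>?V. G z = 0" | (W0) "W \<noteq> {}"
  proof (cases "W = {} \<and> (\<exists>z\<in>?V. F z \<noteq> 0)")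
    case True
    then obtain z1 where z1: "z1 \<in> ?V \<inter> F -` (- {0})" by auto
    have "G z = (\<lambda>_. 0) z" if z: "z \<in> ?V" for z
      by (rule analytic_continuation_open[OF oF round_domain_open _ round_domain_connected _ G holomorphic_on_const _ z])
        (use z1 True in \<open>auto simp: W_def\<close>)
    then show ?thesis using that by simp
  qed (use that in blast)
  then show ?thesis
  proof cases
    case G0 then show ?thesis by (intro disjI2 exI[of _ 0]) simp
  next
    case W0
    then have "infinite W" using finite_imp_not_open oW by blast
    \<comment> \<open>The base point must differ from the origin: the circle through it has to have
      limit points.\<close>
    then have "\<not> W \<subseteq> {0}" by (meson finite.emptyI finite_insert finite_subset)
    then obtain z0 where z0: "z0 \<in> W" "z0 \<noteq> 0" by blast
    have z0V: "z0 \<in> ?V" "F z0 \<noteq> 0" "G z0 \<noteq> 0" using z0 by (auto simp: W_def)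
    obtain e where e: "0 < e" "ball z0 e \<subseteq> W" using oW z0 open_contains_ball by metis
    have BV: "ball z0 e \<subseteq> ?V" using e by (auto simp: W_def)
    define C where "C = sphere (0::complex) (cmod z0)"
    have CV: "C \<subseteq> ?V" using z0V by (auto simp: C_def round_domain_def)
    have key: "G (w * z0) * F z0 = F (w * z0) * G z0" if w: "cmod w = 1" for w
    proof -
      have w0: "w \<noteq> 0" using w by auto
      have hw: "(\<lambda>z. H (w * z)) holomorphic_on ?V" if "H holomorphic_on ?V" for H
      proof -
        have "H \<circ> (\<lambda>z. w * z) holomorphic_on ?V"
          by (rule holomorphic_on_compose_gen[OF _ that]) (auto intro!: holomorphic_intros simp: round_domain_rotate w)
        then show ?thesis by (simp add: o_def)
      qed
      have nz: "F z \<noteq> 0" "G z \<noteq> 0" "F (w * z) \<noteq> 0" "G (w * z) \<noteq> 0" if "z \<in> ball z0 e" for z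
      proof -
        have zW: "z \<in> W" using that e by blast
        then show "F z \<noteq> 0" "G z \<noteq> 0" by (auto simp: W_def)
        then show "F (w * z) \<noteq> 0" "G (w * z) \<noteq> 0"
          using rad[OF _ w, of z] zW by (auto simp: W_def)
      qed
      have "\<exists>c. \<forall>z\<in>ball z0 e. F (w * z) / F z = c"
      proof (rule holomorphic_eq_cnj_holomorphic_constant)
        show "(\<lambda>z. F (w * z) / F z) holomorphic_on ball z0 e" "(\<lambda>z. G z / G (w * z)) holomorphic_on ball z0 e"
          using nz by (auto intro!: holomorphic_on_divide holomorphic_on_subset[OF hw[OF F] BV]
              holomorphic_on_subset[OF F BV] holomorphic_on_subset[OF hw[OF G] BV] holomorphic_on_subset[OF G BV])
        show "F (w * z) / F z = cnj (G z / G (w * z))" if "z \<in> ball z0 e" for z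
          using rad[OF subsetD[OF BV that] w] nz[OF that] by (simp add: field_simps)
      qed auto
      then obtain c where c: "\<And>z. z \<in> ball z0 e \<Longrightarrow> F (w * z) = c * F z"
        using nz by (auto simp: divide_eq_eq)
      have cV: "F (w * z) = c * F z" if z: "z \<in> ?V" for z
        by (rule analytic_continuation_open[OF open_ball round_domain_open _ round_domain_connected BV hw[OF F] _ c z])
          (use e F in \<open>auto intro!: holomorphic_intros\<close>)
      \<comment> \<open>The maximum of \<open>cmod F\<close> on the circle is positive and is
        respected by every rotation. Rotating the maximal point forward gives
        \<open>cmod c \<le> 1\<close>, rotating it backward gives the reverse.\<close>
      have "continuous_on C (\<lambda>z. cmod (F z))"
        by (intro continuous_intros continuous_on_subset[OF Fc CV])
      then obtain z1 where z1: "z1 \<in> C" "\<And>y. y \<in> C \<Longrightarrow> cmod (F y) \<le> cmod (F z1)"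
        using continuous_attains_sup[of C "\<lambda>z. cmod (F z)"] by (auto simp: C_def)
      have pos: "0 < cmod (F z1)"
        using z1(2)[of z0] z0V by (smt (verit) C_def mem_sphere_0 zero_less_norm_iff)
      have "cmod (F (w * z1)) \<le> cmod (F z1)" using z1 w by (auto simp: C_def norm_mult)
      then have c1: "cmod c \<le> 1" using cV[of z1] z1 CV pos by (auto simp: norm_mult)
      define z2 where "z2 = inverse w * z1"
      have z2: "z2 \<in> C" "w * z2 = z1" using z1 w w0 by (auto simp: z2_def C_def norm_mult norm_inverse)
      have "cmod (F z1) = cmod c * cmod (F z2)" using cV[of z2] z2 CV by (auto simp: norm_mult)
      also have "\<dots> \<le> cmod c * cmod (F z1)" using z1(2)[OF z2(1)] by (intro mult_left_mono) auto
      finally have "1 \<le> cmod c" using pos by simp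
      with c1 have "cmod c = 1" by simp
      then have cc: "c * cnj c = 1" by (simp add: complex_norm_square[symmetric])
      \<comment> \<open>The radial identity with the factor \<open>c\<close> inserted; since
        \<open>c * cnj c = 1\<close>, the function \<open>G\<close> acquires the same factor as
        \<open>F\<close>.\<close>
      have "c * F z0 * cnj (G (w * z0)) = F z0 * cnj (G z0)"
        using rad[OF z0V(1) w] cV[OF z0V(1)] by simp
      then have "c * cnj (G (w * z0)) = cnj (G z0)" using z0V by simp
      then have "cnj (c * cnj (G (w * z0))) = cnj (cnj (G z0))" by (rule arg_cong)
      then have "cnj c * G (w * z0) = G z0" by simp
      then have "c * cnj c * G (w * z0) = c * G z0" by (simp add: mult.assoc)
      then have "G (w * z0) = c * G z0" using cc by simp
      then show ?thesis using cV[OF z0V(1)] by simp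
    qed
    define l where "l = G z0 / F z0"
    have zC: "z0 \<in> C" by (simp add: C_def)
    have on_C: "G y - l * F y = 0" if "y \<in> C" for y
    proof -
      have "cmod (y / z0) = 1" using that z0 by (simp add: C_def norm_divide)
      from key[OF this] have "G y * F z0 = F y * G z0" using z0 by simp
      then show ?thesis using z0V by (simp add: l_def field_simps)
    qed
    have lim: "z0 islimpt C"
    proof (rule connected_imp_perfect)
      show "connected C" unfolding C_def by (rule connected_sphere) simp
      have "- z0 \<in> C" "- z0 \<noteq> z0" using z0 by (auto simp: C_def)
      then show "C \<noteq> {x}" for x using zC by auto
    qed (rule zC)
    have hl: "(\<lambda>z. G z - l * F z) holomorphic_on ?V" by (intro holomorphic_intros F G)
    have "G z - l * F z = 0" if "z \<in> ?V" for z
      by (rule analytic_continuation[OF hl round_domain_open round_domain_connected CV z0V(1) lim on_C that])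
    then show ?thesis by (intro disjI2 exI[of _ l]) simp
  next
    case F0 then show ?thesis by blast
  qed
qed

text \<open>Dependence of the derivatives gives \<open>h1 = l * h2 + c\<close> unless
  \<open>h2\<close> is constant already. The integral relation then becomes \<open>cnj l\<close>
  times a weighted square of \<open>h2 - h2 v\<close>, so either \<open>l = 0\<close> or
  \<open>h2\<close> is constant.\<close>

theorem round_domain_dichotomy:
  assumes rR: "r < R" "0 < R" "r \<noteq> 0"
    and h1: "h1 holomorphic_on round_domain r R" "continuous_on (closure (round_domain r R)) h1"
    and h2: "h2 holomorphic_on round_domain r R" "continuous_on (closure (round_domain r R)) h2"
    and hyp: "\<And>v k. v \<in> round_domain r R \<Longrightarrow> representer (round_domain r R) v k \<Longrightarrow>
      (LINT z|lb (round_domain r R). (h2 z - h2 v) * cnj (h1 z - h1 v) * of_real ((cmod (k z))\<^sup>2)) = 0"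
  shows "(\<exists>c. \<forall>z\<in>round_domain r R. h1 z = c) \<or> (\<exists>c. \<forall>z\<in>round_domain r R. h2 z = c)"
proof -
  let ?V = "round_domain r R"
  have b: "berezin_fixed ?V (\<lambda>z. h2 z * cnj (h1 z))"
    unfolding berezin_fixed_def
  proof (intro allI impI)
    fix v k assume v: "v \<in> ?V" and k: "representer ?V v k"
    then have kl: "k \<in> l2 (lb ?V)" by (auto simp: representer_def bergman1_def)
    define K where "K = (\<lambda>z. complex_of_real ((cmod (k z))\<^sup>2))"
    have i: "integrable (lb ?V) (\<lambda>z. s z * K z)" if "continuous_on (closure ?V) s" for s
      unfolding K_def by (rule integrable_weighted[OF round_domain_bounded that kl])
    define N where "N = complex_of_real (sq_norm (lb ?V) k)"
    have c: "continuous_on (closure ?V) (\<lambda>z. h2 z * cnj (h1 z))"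
       "continuous_on (closure ?V) (\<lambda>z. cnj (h1 z))"
      by (intro continuous_intros h1 h2)+
    have e: "(LINT z|lb ?V. s z * K z) = s v * N" if "berezin_fixed ?V s" for s
      using that v k unfolding berezin_fixed_def K_def N_def by blast
    have b2: "berezin_fixed ?V h2" and b1: "berezin_fixed ?V (\<lambda>z. cnj (h1 z))" and b0: "berezin_fixed ?V (\<lambda>z. 1)"
      by (auto intro!: berezin_fixed_holomorphic berezin_fixed_cnj round_domain_bounded h1 h2)
    have "0 = (LINT z|lb ?V. (h2 z - h2 v) * cnj (h1 z - h1 v) * K z)"
      using hyp[OF v k] by (simp add: K_def)
    \<comment> \<open>Of the four terms, those with \<open>h2\<close>, with \<open>cnj h1\<close>
      and with the constant are known because these functions are fixed; the relation is left to
      determine the product.\<close>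
    also have "\<dots> = (LINT z|lb ?V. (h2 z * cnj (h1 z)) * K z - cnj (h1 v) * (h2 z * K z)
        - (h2 v * (cnj (h1 z) * K z) - h2 v * cnj (h1 v) * (1 * K z)))"
      by (simp add: algebra_simps)
    also have "\<dots> = (LINT z|lb ?V. (h2 z * cnj (h1 z)) * K z) - (LINT z|lb ?V. cnj (h1 v) * (h2 z * K z))
        - ((LINT z|lb ?V. h2 v * (cnj (h1 z) * K z)) - (LINT z|lb ?V. h2 v * cnj (h1 v) * (1 * K z)))"
      by (simp only: Bochner_Integration.integral_diff Bochner_Integration.integrable_diff
          integrable_mult_right i[OF c(1)] i[OF c(2)] i[OF h2(2)] i[OF continuous_on_const])
    also have "\<dots> = (LINT z|lb ?V. (h2 z * cnj (h1 z)) * K z) - cnj (h1 v) * (h2 v * N)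
        - (h2 v * (cnj (h1 v) * N) - h2 v * cnj (h1 v) * (1 * N))"
      by (simp only: integral_mult_right_zero e[OF b2] e[OF b1] e[OF b0, unfolded mult_1_left] mult_1_left)
    finally have "(LINT z|lb ?V. (h2 z * cnj (h1 z)) * K z) = h2 v * cnj (h1 v) * N"
      by (simp add: algebra_simps)
    then show "(LINT z|lb ?V. h2 z * cnj (h1 z) * complex_of_real ((cmod (k z))\<^sup>2))
        = h2 v * cnj (h1 v) * complex_of_real (sq_norm (lb ?V) k)"
      by (simp add: K_def N_def)
  qed
  have d: "deriv h1 holomorphic_on ?V" "deriv h2 holomorphic_on ?V"
    using h1 h2 by (auto intro: holomorphic_deriv round_domain_open)
  have const: "\<exists>c. \<forall>z\<in>?V. h z = c" if h: "h holomorphic_on ?V" and h0: "\<And>z. z \<in> ?V \<Longrightarrow> deriv h z = 0" for h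
  proof -
    have "\<forall>x\<in>?V - {}. DERIV h x :> 0"
    proof
      fix x assume "x \<in> ?V - {}"
      then have x: "x \<in> ?V" by simp
      show "DERIV h x :> 0" using holomorphic_derivI[OF h round_domain_open x, of UNIV] h0[OF x] by simp
    qed
    from DERIV_zero_connected_constant[OF round_domain_connected round_domain_open finite.emptyI
        holomorphic_on_imp_continuous_on[OF h] this]
    show ?thesis by blast
  qed
  consider "\<forall>z\<in>?V. deriv h2 z = 0" | l where "\<forall>z\<in>?V. deriv h1 z = l * deriv h2 z"
    using radial_product_dependent[OF d(2,1) derivative_product_radial[OF rR h1 h2 b]] by blast
  then show ?thesis
  proof cases
    case 1 then show ?thesis using const[OF h2(1)] by blast
  next
    case (2 l)
    have "\<exists>c. \<forall>z\<in>?V. h1 z - l * h2 z = c"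
    proof (rule const)
      show "(\<lambda>z. h1 z - l * h2 z) holomorphic_on ?V" by (intro holomorphic_intros h1 h2)
      fix z assume z: "z \<in> ?V"
      have "((\<lambda>z. h1 z - l * h2 z) has_field_derivative (deriv h1 z - l * deriv h2 z)) (at z)"
        using holomorphic_derivI[OF h1(1) round_domain_open z] holomorphic_derivI[OF h2(1) round_domain_open z]
        by (auto intro!: derivative_eq_intros)
      then show "deriv (\<lambda>z. h1 z - l * h2 z) z = 0" using 2 z by (simp add: DERIV_imp_deriv)
    qed
    then obtain c where c: "\<And>z. z \<in> ?V \<Longrightarrow> h1 z = l * h2 z + c" by (metis diff_eq_eq add.commute)
    show ?thesis
    proof (cases "l = 0")
      case True then show ?thesis using c by auto
    next
      case False
      \<comment> \<open>A concrete point of the domain; \<open>max r 0\<close> covers the negative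
        inner radius of a disk.\<close>
      define t where "t = (max r 0 + R) / 2"
      have t: "r < t" "0 < t" "t < R" using rR by (auto simp: t_def)
      define v where "v = complex_of_real t"
      have v: "v \<in> ?V" using t by (simp add: v_def round_domain_def)
      obtain k where k: "representer ?V v k" using representer_exists[OF round_domain_open round_domain_bounded v] by blast
      have kh: "k \<in> l2 (lb ?V)" "k holomorphic_on ?V" "k v = 1" using k by (auto simp: representer_def bergman1_def)
      have kc: "continuous_on ?V k" using kh by (intro holomorphic_on_imp_continuous_on)
      have h2c: "continuous_on ?V h2" using h2 by (intro holomorphic_on_imp_continuous_on)
      define f where "f = (\<lambda>z. (cmod (h2 z - h2 v))\<^sup>2 * (cmod (k z))\<^sup>2)"
      have fc: "of_real (f z) = (h2 z - h2 v) * cnj (h2 z - h2 v) * of_real ((cmod (k z))\<^sup>2)" for z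
        by (simp only: f_def of_real_mult complex_norm_square)
      have "integrable (lb ?V) (\<lambda>z. complex_of_real (f z))"
        unfolding fc by (rule integrable_weighted[OF round_domain_bounded _ kh(1)]) (intro continuous_intros h2)
      then have fi: "integrable (lb ?V) f" by (simp only: complex_of_real_integrable_eq)
      have "0 = (LINT z|lb ?V. (h2 z - h2 v) * cnj (h1 z - h1 v) * of_real ((cmod (k z))\<^sup>2))"
        using hyp[OF v k] by simp
      also have "\<dots> = (LINT z|lb ?V. cnj l * of_real (f z))"
      proof (rule Bochner_Integration.integral_cong[OF refl])
        fix z assume "z \<in> space (lb ?V)"
        then have z: "z \<in> ?V" by (simp add: space_restrict_space)
        show "(h2 z - h2 v) * cnj (h1 z - h1 v) * complex_of_real ((cmod (k z))\<^sup>2) = cnj l * complex_of_real (f z)"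
          unfolding fc by (simp add: c[OF z] c[OF v] algebra_simps)
      qed
      also have "\<dots> = cnj l * of_real (integral\<^sup>L (lb ?V) f)" by simp
      finally have fz: "integral\<^sup>L (lb ?V) f = 0" using False by simp
      have f0: "f z = 0" if "z \<in> ?V" for z
        by (rule continuous_nonneg_integral_zero[OF round_domain_open _ _ fi fz that])
          (auto simp: f_def intro!: continuous_intros kc h2c)
      \<comment> \<open>The weight may vanish somewhere, so \<open>h2 = h2 v\<close> is obtained
        first on the open set where \<open>k\<close> is nonzero, which contains
        \<open>v\<close>.\<close>
      define N where "N = ?V \<inter> k -` (- {0})"
      have oN: "open N" unfolding N_def by (rule continuous_open_preimage[OF kc round_domain_open]) (simp add: open_Compl)
      have vN: "N \<noteq> {}" using v kh by (auto simp: N_def)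
      have hN: "h2 z = (\<lambda>_. h2 v) z" if "z \<in> N" for z
        using f0[of z] that by (auto simp: f_def N_def)
      have "h2 z = (\<lambda>_. h2 v) z" if z: "z \<in> ?V" for z
        by (rule analytic_continuation_open[OF oN round_domain_open vN round_domain_connected _ h2(1) holomorphic_on_const hN z])
          (auto simp: N_def)
      then show ?thesis by auto
    qed
  qed
qed

section \<open>Products of Hankel operators\<close>

lemma bergman_eqI:
  assumes \<Omega>: "open \<Omega>" and p: "p \<in> bergman_space \<Omega>" and q: "q \<in> bergman_space \<Omega>"
    and z: "sq_norm (lb \<Omega>) (\<lambda>x. p x - q x) = 0"
  shows "p = q"
proof
  fix x
  note P = bergman_spaceD[OF p \<Omega>] and Q = bergman_spaceD[OF q \<Omega>]
  show "p x = q x"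
  proof (cases "x \<in> \<Omega>")
    case True
    have "(cmod (p x - q x))\<^sup>2 = 0"
    proof (rule continuous_nonneg_integral_zero[OF \<Omega> _ _ _ _ True])
      show "continuous_on \<Omega> (\<lambda>x. (cmod (p x - q x))\<^sup>2)" by (intro continuous_intros P Q)
      show "integrable (lb \<Omega>) (\<lambda>x. (cmod (p x - q x))\<^sup>2)" by (intro l2_integrable l2_diff P Q)
      show "(LINT x|lb \<Omega>. (cmod (p x - q x))\<^sup>2) = 0" using z by (simp add: sq_norm_def)
    qed simp
    then show ?thesis by simp
  next
    case False then show ?thesis using P(3) Q(3) by simp
  qed
qed

lemma L2_inner_eq_ip:
  assumes "\<Omega> \<in> sets borel" "f \<in> borel_measurable (lb \<Omega>)" "g \<in> borel_measurable (lb \<Omega>)"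
  shows "L2_inner \<Omega> f g = ip (lb \<Omega>) f g"
proof -
  have "(\<lambda>x. cnj (g x)) \<in> borel_measurable (lb \<Omega>)"
    using borel_measurable_continuous_on[OF continuous_on_cnj[OF continuous_on_id] assms(3)] .
  then have "(\<lambda>x. f x * cnj (g x)) \<in> borel_measurable (lb \<Omega>)"
    using assms(2) by (intro borel_measurable_times)
  then show ?thesis
    unfolding L2_inner_def ip_def by (rule lebesgue_on_eq_lb(2)[OF assms(1)])
qed

lemma L2_norm_eq:
  assumes "\<Omega> \<in> sets borel" "f \<in> borel_measurable (lb \<Omega>)"
  shows "L2_norm \<Omega> f = sqrt (sq_norm (lb \<Omega>) f)"
proof -
  have "(\<lambda>x. (cmod (f x))\<^sup>2) \<in> borel_measurable (lb \<Omega>)" using assms(2) by measurable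
  then show ?thesis
    unfolding L2_norm_def sq_norm_def by (subst lebesgue_on_eq_lb(2)[OF assms(1)]) auto
qed

lemma bergman_unique:
  assumes \<Omega>: "open \<Omega>" and p: "p \<in> bergman_space \<Omega>" and q: "q \<in> bergman_space \<Omega>"
    and eq: "\<And>u. u \<in> bergman_space \<Omega> \<Longrightarrow> ip (lb \<Omega>) p u = ip (lb \<Omega>) q u"
  shows "p = q"
proof (rule bergman_eqI[OF \<Omega> p q])
  have d: "(\<lambda>x. p x - q x) \<in> bergman_space \<Omega>" using p q by (rule bergman_space_subspace(4)[OF \<Omega>])
  note l = bergman_spaceD(1)[OF _ \<Omega>]
  have "ip (lb \<Omega>) (\<lambda>x. p x - q x) (\<lambda>x. p x - q x) = 0"
    using eq[OF d] by (simp add: ip_diff_left l p q d)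
  then show "sq_norm (lb \<Omega>) (\<lambda>x. p x - q x) = 0" by (simp add: ip_self)
qed

text \<open>Two candidates have equal inner products with every Bergman function, hence coincide as
  functions; this evaluates the definite description.\<close>

lemma bergman_projection_eq:
  assumes \<Omega>: "open \<Omega>" and f: "f \<in> l2 (lb \<Omega>)" and p: "p \<in> bergman_space \<Omega>"
    and orth: "\<And>u. u \<in> bergman_space \<Omega> \<Longrightarrow> ip (lb \<Omega>) (\<lambda>x. f x - p x) u = 0"
  shows "bergman_projection \<Omega> f = p"
  unfolding bergman_projection_def
proof (rule the_equality)
  note l = bergman_spaceD(1)[OF _ \<Omega>]
  have e: "L2_inner \<Omega> (\<lambda>z. f z - q z) u = ip (lb \<Omega>) (\<lambda>z. f z - q z) u"
    if "q \<in> bergman_space \<Omega>" "u \<in> bergman_space \<Omega>" for q u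
    using that \<Omega> by (intro L2_inner_eq_ip l2_measurable l2_diff f l) auto
  show "p \<in> bergman_space \<Omega> \<and> (\<forall>u\<in>bergman_space \<Omega>. L2_inner \<Omega> (\<lambda>z. f z - p z) u = 0)"
    using p orth by (simp add: e)
  fix q assume q: "q \<in> bergman_space \<Omega> \<and> (\<forall>u\<in>bergman_space \<Omega>. L2_inner \<Omega> (\<lambda>z. f z - q z) u = 0)"
  show "q = p"
  proof (rule bergman_unique[OF \<Omega> _ p])
    show qb: "q \<in> bergman_space \<Omega>" using q by simp
    fix u assume u: "u \<in> bergman_space \<Omega>"
    have "ip (lb \<Omega>) (\<lambda>z. f z - q z) u = 0" using q u e[OF qb u] by simp
    then show "ip (lb \<Omega>) q u = ip (lb \<Omega>) p u"
      using orth[OF u] by (simp add: ip_diff_left f l qb p u)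
  qed
qed

text \<open>The consequence of compactness that the rest of the proof uses, freed from operators and
  definite descriptions: \<open>p n\<close> and \<open>q n\<close> are the projections of
  \<open>\<phi> * F n\<close> and \<open>\<psi> * F n\<close>, specified by orthogonality. In this
  form it passes easily to exchanged coordinates.\<close>

definition asymptotically_orthogonal ::
    "(complex \<times> complex) set \<Rightarrow> (complex \<times> complex \<Rightarrow> complex) \<Rightarrow> (complex \<times> complex \<Rightarrow> complex) \<Rightarrow> bool" where
  "asymptotically_orthogonal \<Omega> \<phi> \<psi> \<longleftrightarrow> (\<forall>(F :: nat \<Rightarrow> complex \<times> complex \<Rightarrow> complex) p q C.
     (\<forall>n. F n \<in> bergman_space \<Omega> \<and> p n \<in> bergman_space \<Omega> \<and> q n \<in> bergman_space \<Omega>) \<longrightarrow>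
     (\<forall>n. \<forall>u\<in>bergman_space \<Omega>. ip (lb \<Omega>) (\<lambda>x. \<phi> x * F n x - p n x) u = 0) \<longrightarrow>
     (\<forall>n. \<forall>u\<in>bergman_space \<Omega>. ip (lb \<Omega>) (\<lambda>x. \<psi> x * F n x - q n x) u = 0) \<longrightarrow>
     (\<forall>n. sq_norm (lb \<Omega>) (F n) \<le> C) \<longrightarrow>
     (\<forall>u\<in>bergman_space \<Omega>. (\<lambda>n. ip (lb \<Omega>) (F n) u) \<longlonglongrightarrow> 0) \<longrightarrow>
     (\<lambda>n. ip (lb \<Omega>) (\<lambda>x. \<phi> x * F n x - p n x) (\<lambda>x. \<psi> x * F n x - q n x)) \<longlonglongrightarrow> 0)"

lemma l2_symbol_mult:
  fixes \<Omega> :: "(complex \<times> complex) set"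
  assumes \<Omega>: "bounded \<Omega>" and \<phi>: "continuous_on (closure \<Omega>) \<phi>" and f: "f \<in> l2 (lb \<Omega>)"
  shows "(\<lambda>x. \<phi> x * f x) \<in> l2 (lb \<Omega>)"
proof -
  obtain B where B: "\<And>z. z \<in> closure \<Omega> \<Longrightarrow> cmod (\<phi> z) \<le> B"
    using bounded_of_closure[OF \<Omega> \<phi>] by blast
  show ?thesis
    using B closure_subset[of \<Omega>]
    by (intro l2_bounded_mult[OF f, where B=B] borel_measurable_lb continuous_on_subset[OF \<phi>])
      (auto simp: space_restrict_space)
qed

text \<open>The inner product of the two Hankel images is that of \<open>T (F n)\<close> with
  \<open>F n\<close>. Along a subsequence \<open>T (F n)\<close> tends in norm to some
  \<open>u\<close>; boundedness of \<open>F n\<close> disposes of the difference and weak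
  convergence of the remaining pairing with \<open>u\<close>.\<close>

lemma asymptotically_orthogonalI:
  assumes \<Omega>: "open \<Omega>" "bounded \<Omega>"
    and \<phi>: "continuous_on (closure \<Omega>) \<phi>" and \<psi>: "continuous_on (closure \<Omega>) \<psi>"
    and comp: "compact_on_bergman \<Omega> (hankel_adjoint \<Omega> \<psi> \<circ> hankel \<Omega> \<phi>)"
  shows "asymptotically_orthogonal \<Omega> \<phi> \<psi>"
  unfolding asymptotically_orthogonal_def
proof (intro allI impI)
  fix F p q :: "nat \<Rightarrow> complex \<times> complex \<Rightarrow> complex" and C :: real
  let ?B = "bergman_space \<Omega>" and ?M = "lb \<Omega>"
  assume B: "\<forall>n. F n \<in> ?B \<and> p n \<in> ?B \<and> q n \<in> ?B"
    and op: "\<forall>n. \<forall>u\<in>?B. ip ?M (\<lambda>x. \<phi> x * F n x - p n x) u = 0"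
    and oq: "\<forall>n. \<forall>u\<in>?B. ip ?M (\<lambda>x. \<psi> x * F n x - q n x) u = 0"
    and C: "\<forall>n. sq_norm ?M (F n) \<le> C"
    and weak: "\<forall>u\<in>?B. (\<lambda>n. ip ?M (F n) u) \<longlonglongrightarrow> 0"
  have FB: "F n \<in> ?B" "p n \<in> ?B" "q n \<in> ?B" for n using B by auto
  note l = bergman_spaceD(1)[OF _ \<Omega>(1)]
  have Sb: "\<Omega> \<in> sets borel" using \<Omega> by simp
  define T where "T = hankel_adjoint \<Omega> \<psi> \<circ> hankel \<Omega> \<phi>"
  define k where "k n x = \<phi> x * F n x - p n x" for n x
  define g where "g n x = \<psi> x * F n x - q n x" for n x
  have kl: "k n \<in> l2 ?M" for n
    unfolding k_def[abs_def] by (intro l2_diff l2_symbol_mult[OF \<Omega>(2) \<phi>] l FB)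
  have gl: "g n \<in> l2 ?M" for n
    unfolding g_def[abs_def] by (intro l2_diff l2_symbol_mult[OF \<Omega>(2) \<psi>] l FB)
  have ko: "ip ?M (k n) u = 0" if "u \<in> ?B" for n u
    using op that by (simp add: k_def[abs_def])
  have ko': "ip ?M u (k n) = 0" if "u \<in> ?B" for n u
    using ko[OF that, of n] ip_commute[of ?M u "k n"] by simp
  have hk: "hankel \<Omega> \<phi> (F n) = k n" for n
  proof -
    have "bergman_projection \<Omega> (\<lambda>w. \<phi> w * F n w) = p n"
      using op by (intro bergman_projection_eq \<Omega> l2_symbol_mult[OF \<Omega>(2) \<phi>] l FB) auto
    then show ?thesis by (simp add: hankel_def k_def[abs_def])
  qed
  have c\<psi>: "continuous_on (closure \<Omega>) (\<lambda>x. cnj (\<psi> x))" using \<psi> by (rule continuous_on_cnj)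
  have ipT: "ip ?M (T (F n)) (F n) = ip ?M (k n) (g n)" for n
  proof -
    have ckl: "(\<lambda>x. cnj (\<psi> x) * k n x) \<in> l2 ?M" by (rule l2_symbol_mult[OF \<Omega>(2) c\<psi> kl])
    \<comment> \<open>The adjoint applied to \<open>k n\<close> is the projection of
      \<open>cnj \<psi> * k n\<close>, because \<open>k n\<close> is orthogonal to the Bergman
      space.\<close>
    obtain t where t: "t \<in> ?B" and ot: "\<And>u. u \<in> ?B \<Longrightarrow> ip ?M (\<lambda>x. cnj (\<psi> x) * k n x - t x) u = 0"
      using bergman_projection_exists[OF \<Omega>(1) ckl] by blast
    have adj: "L2_inner \<Omega> (hankel \<Omega> \<psi> f) (k n) = ip ?M f t" if f: "f \<in> ?B" for f
    proof -
      have fl: "(\<lambda>x. \<psi> x * f x) \<in> l2 ?M" by (intro l2_symbol_mult[OF \<Omega>(2) \<psi>] l f)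
      obtain s where s: "s \<in> ?B" and os: "\<And>u. u \<in> ?B \<Longrightarrow> ip ?M (\<lambda>x. \<psi> x * f x - s x) u = 0"
        using bergman_projection_exists[OF \<Omega>(1) fl] by blast
      have "hankel \<Omega> \<psi> f = (\<lambda>x. \<psi> x * f x - s x)"
        using bergman_projection_eq[OF \<Omega>(1) fl s os] by (simp add: hankel_def)
      then have "L2_inner \<Omega> (hankel \<Omega> \<psi> f) (k n) = ip ?M (\<lambda>x. \<psi> x * f x - s x) (k n)"
        using L2_inner_eq_ip[OF Sb l2_measurable[OF l2_diff[OF fl l[OF s]]] l2_measurable[OF kl]] by simp
      also have "\<dots> = ip ?M (\<lambda>x. \<psi> x * f x) (k n)"
        by (simp add: ip_diff_left fl l s kl ko')
      also have "\<dots> = ip ?M f (\<lambda>x. cnj (\<psi> x) * k n x)"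
        by (simp add: ip_def mult_ac)
      also have "\<dots> = ip ?M f t"
      proof -
        have "ip ?M f (\<lambda>x. cnj (\<psi> x) * k n x - t x) = 0"
          using ot[OF f] ip_commute[of ?M f] by simp
        then show ?thesis by (simp add: ip_diff_right ckl l t f)
      qed
      finally show ?thesis .
    qed
    have e: "L2_inner \<Omega> f u = ip ?M f u" if "f \<in> ?B" "u \<in> ?B" for f u
      using that by (intro L2_inner_eq_ip[OF Sb] l2_measurable l)
    have "T (F n) = t"
      unfolding T_def o_def hk hankel_adjoint_def
    proof (rule the_equality)
      show "t \<in> ?B \<and> (\<forall>f\<in>?B. L2_inner \<Omega> (hankel \<Omega> \<psi> f) (k n) = L2_inner \<Omega> f t)"
        using t by (simp add: adj e)
      fix u assume u: "u \<in> ?B \<and> (\<forall>f\<in>?B. L2_inner \<Omega> (hankel \<Omega> \<psi> f) (k n) = L2_inner \<Omega> f u)"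
      show "u = t"
      proof (rule bergman_unique[OF \<Omega>(1) _ t])
        show "u \<in> ?B" using u by simp
        fix f assume f: "f \<in> ?B"
        have "ip ?M f u = ip ?M f t" using u f e[of f u] adj[OF f] by simp
        then show "ip ?M u f = ip ?M t f" using ip_commute[of ?M u f] ip_commute[of ?M t f] by simp
      qed
    qed
    then have "ip ?M (T (F n)) (F n) = ip ?M (\<lambda>x. cnj (\<psi> x) * k n x) (F n)"
      using ot[OF FB(1), of n] by (simp add: ip_diff_left ckl l t FB)
    also have "\<dots> = ip ?M (k n) (\<lambda>x. \<psi> x * F n x)" by (simp add: ip_def mult_ac)
    also have "\<dots> = ip ?M (k n) (g n)"
      unfolding g_def[abs_def]
      by (simp add: ip_diff_right l2_symbol_mult[OF \<Omega>(2) \<psi>] l FB kl ko)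
    finally show ?thesis .
  qed
  have TB: "T f \<in> ?B" if "f \<in> ?B" for f
    using comp that unfolding compact_on_bergman_def T_def by blast
  have "(\<lambda>n. ip ?M (T (F n)) (F n)) \<longlonglongrightarrow> 0"
  proof (rule ccontr)
    assume "\<not> ?thesis"
    then obtain e where e: "0 < e" and fr: "\<forall>N. \<exists>n\<ge>N. e \<le> cmod (ip ?M (T (F n)) (F n))"
      unfolding LIMSEQ_iff by (auto simp: not_less)
    \<comment> \<open>Compactness yields convergence only along subsequences; it is therefore
      applied to the indices at which the inner product stays large.\<close>
    define P where "P = (\<lambda>n. e \<le> cmod (ip ?M (T (F n)) (F n)))"
    have "infinite {n. P n}" unfolding infinite_nat_iff_unbounded_le using fr by (auto simp: P_def)
    then obtain s :: "nat \<Rightarrow> nat" where s: "strict_mono s" "\<And>n. s n \<in> {n. P n}"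
      by (auto dest: infinite_enumerate)
    have "range (F \<circ> s) \<subseteq> ?B" using FB by auto
    moreover have "\<exists>C. \<forall>n. L2_norm \<Omega> ((F \<circ> s) n) \<le> C"
    proof (intro exI[of _ "sqrt C"] allI)
      fix n show "L2_norm \<Omega> ((F \<circ> s) n) \<le> sqrt C"
        using L2_norm_eq[OF Sb l2_measurable[OF l[OF FB(1)]]] C by simp
    qed
    ultimately obtain u r where u: "u \<in> ?B" and r: "strict_mono (r :: nat \<Rightarrow> nat)"
      and lim: "(\<lambda>n. L2_norm \<Omega> (\<lambda>z. T ((F \<circ> s) (r n)) z - u z)) \<longlonglongrightarrow> 0"
      using comp unfolding compact_on_bergman_def T_def[symmetric] by blast
    define a where "a n = s (r n)" for n
    have a: "strict_mono a" using s(1) r by (auto simp: a_def strict_mono_def)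
    have dl: "(\<lambda>z. T (F (a n)) z - u z) \<in> l2 ?M" for n by (intro l2_diff l TB FB u)
    have "(\<lambda>n. (L2_norm \<Omega> (\<lambda>z. T (F (a n)) z - u z))\<^sup>2) \<longlonglongrightarrow> 0\<^sup>2"
      using lim by (intro tendsto_power) (simp add: a_def)
    then have "(\<lambda>n. sq_norm ?M (\<lambda>z. T (F (a n)) z - u z)) \<longlonglongrightarrow> 0"
      by (simp add: L2_norm_eq[OF Sb l2_measurable[OF dl]])
    then have "(\<lambda>n. ip ?M (\<lambda>z. T (F (a n)) z - u z) (F (a n))) \<longlonglongrightarrow> 0"
      using C by (intro ip_tendsto[where C=C] dl l FB) auto
    moreover have "(\<lambda>n. ip ?M u (F (a n))) \<longlonglongrightarrow> 0"
    proof -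
      have "(\<lambda>n. ip ?M (F (a n)) u) \<longlonglongrightarrow> 0"
        using LIMSEQ_subseq_LIMSEQ[OF _ a] weak u by (fastforce simp: o_def)
      from tendsto_cnj[OF this] show ?thesis by (simp flip: ip_commute)
    qed
    ultimately have "(\<lambda>n. ip ?M (\<lambda>z. T (F (a n)) z - u z) (F (a n)) + ip ?M u (F (a n))) \<longlonglongrightarrow> 0 + 0"
      by (rule tendsto_add)
    then have "(\<lambda>n. ip ?M (T (F (a n))) (F (a n))) \<longlonglongrightarrow> 0"
      by (simp add: ip_diff_left l TB FB u)
    then obtain N where "\<forall>n\<ge>N. cmod (ip ?M (T (F (a n))) (F (a n))) < e"
      using e unfolding LIMSEQ_iff by auto
    then have "cmod (ip ?M (T (F (a N))) (F (a N))) < e" by simp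
    moreover have "P (a N)" using s(2)[of "r N"] by (simp add: a_def)
    ultimately show False by (simp add: P_def)
  qed
  then show "(\<lambda>n. ip ?M (\<lambda>x. \<phi> x * F n x - p n x) (\<lambda>x. \<psi> x * F n x - q n x)) \<longlonglongrightarrow> 0"
    by (simp add: ipT k_def[abs_def] g_def[abs_def])
qed

section \<open>Exchanging the two coordinates\<close>

lemma integral_lb_swap:
  fixes f :: "complex \<times> complex \<Rightarrow> 'b::{banach,second_countable_topology}"
  assumes U: "U \<in> sets borel" and V: "V \<in> sets borel" and f: "f \<in> borel_measurable (lb (U \<times> V))"
  shows "(LINT x|lb (V \<times> U). f (prod.swap x)) = integral\<^sup>L (lb (U \<times> V)) f"
    and "integrable (lb (V \<times> U)) (\<lambda>x. f (prod.swap x)) \<longleftrightarrow> integrable (lb (U \<times> V)) f"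
proof -
  interpret U: sigma_finite_measure "lb U" using U by (rule sigma_finite_lb)
  interpret V: sigma_finite_measure "lb V" using V by (rule sigma_finite_lb)
  interpret P: pair_sigma_finite "lb U" "lb V" ..
  have pl: "lb U \<Otimes>\<^sub>M lb V = lb (U \<times> V)" "lb V \<Otimes>\<^sub>M lb U = lb (V \<times> U)"
    using U V by (auto intro: pair_lb)
  have sw: "(\<lambda>x. f (prod.swap x)) = (\<lambda>(x, y). f (y, x))" by auto
  show "(LINT x|lb (V \<times> U). f (prod.swap x)) = integral\<^sup>L (lb (U \<times> V)) f"
    using P.integral_product_swap[of f] f by (simp add: pl sw)
  show "integrable (lb (V \<times> U)) (\<lambda>x. f (prod.swap x)) \<longleftrightarrow> integrable (lb (U \<times> V)) f"
    using P.integrable_product_swap_iff[of f] f by (simp add: pl sw)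
qed

lemma bergman_space_swap:
  assumes U: "open U" and V: "open V" and f: "f \<in> bergman_space (V \<times> U)"
  shows "(\<lambda>x. f (prod.swap x)) \<in> bergman_space (U \<times> V)"
proof -
  have o: "open (U \<times> V)" "open (V \<times> U)" using U V by (auto intro: open_Times)
  note D = bergman_spaceD[OF f o(2)]
  have m: "(\<lambda>x. (cmod (f x))\<^sup>2) \<in> borel_measurable (lb (V \<times> U))"
    using D(1) by (auto simp: l2_def)
  have c: "continuous_on (U \<times> V) (\<lambda>x. f (prod.swap x))"
    by (rule continuous_on_compose2[OF D(4)]) (auto intro!: continuous_on_swap)
  show ?thesis
  proof (rule bergman_spaceI[OF o(1)])
    show "(\<lambda>x. f (prod.swap x)) \<in> l2 (lb (U \<times> V))"
      using integral_lb_swap(2)[OF _ _ m] U V D(1) borel_measurable_lb[OF c] by (simp add: l2_def)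
    show "(\<lambda>x. f (prod.swap x)) holomorphic2_on U \<times> V"
      by (rule holomorphic2_onI[OF o(1) c])
        (auto intro: holomorphic2_on_imp_field_differentiable[OF D(2) o(2)])
    show "f (prod.swap z) = 0" if "z \<notin> U \<times> V" for z using that D(3) by (cases z) auto
  qed
qed

text \<open>Reduces boundary pieces over points of \<open>frontier V\<close> to those over points of
  \<open>frontier U\<close>, so that the limit argument is carried out for the first coordinate
  only.\<close>

lemma asymptotically_orthogonal_swap:
  assumes U: "open U" "bounded U" and V: "open V" "bounded V"
    and \<phi>: "continuous_on (closure (U \<times> V)) \<phi>" and \<psi>: "continuous_on (closure (U \<times> V)) \<psi>"
    and A: "asymptotically_orthogonal (U \<times> V) \<phi> \<psi>"
  shows "asymptotically_orthogonal (V \<times> U) (\<lambda>x. \<phi> (prod.swap x)) (\<lambda>x. \<psi> (prod.swap x))"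
  unfolding asymptotically_orthogonal_def
proof (intro allI impI)
  fix F p q :: "nat \<Rightarrow> complex \<times> complex \<Rightarrow> complex" and C :: real
  let ?B = "bergman_space (V \<times> U)" and ?M = "lb (V \<times> U)" and ?B' = "bergman_space (U \<times> V)" and ?M' = "lb (U \<times> V)"
  let ?\<phi> = "\<lambda>x. \<phi> (prod.swap x)" and ?\<psi> = "\<lambda>x. \<psi> (prod.swap x)"
  assume B: "\<forall>n. F n \<in> ?B \<and> p n \<in> ?B \<and> q n \<in> ?B"
    and op: "\<forall>n. \<forall>u\<in>?B. ip ?M (\<lambda>x. ?\<phi> x * F n x - p n x) u = 0"
    and oq: "\<forall>n. \<forall>u\<in>?B. ip ?M (\<lambda>x. ?\<psi> x * F n x - q n x) u = 0"
    and C: "\<forall>n. sq_norm ?M (F n) \<le> C"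
    and weak: "\<forall>u\<in>?B. (\<lambda>n. ip ?M (F n) u) \<longlonglongrightarrow> 0"
  have o: "open (U \<times> V)" "open (V \<times> U)" using U V by (auto intro: open_Times)
  have S: "U \<in> sets borel" "V \<in> sets borel" using U V by auto
  define sw where "sw f = (\<lambda>x. f (prod.swap x))" for f :: "complex \<times> complex \<Rightarrow> complex"
  have swsw: "sw (sw f) = f" for f by (simp add: sw_def)
  have swB: "sw f \<in> ?B'" if "f \<in> ?B" for f
    unfolding sw_def using bergman_space_swap[OF U(1) V(1) that] .
  have swB': "sw f \<in> ?B" if "f \<in> ?B'" for f
    unfolding sw_def using bergman_space_swap[OF V(1) U(1) that] .
  have ipsw: "ip ?M (sw f) (sw g) = ip ?M' f g" if "continuous_on (U \<times> V) f" "continuous_on (U \<times> V) g" for f g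
  proof -
    have "(\<lambda>x. f x * cnj (g x)) \<in> borel_measurable ?M'"
      by (intro borel_measurable_lb continuous_intros that)
    from integral_lb_swap(1)[OF S this] show ?thesis by (simp add: ip_def sw_def)
  qed
  have cB: "continuous_on (U \<times> V) f" if "f \<in> ?B'" for f using bergman_spaceD(4)[OF that o(1)] .
  have c\<phi>: "continuous_on (U \<times> V) \<phi>" "continuous_on (U \<times> V) \<psi>"
    using continuous_on_subset[OF \<phi> closure_subset] continuous_on_subset[OF \<psi> closure_subset] by auto
  have FB: "F n \<in> ?B" "p n \<in> ?B" "q n \<in> ?B" for n using B by auto
  have c1: "continuous_on (U \<times> V) (\<lambda>x. \<phi> x * sw (F n) x - sw (p n) x)" for n
    by (intro continuous_on_diff continuous_on_mult c\<phi> cB swB FB)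
  have c2: "continuous_on (U \<times> V) (\<lambda>x. \<psi> x * sw (F n) x - sw (q n) x)" for n
    by (intro continuous_on_diff continuous_on_mult c\<phi> cB swB FB)
  have s1: "sw (\<lambda>x. \<phi> x * sw (F n) x - sw (p n) x) = (\<lambda>x. ?\<phi> x * F n x - p n x)" for n
    by (simp add: sw_def)
  have s2: "sw (\<lambda>x. \<psi> x * sw (F n) x - sw (q n) x) = (\<lambda>x. ?\<psi> x * F n x - q n x)" for n
    by (simp add: sw_def)
  have "(\<lambda>n. ip ?M' (\<lambda>x. \<phi> x * sw (F n) x - sw (p n) x) (\<lambda>x. \<psi> x * sw (F n) x - sw (q n) x)) \<longlonglongrightarrow> 0"
  proof (rule A[unfolded asymptotically_orthogonal_def, rule_format, where C=C])
    fix n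
    show "sw (F n) \<in> ?B' \<and> sw (p n) \<in> ?B' \<and> sw (q n) \<in> ?B'" using FB swB by blast
    show "ip ?M' (\<lambda>x. \<phi> x * sw (F n) x - sw (p n) x) u = 0" if "u \<in> ?B'" for u
      using op swB'[OF that] ipsw[OF c1 cB[OF that], of n] unfolding s1 by simp
    show "ip ?M' (\<lambda>x. \<psi> x * sw (F n) x - sw (q n) x) u = 0" if "u \<in> ?B'" for u
      using oq swB'[OF that] ipsw[OF c2 cB[OF that], of n] unfolding s2 by simp
    have "ip ?M' (sw (F n)) (sw (F n)) = ip ?M (F n) (F n)"
      using ipsw[OF cB[OF swB[OF FB(1)]] cB[OF swB[OF FB(1)]], of n n] by (simp add: swsw)
    then show "sq_norm ?M' (sw (F n)) \<le> C" using C by (simp add: ip_self)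
  next
    fix u assume u: "u \<in> ?B'"
    have "ip ?M' (sw (F n)) u = ip ?M (F n) (sw u)" for n
      using ipsw[OF cB[OF swB[OF FB(1)]] cB[OF u], of n] by (simp add: swsw)
    then show "(\<lambda>n. ip ?M' (sw (F n)) u) \<longlonglongrightarrow> 0" using weak swB'[OF u] by simp
  qed
  then show "(\<lambda>n. ip ?M (\<lambda>x. ?\<phi> x * F n x - p n x) (\<lambda>x. ?\<psi> x * F n x - q n x)) \<longlonglongrightarrow> 0"
    by (simp add: ipsw[OF c1 c2, symmetric] s1 s2)
qed

section \<open>Tensor products and concentration\<close>

lemma integrable_tensor:
  fixes f :: "complex \<Rightarrow> 'b::{real_normed_field,banach,second_countable_topology}" and g :: "complex \<Rightarrow> 'b"
  assumes U: "U \<in> sets borel" and V: "V \<in> sets borel"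
    and f: "integrable (lb U) f" and g: "integrable (lb V) g"
  shows "integrable (lb (U \<times> V)) (\<lambda>x. f (fst x) * g (snd x))"
    and "(LINT x|lb (U \<times> V). f (fst x) * g (snd x)) = integral\<^sup>L (lb U) f * integral\<^sup>L (lb V) g"
proof -
  interpret U: sigma_finite_measure "lb U" using U by (rule sigma_finite_lb)
  interpret V: sigma_finite_measure "lb V" using V by (rule sigma_finite_lb)
  interpret P: pair_sigma_finite "lb U" "lb V" ..
  have pl: "lb U \<Otimes>\<^sub>M lb V = lb (U \<times> V)" using U V by (rule pair_lb)
  have [measurable]: "f \<in> borel_measurable (lb U)" "g \<in> borel_measurable (lb V)"
    using f g by auto
  have "integrable (lb U \<Otimes>\<^sub>M lb V) (\<lambda>x. f (fst x) * g (snd x))"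
  proof (rule P.Fubini_integrable)
    show "integrable (lb U) (\<lambda>x. LINT y|lb V. norm (f (fst (x, y)) * g (snd (x, y))))"
      using f by (simp add: norm_mult)
    show "AE x in lb U. integrable (lb V) (\<lambda>y. f (fst (x, y)) * g (snd (x, y)))"
      using g by (intro AE_I2) simp
  qed measurable
  then show i: "integrable (lb (U \<times> V)) (\<lambda>x. f (fst x) * g (snd x))" by (simp add: pl)
  have "(LINT x|lb (U \<times> V). f (fst x) * g (snd x)) = (LINT z|lb U. LINT w|lb V. f z * g w)"
    using P.integral_fst'[of "\<lambda>x. f (fst x) * g (snd x)"] i by (simp add: pl)
  also have "\<dots> = integral\<^sup>L (lb U) f * integral\<^sup>L (lb V) g" by simp
  finally show "(LINT x|lb (U \<times> V). f (fst x) * g (snd x)) = integral\<^sup>L (lb U) f * integral\<^sup>L (lb V) g" .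
qed

lemma measurable_tensor:
  fixes U V :: "complex set"
  assumes U: "U \<in> sets borel" and V: "V \<in> sets borel"
    and f: "f \<in> borel_measurable (lb U)" and g: "g \<in> borel_measurable (lb V)"
  shows "(\<lambda>x. f (fst x) * g (snd x) :: complex) \<in> borel_measurable (lb (U \<times> V))"
proof -
  have "(\<lambda>x. f (fst x) * g (snd x)) \<in> borel_measurable (lb U \<Otimes>\<^sub>M lb V)"
    using f g by measurable
  then show ?thesis by (simp add: pair_lb U V)
qed

lemma l2_tensor:
  fixes f g :: "complex \<Rightarrow> complex"
  assumes U: "U \<in> sets borel" and V: "V \<in> sets borel" and f: "f \<in> l2 (lb U)" and g: "g \<in> l2 (lb V)"
  shows "(\<lambda>x. f (fst x) * g (snd x)) \<in> l2 (lb (U \<times> V))"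
    and "sq_norm (lb (U \<times> V)) (\<lambda>x. f (fst x) * g (snd x)) = sq_norm (lb U) f * sq_norm (lb V) g"
  using integrable_tensor[OF U V l2_integrable[OF f] l2_integrable[OF g]]
    measurable_tensor[OF U V l2_measurable[OF f] l2_measurable[OF g]]
  by (auto simp: l2_def sq_norm_def norm_mult power_mult_distrib)

lemma ip_tensor:
  fixes U V :: "complex set"
  assumes U: "U \<in> sets borel" and V: "V \<in> sets borel"
    and "f \<in> l2 (lb U)" "g \<in> l2 (lb V)" "f' \<in> l2 (lb U)" "g' \<in> l2 (lb V)"
  shows "ip (lb (U \<times> V)) (\<lambda>x. f (fst x) * g (snd x)) (\<lambda>x. f' (fst x) * g' (snd x))
    = ip (lb U) f f' * ip (lb V) g g'"
  using integrable_tensor(2)[OF U V l2_product_integrable[OF assms(3,5)] l2_product_integrable[OF assms(4,6)]]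
  by (simp add: ip_def mult_ac)

lemma ip_cong:
  assumes "\<And>x. x \<in> space M \<Longrightarrow> f x = f' x" "\<And>x. x \<in> space M \<Longrightarrow> g x = g' x"
  shows "ip M f g = ip M f' g'"
  unfolding ip_def by (intro Bochner_Integration.integral_cong) (auto simp: assms)

lemma sq_norm_cong:
  assumes "\<And>x. x \<in> space M \<Longrightarrow> f x = f' x" shows "sq_norm M f = sq_norm M f'"
  unfolding sq_norm_def by (intro Bochner_Integration.integral_cong) (auto simp: assms)

lemma l2_cong:
  assumes "\<And>x. x \<in> space M \<Longrightarrow> f x = f' x" shows "f \<in> l2 M \<longleftrightarrow> f' \<in> l2 M"
proof -
  have "f \<in> borel_measurable M \<longleftrightarrow> f' \<in> borel_measurable M" using assms by (rule measurable_cong)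
  moreover have "integrable M (\<lambda>x. (cmod (f x))\<^sup>2) \<longleftrightarrow> integrable M (\<lambda>x. (cmod (f' x))\<^sup>2)"
    using assms by (intro Bochner_Integration.integrable_cong) auto
  ultimately show ?thesis by (simp add: l2_def)
qed

lemma space_lb [simp]: "S \<in> sets borel \<Longrightarrow> space (lb S) = S"
  by (simp add: space_restrict_space)

text \<open>Cut off outside the product so as to meet the normalisation of
  \<open>bergman_space\<close>.\<close>

definition tensor :: "complex set \<Rightarrow> complex set \<Rightarrow> (complex \<Rightarrow> complex) \<Rightarrow> (complex \<Rightarrow> complex) \<Rightarrow> complex \<times> complex \<Rightarrow> complex" where
  "tensor U V f g x = (if x \<in> U \<times> V then f (fst x) * g (snd x) else 0)"

lemma tensor_bergman:
  assumes U: "open U" and V: "open V" and f: "f \<in> bergman1 U" and g: "g \<in> bergman1 V"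
  shows "tensor U V f g \<in> bergman_space (U \<times> V)"
proof -
  have o: "open (U \<times> V)" using U V by (rule open_Times)
  have S: "U \<in> sets borel" "V \<in> sets borel" "U \<times> V \<in> sets borel" using U V o by auto
  have fh: "f holomorphic_on U" "g holomorphic_on V" using f g by (auto simp: bergman1_def)
  have fc: "continuous_on U f" "continuous_on V g" using fh by (auto intro: holomorphic_on_imp_continuous_on)
  have c: "continuous_on (U \<times> V) (\<lambda>x. f (fst x) * g (snd x))"
    by (intro continuous_on_mult continuous_on_compose2[OF fc(1)] continuous_on_compose2[OF fc(2)] continuous_intros) auto
  have c': "continuous_on (U \<times> V) (tensor U V f g)"
    by (rule continuous_on_eq[OF c]) (auto simp: tensor_def)
  show ?thesis
  proof (rule bergman_spaceI[OF o])
    show "tensor U V f g \<in> l2 (lb (U \<times> V))"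
      using l2_tensor(1)[OF S(1,2), of f g] f g S(3)
      by (subst l2_cong[where f'="\<lambda>x. f (fst x) * g (snd x)"]) (auto simp: tensor_def bergman1_def)
    show "tensor U V f g holomorphic2_on U \<times> V"
    proof (rule holomorphic2_onI[OF o c'])
      fix z w assume zw: "(z, w) \<in> U \<times> V"
      have "(\<lambda>u. f u * g w) field_differentiable at z"
        using zw fh U by (intro field_differentiable_mult field_differentiable_const) 
          (auto intro: holomorphic_on_imp_differentiable_at)
      then show "(\<lambda>u. tensor U V f g (u, w)) field_differentiable at z"
        unfolding field_differentiable_def
        by (rule ex_forward) (rule has_field_derivative_transform_within_open[OF _ U], use zw in \<open>auto simp: tensor_def\<close>)
      have "(\<lambda>v. f z * g v) field_differentiable at w"
        using zw fh V by (intro field_differentiable_mult field_differentiable_const)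
          (auto intro: holomorphic_on_imp_differentiable_at)
      then show "(\<lambda>v. tensor U V f g (z, v)) field_differentiable at w"
        unfolding field_differentiable_def
        by (rule ex_forward) (rule has_field_derivative_transform_within_open[OF _ V], use zw in \<open>auto simp: tensor_def\<close>)
    qed
  qed (auto simp: tensor_def)
qed

section \<open>Sequences whose mass gathers at a boundary point\<close>

lemma indicator_l2:
  assumes f: "f \<in> l2 M" and A: "(\<lambda>x. indicator A x :: real) \<in> borel_measurable M"
  shows "(\<lambda>x. of_real (indicator A x) * f x) \<in> l2 M"
  using A by (intro l2_bounded_mult[OF f, where B=1]) (auto simp: indicator_def)

lemma indicator_sq_norm_tendsto:
  assumes f: "f \<in> l2 M" and A: "\<And>m::nat. (\<lambda>x. indicator (A m) x :: real) \<in> borel_measurable M"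
    and lim: "\<And>x. x \<in> space M \<Longrightarrow> \<forall>\<^sub>F m in sequentially. x \<notin> A m"
  shows "(\<lambda>m. sq_norm M (\<lambda>x. of_real (indicator (A m) x) * f x)) \<longlonglongrightarrow> 0"
proof -
  have fm: "f \<in> borel_measurable M" using f by (rule l2_measurable)
  have "(\<lambda>m. LINT x|M. (cmod (of_real (indicator (A m) x) * f x))\<^sup>2) \<longlonglongrightarrow> (LINT x|M. 0)"
  proof (rule integral_dominated_convergence)
    show "integrable M (\<lambda>x. (cmod (f x))\<^sup>2)" using f by (rule l2_integrable)
    show "(\<lambda>x. (cmod (of_real (indicator (A m) x) * f x))\<^sup>2) \<in> borel_measurable M" for m
      using l2_measurable[OF indicator_l2[OF f A[of m]]] by measurable
    show "AE x in M. (\<lambda>m. (cmod (of_real (indicator (A m) x) * f x))\<^sup>2) \<longlonglongrightarrow> 0"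
    proof (rule AE_I2)
      fix x assume "x \<in> space M"
      from lim[OF this] show "(\<lambda>m. (cmod (of_real (indicator (A m) x) * f x))\<^sup>2) \<longlonglongrightarrow> 0"
        by (rule tendsto_eventually[OF eventually_mono]) simp
    qed
    show "AE x in M. norm ((cmod (of_real (indicator (A m) x) * f x))\<^sup>2) \<le> (cmod (f x))\<^sup>2" for m
      by (intro AE_I2) (auto simp: indicator_def)
  qed simp
  then show ?thesis by (simp add: sq_norm_def)
qed

text \<open>The squared moduli form an approximate identity at \<xi>: total mass one, and vanishing
  mass outside every ball about \<xi>.\<close>

definition concentrates :: "complex set \<Rightarrow> complex \<Rightarrow> (nat \<Rightarrow> complex \<Rightarrow> complex) \<Rightarrow> bool" where
  "concentrates U \<xi> k \<longleftrightarrow> (\<forall>n. k n \<in> bergman1 U \<and> sq_norm (lb U) (k n) = 1) \<and>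
     (\<forall>\<delta>>0. (\<lambda>n. sq_norm (lb U) (\<lambda>z. of_real (indicator (- ball \<xi> \<delta>) z) * k n z)) \<longlonglongrightarrow> 0)"

lemma indicator_measurable_lb:
  fixes A :: "'a::euclidean_space set"
  assumes "A \<in> sets borel" shows "(\<lambda>x. indicator A x :: real) \<in> borel_measurable (lb S)"
  using assms by (intro measurable_restrict_space1) simp

text \<open>Close to the slice over \<xi> it is \<open>u\<close> that has little mass, by dominated
  convergence and because \<xi> lies outside \<open>U\<close>; away from it the tensors have little
  mass. Cauchy-Schwarz is applied to each region.\<close>

lemma tensor_weakly_null:
  assumes U: "open U" and V: "open V" and \<xi>: "\<xi> \<notin> U"
    and k: "concentrates U \<xi> k" and e: "e \<in> bergman1 V" and u: "u \<in> l2 (lb (U \<times> V))"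
  shows "(\<lambda>n. ip (lb (U \<times> V)) (tensor U V (k n) e) u) \<longlonglongrightarrow> 0"
proof (rule LIMSEQ_I)
  fix \<epsilon> :: real assume \<epsilon>: "0 < \<epsilon>"
  let ?M = "lb (U \<times> V)"
  have o: "open (U \<times> V)" using U V by (rule open_Times)
  have S: "U \<in> sets borel" "V \<in> sets borel" "U \<times> V \<in> sets borel" using U V o by auto
  have kb: "k n \<in> bergman1 U" "sq_norm (lb U) (k n) = 1" for n using k by (auto simp: concentrates_def)
  have kl: "k n \<in> l2 (lb U)" for n using kb by (simp add: bergman1_def)
  have el: "e \<in> l2 (lb V)" using e by (simp add: bergman1_def)
  define F where "F n x = k n (fst x) * e (snd x)" for n x
  have Fl: "F n \<in> l2 ?M" and Fn: "sq_norm ?M (F n) = sq_norm (lb V) e" for n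
    using l2_tensor[OF S(1,2) kl el] kb by (auto simp: F_def[abs_def])
  define E where "E = sqrt (sq_norm (lb V) e) + 1"
  have E: "0 < E" "sqrt (sq_norm (lb V) e) \<le> E"
    unfolding E_def using real_sqrt_ge_zero[OF sq_norm_nonneg[of "lb V" e]] by linarith+
  define K where "K = sqrt (sq_norm ?M u) + 1"
  have K: "0 < K" "sqrt (sq_norm ?M u) \<le> K"
    unfolding K_def using real_sqrt_ge_zero[OF sq_norm_nonneg[of ?M u]] by linarith+
  define A where "A \<delta> = {x :: complex \<times> complex. fst x \<in> ball \<xi> \<delta>}" for \<delta>
  have Ao: "A \<delta> \<in> sets borel" for \<delta>
  proof -
    have "A \<delta> = fst -` ball \<xi> \<delta>" by (auto simp: A_def)
    then show ?thesis by (simp only: borel_open open_vimage_fst open_ball)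
  qed
  have Am: "(\<lambda>x. indicator (A \<delta>) x :: real) \<in> borel_measurable ?M" for \<delta>
    using Ao by (rule indicator_measurable_lb)
  have near: "(\<lambda>m. sq_norm ?M (\<lambda>x. of_real (indicator (A (1 / Suc m)) x) * u x)) \<longlonglongrightarrow> 0"
  proof (rule indicator_sq_norm_tendsto[OF u Am])
    fix x assume "x \<in> space ?M"
    then have "fst x \<noteq> \<xi>" using S \<xi> by auto
    then have d: "0 < dist \<xi> (fst x)" by auto
    have "(\<lambda>m. 1 / real (Suc m)) \<longlonglongrightarrow> 0" using LIMSEQ_inverse_real_of_nat by (simp add: inverse_eq_divide)
    from order_tendstoD(2)[OF this d] show "\<forall>\<^sub>F m in sequentially. x \<notin> A (1 / Suc m)"
      by (rule eventually_mono) (simp add: A_def)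
  qed
  \<comment> \<open>Tolerances chosen so that each region contributes less than half of \<epsilon>;
    the summand 1 in \<open>E\<close> and \<open>K\<close> keeps the divisors positive.\<close>
  have "0 < (\<epsilon> / (2 * E))\<^sup>2" using \<epsilon> E by simp
  from order_tendstoD(2)[OF near this] obtain m
    where m: "sq_norm ?M (\<lambda>x. of_real (indicator (A (1 / Suc m)) x) * u x) < (\<epsilon> / (2 * E))\<^sup>2"
    unfolding eventually_sequentially by blast
  define \<delta> where "\<delta> = 1 / real (Suc m)"
  have \<delta>: "0 < \<delta>" by (simp add: \<delta>_def)
  define u1 where "u1 x = of_real (indicator (A \<delta>) x) * u x" for x
  define F2 where "F2 n x = of_real (indicator (- ball \<xi> \<delta>) (fst x)) * k n (fst x) * e (snd x)" for n x
  have bm: "(\<lambda>x. indicator (- ball \<xi> \<delta>) x :: real) \<in> borel_measurable (lb U)"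
    by (rule indicator_measurable_lb) simp
  have il: "(\<lambda>z. of_real (indicator (- ball \<xi> \<delta>) z) * k n z) \<in> l2 (lb U)" for n
    by (rule indicator_l2[OF kl bm])
  have u1l: "u1 \<in> l2 ?M" unfolding u1_def[abs_def] by (rule indicator_l2[OF u Am])
  have F2l: "F2 n \<in> l2 ?M" and F2n: "sq_norm ?M (F2 n)
      = sq_norm (lb U) (\<lambda>z. of_real (indicator (- ball \<xi> \<delta>) z) * k n z) * sq_norm (lb V) e" for n
    using l2_tensor[OF S(1,2) il el] by (auto simp: F2_def[abs_def])
  have "(\<lambda>n. sq_norm (lb U) (\<lambda>z. of_real (indicator (- ball \<xi> \<delta>) z) * k n z) * sq_norm (lb V) e) \<longlonglongrightarrow> 0 * sq_norm (lb V) e"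
    using k \<delta> unfolding concentrates_def by (intro tendsto_mult tendsto_const) auto
  then have "(\<lambda>n. sq_norm ?M (F2 n)) \<longlonglongrightarrow> 0" by (simp add: F2n)
  moreover have "0 < (\<epsilon> / (2 * K))\<^sup>2" using \<epsilon> K by simp
  ultimately have "\<forall>\<^sub>F n in sequentially. sq_norm ?M (F2 n) < (\<epsilon> / (2 * K))\<^sup>2" by (rule order_tendstoD(2))
  then obtain N where N: "\<And>n. n \<ge> N \<Longrightarrow> sq_norm ?M (F2 n) < (\<epsilon> / (2 * K))\<^sup>2"
    unfolding eventually_sequentially by blast
  have "norm (ip ?M (tensor U V (k n) e) u - 0) < \<epsilon>" if n: "n \<ge> N" for n
  proof -
    have "ip ?M (tensor U V (k n) e) u = ip ?M (F n) u"
      using S by (intro ip_cong) (auto simp: tensor_def F_def)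
    also have "\<dots> = ip ?M (F n) u1 + ip ?M (F2 n) u"
    proof -
      have eq: "F n x * cnj (u x) = F n x * cnj (u1 x) + F2 n x * cnj (u x)" for x
        by (auto simp: F_def u1_def F2_def A_def indicator_def)
      show ?thesis
        unfolding ip_def eq
        by (intro Bochner_Integration.integral_add l2_product_integrable Fl u1l F2l u)
    qed
    finally have "cmod (ip ?M (tensor U V (k n) e) u) \<le> cmod (ip ?M (F n) u1) + cmod (ip ?M (F2 n) u)"
      by (simp add: norm_triangle_ineq)
    moreover have "cmod (ip ?M (F n) u1) < \<epsilon> / 2"
    proof -
      have "cmod (ip ?M (F n) u1) \<le> sqrt (sq_norm (lb V) e) * sqrt (sq_norm ?M u1)"
        using cauchy_schwarz[OF Fl u1l, of n] by (simp add: Fn)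
      also have "\<dots> \<le> E * sqrt (sq_norm ?M u1)" using E by (intro mult_right_mono) auto
      also have "\<dots> < E * (\<epsilon> / (2 * E))"
      proof (intro mult_strict_left_mono E)
        have "sqrt (sq_norm ?M u1) < sqrt ((\<epsilon> / (2 * E))\<^sup>2)"
          using m by (intro real_sqrt_less_mono) (simp add: u1_def[abs_def] \<delta>_def)
        then show "sqrt (sq_norm ?M u1) < \<epsilon> / (2 * E)" using \<epsilon> E by simp
      qed
      finally show ?thesis using E by simp
    qed
    moreover have "cmod (ip ?M (F2 n) u) < \<epsilon> / 2"
    proof -
      have "cmod (ip ?M (F2 n) u) \<le> sqrt (sq_norm ?M (F2 n)) * sqrt (sq_norm ?M u)"
        by (rule cauchy_schwarz[OF F2l u])
      also have "\<dots> \<le> sqrt (sq_norm ?M (F2 n)) * K" using K by (intro mult_left_mono) auto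
      also have "\<dots> < (\<epsilon> / (2 * K)) * K"
      proof (intro mult_strict_right_mono K)
        have "sqrt (sq_norm ?M (F2 n)) < sqrt ((\<epsilon> / (2 * K))\<^sup>2)"
          using N[OF n] by (intro real_sqrt_less_mono)
        then show "sqrt (sq_norm ?M (F2 n)) < \<epsilon> / (2 * K)" using \<epsilon> K by simp
      qed
      finally show ?thesis using K by simp
    qed
    ultimately show ?thesis by simp
  qed
  then show "\<exists>no. \<forall>n\<ge>no. norm (ip ?M (tensor U V (k n) e) u - 0) < \<epsilon>" by blast
qed

text \<open>Uniform continuity makes the symbol small wherever the first coordinate is near \<xi>;
  elsewhere it is bounded and multiplies vanishing mass.\<close>

lemma tensor_concentration:
  assumes U: "open U" "bounded U" and V: "open V" "bounded V"
    and k: "concentrates U \<xi> k" and e: "e \<in> bergman1 V"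
    and \<Phi>: "continuous_on (closure (U \<times> V)) \<Phi>" and \<xi>: "\<xi> \<in> closure U"
    and z: "\<And>w. w \<in> V \<Longrightarrow> \<Phi> (\<xi>, w) = 0"
  shows "(\<lambda>n. sq_norm (lb (U \<times> V)) (\<lambda>x. \<Phi> x * tensor U V (k n) e x)) \<longlonglongrightarrow> 0"
proof -
  let ?M = "lb (U \<times> V)"
  have o: "open (U \<times> V)" using U V by (intro open_Times)
  have bd: "bounded (U \<times> V)" using U V by (intro bounded_Times)
  have S: "U \<in> sets borel" "V \<in> sets borel" "U \<times> V \<in> sets borel" using U V o by auto
  have kb: "k n \<in> bergman1 U" "sq_norm (lb U) (k n) = 1" for n using k by (auto simp: concentrates_def)
  have kl: "k n \<in> l2 (lb U)" for n using kb by (simp add: bergman1_def)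
  have el: "e \<in> l2 (lb V)" using e by (simp add: bergman1_def)
  have tl: "tensor U V (k n) e \<in> l2 ?M" for n
    using bergman_spaceD(1)[OF tensor_bergman[OF U(1) V(1) kb(1) e] o] .
  obtain B where B: "\<And>z. z \<in> closure (U \<times> V) \<Longrightarrow> cmod (\<Phi> z) \<le> B"
    using bounded_of_closure[OF bd \<Phi>] by blast
  have uc: "uniformly_continuous_on (closure (U \<times> V)) \<Phi>"
    using \<Phi> bd by (intro compact_uniformly_continuous) auto
  show ?thesis
  proof (rule LIMSEQ_I)
    fix \<epsilon> :: real assume \<epsilon>: "0 < \<epsilon>"
    let ?e = "sq_norm (lb V) e"
    \<comment> \<open>Chosen so that \<open>\<eta>\<^sup>2 * (?e + 1)\<close> is half of \<epsilon>;
      the summand 1 covers the case \<open>?e = 0\<close>.\<close>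
    define \<eta> where "\<eta> = sqrt (\<epsilon> / (2 * (?e + 1)))"
    have e1: "0 < ?e + 1" using sq_norm_nonneg[of "lb V" e] by linarith
    have \<eta>: "0 < \<eta>" "\<eta>\<^sup>2 * ?e < \<epsilon> / 2 + \<epsilon> / 4"
    proof -
      show "0 < \<eta>" using \<epsilon> e1 by (simp add: \<eta>_def)
      have "\<eta>\<^sup>2 = \<epsilon> / (2 * (?e + 1))" using \<epsilon> e1 by (simp add: \<eta>_def)
      moreover have "\<epsilon> / (2 * b) * b = \<epsilon> / 2" if "0 < b" for b :: real using that by simp
      from this[OF e1] have "\<epsilon> / (2 * (?e + 1)) * (?e + 1) = \<epsilon> / 2" .
      ultimately have "\<eta>\<^sup>2 * (?e + 1) = \<epsilon> / 2" by (simp only:)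
      moreover have "\<eta>\<^sup>2 * ?e \<le> \<eta>\<^sup>2 * (?e + 1)" by (intro mult_left_mono) auto
      ultimately have "\<eta>\<^sup>2 * ?e \<le> \<epsilon> / 2" by simp
      then show "\<eta>\<^sup>2 * ?e < \<epsilon> / 2 + \<epsilon> / 4" using \<epsilon> by linarith
    qed
    obtain \<delta> where \<delta>: "0 < \<delta>" and uc': "\<And>x y. x \<in> closure (U \<times> V) \<Longrightarrow> y \<in> closure (U \<times> V) \<Longrightarrow>
        dist y x < \<delta> \<Longrightarrow> dist (\<Phi> y) (\<Phi> x) < \<eta>"
      using uc \<eta>(1) unfolding uniformly_continuous_on_def by metis
    define c where "c n = sq_norm (lb U) (\<lambda>z. of_real (indicator (- ball \<xi> \<delta>) z) * k n z)" for n
    have bm: "(\<lambda>x. indicator (- ball \<xi> \<delta>) x :: real) \<in> borel_measurable (lb U)"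
      by (rule indicator_measurable_lb) simp
    have il: "(\<lambda>z. of_real (indicator (- ball \<xi> \<delta>) z) * k n z) \<in> l2 (lb U)" for n
      by (rule indicator_l2[OF kl bm])
    have le: "sq_norm ?M (\<lambda>x. \<Phi> x * tensor U V (k n) e x) \<le> (\<eta>\<^sup>2 + B\<^sup>2 * c n) * ?e" for n
    proof -
      \<comment> \<open>A majorant in the first variable alone, so that the integral over the
        product factors.\<close>
      define G where "G z = \<eta>\<^sup>2 * (cmod (k n z))\<^sup>2
        + B\<^sup>2 * (cmod (of_real (indicator (- ball \<xi> \<delta>) z) * k n z))\<^sup>2" for z
      have Gi: "integrable (lb U) G" "integral\<^sup>L (lb U) G = \<eta>\<^sup>2 + B\<^sup>2 * c n"
        using l2_integrable[OF kl, of n] l2_integrable[OF il, of n] kb(2)[of n]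
        by (auto simp: G_def[abs_def] sq_norm_def c_def)
      note T = integrable_tensor[OF S(1,2) Gi(1) l2_integrable[OF el]]
      have "sq_norm ?M (\<lambda>x. \<Phi> x * tensor U V (k n) e x) \<le> (LINT x|?M. G (fst x) * (cmod (e (snd x)))\<^sup>2)"
        unfolding sq_norm_def
      proof (rule integral_mono[OF _ T(1)])
        show "integrable ?M (\<lambda>x. (cmod (\<Phi> x * tensor U V (k n) e x))\<^sup>2)"
          by (intro l2_integrable l2_symbol_mult[OF bd \<Phi>] tl)
        fix x assume "x \<in> space ?M"
        then have x: "x \<in> U \<times> V" using S by simp
        then have xc: "x \<in> closure (U \<times> V)" by (rule subsetD[OF closure_subset])
        have "(cmod (\<Phi> x))\<^sup>2 * (cmod (k n (fst x)))\<^sup>2 \<le> G (fst x)"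
        proof (cases "fst x \<in> ball \<xi> \<delta>")
          case True
          define y where "y = (\<xi>, snd x)"
          have yc: "y \<in> closure (U \<times> V)"
            using x \<xi> closure_subset[of V] by (auto simp: y_def closure_Times)
          have "dist y x = dist \<xi> (fst x)" by (simp add: y_def dist_prod_def)
          then have "dist (\<Phi> y) (\<Phi> x) < \<eta>" using True by (intro uc'[OF xc yc]) simp
          moreover have "\<Phi> y = 0" using x by (auto simp: y_def z)
          ultimately have "cmod (\<Phi> x) < \<eta>" by simp
          then have "(cmod (\<Phi> x))\<^sup>2 \<le> \<eta>\<^sup>2" by (intro power_mono) auto
          then have "(cmod (\<Phi> x))\<^sup>2 * (cmod (k n (fst x)))\<^sup>2 \<le> \<eta>\<^sup>2 * (cmod (k n (fst x)))\<^sup>2"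
            by (intro mult_right_mono) auto
          also have "\<dots> \<le> G (fst x)" by (simp add: G_def)
          finally show ?thesis .
        next
          case False
          have "(cmod (\<Phi> x))\<^sup>2 \<le> B\<^sup>2" using B[OF xc] by (intro power_mono) auto
          then have "(cmod (\<Phi> x))\<^sup>2 * (cmod (k n (fst x)))\<^sup>2 \<le> B\<^sup>2 * (cmod (k n (fst x)))\<^sup>2"
            by (intro mult_right_mono) auto
          also have "\<dots> \<le> G (fst x)" using False by (simp add: G_def)
          finally show ?thesis .
        qed
        then have "((cmod (\<Phi> x))\<^sup>2 * (cmod (k n (fst x)))\<^sup>2) * (cmod (e (snd x)))\<^sup>2 \<le> G (fst x) * (cmod (e (snd x)))\<^sup>2"
          by (intro mult_right_mono) auto
        then show "(cmod (\<Phi> x * tensor U V (k n) e x))\<^sup>2 \<le> G (fst x) * (cmod (e (snd x)))\<^sup>2"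
          using x by (simp add: tensor_def norm_mult power_mult_distrib mult.assoc)
      qed
      also have "\<dots> = (\<eta>\<^sup>2 + B\<^sup>2 * c n) * ?e" using T(2) by (simp add: Gi sq_norm_def)
      finally show ?thesis .
    qed
    have "c \<longlonglongrightarrow> 0" using k \<delta> by (simp add: concentrates_def c_def[abs_def])
    then have "(\<lambda>n. (\<eta>\<^sup>2 + B\<^sup>2 * c n) * ?e) \<longlonglongrightarrow> (\<eta>\<^sup>2 + B\<^sup>2 * 0) * ?e" by (intro tendsto_intros)
    moreover have "(\<eta>\<^sup>2 + B\<^sup>2 * 0) * ?e < \<epsilon>" using \<eta>(2) \<epsilon> by simp
    ultimately have "\<forall>\<^sub>F n in sequentially. (\<eta>\<^sup>2 + B\<^sup>2 * c n) * ?e < \<epsilon>" by (rule order_tendstoD(2))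
    then obtain N where N: "\<And>n. n \<ge> N \<Longrightarrow> (\<eta>\<^sup>2 + B\<^sup>2 * c n) * ?e < \<epsilon>"
      unfolding eventually_sequentially by blast
    have "norm (sq_norm ?M (\<lambda>x. \<Phi> x * tensor U V (k n) e x) - 0) < \<epsilon>" if "n \<ge> N" for n
      using le[of n] N[OF that] by simp
    then show "\<exists>no. \<forall>n\<ge>no. norm (sq_norm ?M (\<lambda>x. \<Phi> x * tensor U V (k n) e x) - 0) < \<epsilon>" by blast
  qed
qed

section \<open>Concentration at a boundary point\<close>

text \<open>Moving \<open>h\<close> to the other factor gives the Bergman function
  \<open>h * g\<close>, which \<open>e\<close> evaluates at \<open>v\<close>. So
  \<open>cnj (h v) * e\<close> is the projection of \<open>cnj h * e\<close>, and the remainder is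
  its Hankel image.\<close>

lemma representer_antiholomorphic_orthogonal:
  assumes V: "bounded V" and h: "continuous_on (closure V) h" "h holomorphic_on V"
    and e: "representer V v e" and g: "g \<in> bergman1 V"
  shows "(\<lambda>w. (cnj (h w) - cnj (h v)) * e w) \<in> l2 (lb V)"
    and "ip (lb V) (\<lambda>w. (cnj (h w) - cnj (h v)) * e w) g = 0"
proof -
  have eb: "e \<in> bergman1 V" and er: "\<And>g. g \<in> bergman1 V \<Longrightarrow> ip (lb V) g e = g v * of_real (sq_norm (lb V) e)"
    using e by (auto simp: representer_def)
  have el: "e \<in> l2 (lb V)" and gl: "g \<in> l2 (lb V)" using eb g by (auto simp: bergman1_def)
  obtain B where B: "\<And>z. z \<in> closure V \<Longrightarrow> cmod (h z) \<le> B"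
    using bounded_of_closure[OF V h(1)] by blast
  have hc: "continuous_on V (\<lambda>w. cnj (h w))"
    using continuous_on_subset[OF h(1) closure_subset] by (rule continuous_on_cnj)
  have l1: "(\<lambda>w. cnj (h w) * e w) \<in> l2 (lb V)"
    using B closure_subset[of V]
    by (intro l2_bounded_mult[OF el, where B=B] borel_measurable_lb hc) (auto simp: space_restrict_space)
  have eq: "(\<lambda>w. (cnj (h w) - cnj (h v)) * e w) = (\<lambda>w. cnj (h w) * e w - cnj (h v) * e w)"
    by (simp add: left_diff_distrib)
  show "(\<lambda>w. (cnj (h w) - cnj (h v)) * e w) \<in> l2 (lb V)"
    unfolding eq by (intro l2_diff l1 l2_scale el)
  have hg: "(\<lambda>w. h w * g w) \<in> bergman1 V" by (rule bergman1_bounded_mult[OF V h g])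
  have "ip (lb V) (\<lambda>w. cnj (h w) * e w) g = ip (lb V) e (\<lambda>w. h w * g w)"
    by (simp add: ip_def mult_ac)
  also have "\<dots> = cnj (h v * g v * of_real (sq_norm (lb V) e))"
    using ip_commute[of "lb V" e] er[OF hg] by simp
  also have "\<dots> = cnj (h v) * ip (lb V) e g"
    using ip_commute[of "lb V" e g] er[OF g] by simp
  finally show "ip (lb V) (\<lambda>w. (cnj (h w) - cnj (h v)) * e w) g = 0"
    unfolding eq by (simp add: ip_diff_left l1 l2_scale el gl ip_scale_left)
qed

text \<open>Integrating over the second variable first, each slice of \<open>g\<close> is
  annihilated by \<open>q\<close>.\<close>

lemma tensor_orthogonal:
  assumes U: "open U" and V: "open V" and k: "k \<in> l2 (lb U)" and q: "q \<in> l2 (lb V)"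
    and orth: "\<And>g. g \<in> bergman1 V \<Longrightarrow> ip (lb V) q g = 0" and g: "g \<in> bergman_space (U \<times> V)"
  shows "ip (lb (U \<times> V)) (\<lambda>x. k (fst x) * q (snd x)) g = 0"
proof -
  have o: "open (U \<times> V)" using U V by (rule open_Times)
  have S: "U \<in> sets borel" "V \<in> sets borel" using U V by auto
  note D = bergman_spaceD[OF g o]
  interpret U: sigma_finite_measure "lb U" using S(1) by (rule sigma_finite_lb)
  interpret V: sigma_finite_measure "lb V" using S(2) by (rule sigma_finite_lb)
  interpret P: pair_sigma_finite "lb U" "lb V" ..
  have pl: "lb U \<Otimes>\<^sub>M lb V = lb (U \<times> V)" using S by (rule pair_lb)
  have "integrable (lb U \<Otimes>\<^sub>M lb V) (\<lambda>x. (cmod (g x))\<^sup>2)" using l2_integrable[OF D(1)] by (simp add: pl)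
  \<comment> \<open>A slice of a square-integrable function is known to be square-integrable only
    for almost every \<open>z\<close>; the exceptional null set does not affect the outer
    integral.\<close>
  from P.AE_integrable_fst'[OF this]
  have ae: "AE z in lb U. integrable (lb V) (\<lambda>w. (cmod (g (z, w)))\<^sup>2)" .
  have zero: "AE z in lb U. (LINT w|lb V. k z * q w * cnj (g (z, w))) = 0"
    using ae
  proof (rule AE_mp, intro AE_I2 impI)
    fix z assume "z \<in> space (lb U)" and i: "integrable (lb V) (\<lambda>w. (cmod (g (z, w)))\<^sup>2)"
    then have z: "z \<in> U" using S by simp
    have h: "(\<lambda>w. g (z, w)) holomorphic_on V"
    proof (rule holomorphic_onI)
      fix w assume "w \<in> V"
      then have "(z, w) \<in> U \<times> V" using z by simp
      then show "(\<lambda>w. g (z, w)) field_differentiable at w within V"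
        by (rule field_differentiable_at_within[OF holomorphic2_on_imp_field_differentiable(2)[OF D(2) o]])
    qed
    then have "(\<lambda>w. g (z, w)) \<in> bergman1 V"
      using i by (simp add: bergman1_def l2_def borel_measurable_lb holomorphic_on_imp_continuous_on)
    from orth[OF this] show "(LINT w|lb V. k z * q w * cnj (g (z, w))) = 0"
      by (simp add: ip_def mult.assoc)
  qed
  have i: "integrable (lb U \<Otimes>\<^sub>M lb V) (\<lambda>x. k (fst x) * q (snd x) * cnj (g x))"
    using l2_product_integrable[OF l2_tensor(1)[OF S k q] D(1)] by (simp add: pl)
  have "ip (lb (U \<times> V)) (\<lambda>x. k (fst x) * q (snd x)) g
      = (LINT z|lb U. LINT w|lb V. k z * q w * cnj (g (z, w)))"
    using P.integral_fst'[OF i] by (simp add: pl ip_def)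
  also have "\<dots> = (LINT z|lb U. 0)"
  proof (rule integral_cong_AE)
    show "(\<lambda>z. LINT w|lb V. k z * q w * cnj (g (z, w))) \<in> borel_measurable (lb U)"
      using P.integrable_fst'[OF i] by simp
  qed (use zero in auto)
  finally show ?thesis by simp
qed

text \<open>The Hankel image is the limit profile \<open>x n\<close>, a freezing error
  \<open>y n\<close>, and a remainder \<open>b n\<close> in the Bergman space. The whole and
  \<open>x n\<close> are both orthogonal to that space, hence so is \<open>y n + b n\<close>, and
  therefore \<open>b n\<close> is no larger than \<open>y n\<close>.\<close>

lemma hankel_decomposition:
  assumes U: "open U" "bounded U" and V: "open V" "bounded V" and \<xi>: "\<xi> \<in> closure U"
    and k: "concentrates U \<xi> k" and \<phi>: "continuous_on (closure (U \<times> V)) \<phi>"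
    and f: "f holomorphic_on V" "continuous_on (closure V) f"
    and h: "h holomorphic_on V" "continuous_on (closure V) h"
    and eq: "\<And>w. w \<in> V \<Longrightarrow> \<phi> (\<xi>, w) = f w + cnj (h w)"
    and e: "representer V v e"
    and p: "\<And>n. p n \<in> bergman_space (U \<times> V)"
    and orth: "\<And>n u. u \<in> bergman_space (U \<times> V) \<Longrightarrow>
       ip (lb (U \<times> V)) (\<lambda>x. \<phi> x * tensor U V (k n) e x - p n x) u = 0"
  shows "\<exists>r. (\<forall>n. r n \<in> l2 (lb (U \<times> V))) \<and> (\<lambda>n. sq_norm (lb (U \<times> V)) (r n)) \<longlonglongrightarrow> 0 \<and>
    (\<forall>n. \<forall>x\<in>U \<times> V. \<phi> x * tensor U V (k n) e x - p n x
       = k n (fst x) * ((cnj (h (snd x)) - cnj (h v)) * e (snd x)) + r n x)"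
proof -
  let ?M = "lb (U \<times> V)" and ?B = "bergman_space (U \<times> V)"
  have o: "open (U \<times> V)" using U V by (intro open_Times)
  have bd: "bounded (U \<times> V)" using U V by (intro bounded_Times)
  have S: "U \<in> sets borel" "V \<in> sets borel" "U \<times> V \<in> sets borel" using U V o by auto
  have kb: "k n \<in> bergman1 U" "sq_norm (lb U) (k n) = 1" for n using k by (auto simp: concentrates_def)
  have kl: "k n \<in> l2 (lb U)" for n using kb by (simp add: bergman1_def)
  have eb: "e \<in> bergman1 V" using e by (simp add: representer_def)
  note l = bergman_spaceD(1)[OF _ o]
  have tb: "tensor U V (k n) e \<in> ?B" for n by (rule tensor_bergman[OF U(1) V(1) kb(1) eb])
  define q1 where "q1 = (\<lambda>w. (cnj (h w) - cnj (h v)) * e w)"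
  have q1l: "q1 \<in> l2 (lb V)" unfolding q1_def by (rule representer_antiholomorphic_orthogonal(1)[OF V(2) h(2,1) e eb])
  have q1o: "ip (lb V) q1 g = 0" if "g \<in> bergman1 V" for g
    unfolding q1_def by (rule representer_antiholomorphic_orthogonal(2)[OF V(2) h(2,1) e that])
  define x where "x n y = k n (fst y) * q1 (snd y)" for n y
  have xl: "x n \<in> l2 ?M" for n unfolding x_def[abs_def] by (rule l2_tensor(1)[OF S(1,2) kl q1l])
  have xo: "ip ?M (x n) g = 0" if "g \<in> ?B" for n g
    unfolding x_def[abs_def] by (rule tensor_orthogonal[OF U(1) V(1) kl q1l q1o that])
  \<comment> \<open>The error made by replacing the first coordinate by \<xi>; it vanishes on the
    slice over \<xi>, as the concentration estimate requires.\<close>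
  define \<Phi> where "\<Phi> y = \<phi> y - \<phi> (\<xi>, snd y)" for y
  have \<Phi>c: "continuous_on (closure (U \<times> V)) \<Phi>"
    unfolding \<Phi>_def
    by (intro continuous_on_diff \<phi> continuous_on_compose2[OF \<phi>] continuous_intros)
      (auto simp: closure_Times \<xi>)
  define y where "y n z = \<Phi> z * tensor U V (k n) e z" for n z
  have yl: "y n \<in> l2 ?M" for n unfolding y_def[abs_def] by (intro l2_symbol_mult[OF bd \<Phi>c] l tb)
  have ylim: "(\<lambda>n. sq_norm ?M (y n)) \<longlonglongrightarrow> 0"
    unfolding y_def[abs_def]
    by (rule tensor_concentration[OF U V k eb \<Phi>c \<xi>]) (simp add: \<Phi>_def)
  define e' where "e' = (\<lambda>w. (f w + cnj (h v)) * e w)"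
  have "e' \<in> bergman1 V"
    unfolding e'_def by (rule bergman1_bounded_mult[OF V(2) _ _ eb]) (intro continuous_intros holomorphic_intros f)+
  then have t'b: "tensor U V (k n) e' \<in> ?B" for n by (rule tensor_bergman[OF U(1) V(1) kb(1)])
  define b where "b n z = tensor U V (k n) e' z - p n z" for n z
  have bb: "b n \<in> ?B" for n unfolding b_def[abs_def] by (rule bergman_space_subspace(4)[OF o t'b p])
  define r where "r n z = y n z + b n z" for n z
  have rl: "r n \<in> l2 ?M" for n unfolding r_def[abs_def] by (intro l2_add yl l bb)
  have dec: "\<phi> z * tensor U V (k n) e z - p n z = x n z + r n z" if z: "z \<in> U \<times> V" for n z
  proof -
    have "\<phi> (\<xi>, snd z) = f (snd z) + cnj (h (snd z))" using z by (intro eq) auto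
    then show ?thesis
      using z by (simp add: x_def r_def y_def b_def \<Phi>_def q1_def e'_def tensor_def algebra_simps)
  qed
  have ro: "ip ?M (r n) u = 0" if u: "u \<in> ?B" for n u
  proof -
    have "ip ?M (\<lambda>z. x n z + r n z) u = 0"
      using orth[OF u, of n] S(3) by (subst (asm) ip_cong[OF dec refl]) auto
    then show ?thesis using xo[OF u, of n] by (simp add: ip_add_left xl rl l u)
  qed
  have "sq_norm ?M (b n) \<le> sq_norm ?M (y n)" for n
    \<comment> \<open>The orthogonality is tested against \<open>b n\<close> itself.\<close>
    using ro[OF bb, of n n] unfolding r_def[abs_def] by (rule sq_norm_minus_orthogonal_le[OF yl l[OF bb]])
  then have rle: "sq_norm ?M (r n) \<le> 4 * sq_norm ?M (y n)" for n
    using sq_norm_add_le[OF yl[of n] l[OF bb[of n]]] unfolding r_def[abs_def] by (smt (verit))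
  have "(\<lambda>n. sq_norm ?M (r n)) \<longlonglongrightarrow> 0"
  proof (rule Lim_null_comparison)
    show "\<forall>\<^sub>F n in sequentially. norm (sq_norm ?M (r n)) \<le> 4 * sq_norm ?M (y n)"
      using rle by (simp add: always_eventually)
    show "(\<lambda>n. 4 * sq_norm ?M (y n)) \<longlonglongrightarrow> 0" using tendsto_mult_right_zero[OF ylim] by simp
  qed
  with rl dec show ?thesis unfolding x_def q1_def by (intro exI[of _ r]) auto
qed

text \<open>Both Hankel images are replaced by their profiles \<open>x n\<close> and
  \<open>x' n\<close>, with errors tending to zero in norm. The inner product of the profiles does
  not depend on \<open>n\<close>, since \<open>k n\<close> has norm one, so it must equal the limit
  zero.\<close>

lemma boundary_berezin:
  assumes U: "open U" "bounded U" and V: "open V" "bounded V" and \<xi>: "\<xi> \<in> frontier U"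
    and k: "concentrates U \<xi> k"
    and \<phi>: "continuous_on (closure (U \<times> V)) \<phi>" and \<psi>: "continuous_on (closure (U \<times> V)) \<psi>"
    and A: "asymptotically_orthogonal (U \<times> V) \<phi> \<psi>"
    and f1: "f1 holomorphic_on V" "continuous_on (closure V) f1"
    and h1: "h1 holomorphic_on V" "continuous_on (closure V) h1"
    and f2: "f2 holomorphic_on V" "continuous_on (closure V) f2"
    and h2: "h2 holomorphic_on V" "continuous_on (closure V) h2"
    and eq1: "\<And>w. w \<in> V \<Longrightarrow> \<phi> (\<xi>, w) = f1 w + cnj (h1 w)"
    and eq2: "\<And>w. w \<in> V \<Longrightarrow> \<psi> (\<xi>, w) = f2 w + cnj (h2 w)"
    and e: "representer V v e"
  shows "(LINT w|lb V. (h2 w - h2 v) * cnj (h1 w - h1 v) * of_real ((cmod (e w))\<^sup>2)) = 0"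
proof -
  let ?M = "lb (U \<times> V)" and ?B = "bergman_space (U \<times> V)"
  have o: "open (U \<times> V)" using U V by (intro open_Times)
  have bd: "bounded (U \<times> V)" using U V by (intro bounded_Times)
  have S: "U \<in> sets borel" "V \<in> sets borel" "U \<times> V \<in> sets borel" using U V o by auto
  have \<xi>c: "\<xi> \<in> closure U" "\<xi> \<notin> U" using \<xi> U(1) by (auto simp: frontier_def interior_open)
  have kb: "k n \<in> bergman1 U" "sq_norm (lb U) (k n) = 1" for n using k by (auto simp: concentrates_def)
  have kl: "k n \<in> l2 (lb U)" for n using kb by (simp add: bergman1_def)
  have eb: "e \<in> bergman1 V" using e by (simp add: representer_def)
  have el: "e \<in> l2 (lb V)" using eb by (simp add: bergman1_def)
  note l = bergman_spaceD(1)[OF _ o]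
  define F where "F n = tensor U V (k n) e" for n
  have Fb: "F n \<in> ?B" for n unfolding F_def by (rule tensor_bergman[OF U(1) V(1) kb(1) eb])
  have proj: "\<exists>p. \<forall>n. p n \<in> ?B \<and> (\<forall>u\<in>?B. ip ?M (\<lambda>x. \<theta> x * F n x - p n x) u = 0)"
    if \<theta>: "continuous_on (closure (U \<times> V)) \<theta>" for \<theta>
  proof (rule choice, rule allI)
    fix n
    show "\<exists>p. p \<in> ?B \<and> (\<forall>u\<in>?B. ip ?M (\<lambda>x. \<theta> x * F n x - p x) u = 0)"
      using bergman_projection_exists[OF o l2_symbol_mult[OF bd \<theta> l[OF Fb[of n]]]] unfolding Bex_def .
  qed
  obtain p where p: "\<And>n. p n \<in> ?B" and op: "\<And>n u. u \<in> ?B \<Longrightarrow> ip ?M (\<lambda>x. \<phi> x * F n x - p n x) u = 0"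
    using proj[OF \<phi>] by blast
  obtain q where q: "\<And>n. q n \<in> ?B" and oq: "\<And>n u. u \<in> ?B \<Longrightarrow> ip ?M (\<lambda>x. \<psi> x * F n x - q n x) u = 0"
    using proj[OF \<psi>] by blast
  have FC: "sq_norm ?M (F n) \<le> sq_norm (lb V) e" for n
  proof -
    have "sq_norm ?M (F n) = sq_norm ?M (\<lambda>x. k n (fst x) * e (snd x))"
      using S by (intro sq_norm_cong) (auto simp: F_def tensor_def)
    then show ?thesis using l2_tensor(2)[OF S(1,2) kl el, of n] kb by simp
  qed
  have weak: "(\<lambda>n. ip ?M (F n) u) \<longlonglongrightarrow> 0" if "u \<in> ?B" for u
    unfolding F_def by (rule tensor_weakly_null[OF U(1) V(1) \<xi>c(2) k eb l[OF that]])
  have lim: "(\<lambda>n. ip ?M (\<lambda>x. \<phi> x * F n x - p n x) (\<lambda>x. \<psi> x * F n x - q n x)) \<longlonglongrightarrow> 0"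
    using A[unfolded asymptotically_orthogonal_def, rule_format, of F p q "sq_norm (lb V) e"]
      Fb p q op oq FC weak by blast
  obtain r where rl: "\<And>n. r n \<in> l2 ?M" and r0: "(\<lambda>n. sq_norm ?M (r n)) \<longlonglongrightarrow> 0"
    and dr: "\<And>n x. x \<in> U \<times> V \<Longrightarrow> \<phi> x * F n x - p n x
       = k n (fst x) * ((cnj (h1 (snd x)) - cnj (h1 v)) * e (snd x)) + r n x"
    using hankel_decomposition[OF U V \<xi>c(1) k \<phi> f1 h1 eq1 e p op[unfolded F_def]]
    unfolding F_def by blast
  obtain s where sl: "\<And>n. s n \<in> l2 ?M" and s0: "(\<lambda>n. sq_norm ?M (s n)) \<longlonglongrightarrow> 0"
    and ds: "\<And>n x. x \<in> U \<times> V \<Longrightarrow> \<psi> x * F n x - q n x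
       = k n (fst x) * ((cnj (h2 (snd x)) - cnj (h2 v)) * e (snd x)) + s n x"
    using hankel_decomposition[OF U V \<xi>c(1) k \<psi> f2 h2 eq2 e q oq[unfolded F_def]]
    unfolding F_def by blast
  define q1 where "q1 = (\<lambda>w. (cnj (h1 w) - cnj (h1 v)) * e w)"
  define q2 where "q2 = (\<lambda>w. (cnj (h2 w) - cnj (h2 v)) * e w)"
  have ql: "q1 \<in> l2 (lb V)" "q2 \<in> l2 (lb V)"
    unfolding q1_def q2_def
    by (rule representer_antiholomorphic_orthogonal(1)[OF V(2) h1(2,1) e eb], rule representer_antiholomorphic_orthogonal(1)[OF V(2) h2(2,1) e eb])
  define x where "x n y = k n (fst y) * q1 (snd y)" for n y
  define x' where "x' n y = k n (fst y) * q2 (snd y)" for n y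
  have xl: "x n \<in> l2 ?M" "x' n \<in> l2 ?M" for n
    unfolding x_def[abs_def] x'_def[abs_def] by (intro l2_tensor(1)[OF S(1,2) kl] ql)+
  have xn: "sq_norm ?M (x n) = sq_norm (lb V) q1" "sq_norm ?M (x' n) = sq_norm (lb V) q2" for n
    unfolding x_def[abs_def] x'_def[abs_def] using l2_tensor(2)[OF S(1,2) kl] ql kb by simp_all
  have ipx: "ip ?M (x n) (x' n) = ip (lb V) q1 q2" for n
    unfolding x_def[abs_def] x'_def[abs_def]
    using ip_tensor[OF S(1,2) kl ql(1) kl ql(2)] kb by (simp add: ip_self)
  have split: "ip ?M (\<lambda>x. \<phi> x * F n x - p n x) (\<lambda>x. \<psi> x * F n x - q n x)
      = ip (lb V) q1 q2 + ip ?M (r n) (x' n) + (ip ?M (x n) (s n) + ip ?M (r n) (s n))" for n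
  proof -
    have "ip ?M (\<lambda>x. \<phi> x * F n x - p n x) (\<lambda>x. \<psi> x * F n x - q n x)
        = ip ?M (\<lambda>y. x n y + r n y) (\<lambda>y. x' n y + s n y)"
      using S(3) by (intro ip_cong) (simp_all add: dr ds x_def x'_def q1_def q2_def)
    also have "\<dots> = ip ?M (x n) (x' n) + ip ?M (r n) (x' n) + (ip ?M (x n) (s n) + ip ?M (r n) (s n))"
      by (simp add: ip_add_left ip_add_right xl rl sl l2_add)
    finally show ?thesis by (simp add: ipx)
  qed
  have "Bseq (\<lambda>n. sq_norm ?M (s n))" using s0 by (intro convergent_imp_Bseq convergentI)
  then obtain Cs where Cs: "\<And>n. sq_norm ?M (s n) \<le> Cs" unfolding Bseq_def by (metis abs_le_D1 real_norm_def)
  have t1: "(\<lambda>n. ip ?M (r n) (x' n)) \<longlonglongrightarrow> 0" by (rule ip_tendsto[OF rl xl(2) r0 xn(2)[THEN eq_refl]])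
  have t3: "(\<lambda>n. ip ?M (r n) (s n)) \<longlonglongrightarrow> 0" by (rule ip_tendsto[OF rl sl r0 Cs])
  have "(\<lambda>n. ip ?M (s n) (x n)) \<longlonglongrightarrow> 0" by (rule ip_tendsto[OF sl xl(1) s0 xn(1)[THEN eq_refl]])
  from tendsto_cnj[OF this] have t2: "(\<lambda>n. ip ?M (x n) (s n)) \<longlonglongrightarrow> 0" by (simp flip: ip_commute)
  have "(\<lambda>n. ip (lb V) q1 q2 + ip ?M (r n) (x' n) + (ip ?M (x n) (s n) + ip ?M (r n) (s n)))
      \<longlonglongrightarrow> ip (lb V) q1 q2 + 0 + (0 + 0)"
    by (intro tendsto_add tendsto_const t1 t2 t3)
  then have "(\<lambda>n. ip ?M (\<lambda>x. \<phi> x * F n x - p n x) (\<lambda>x. \<psi> x * F n x - q n x)) \<longlonglongrightarrow> ip (lb V) q1 q2"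
    by (simp add: split)
  from LIMSEQ_unique[OF this lim] have "ip (lb V) q1 q2 = 0" .
  moreover have "ip (lb V) q1 q2 = (LINT w|lb V. (h2 w - h2 v) * cnj (h1 w - h1 v) * of_real ((cmod (e w))\<^sup>2))"
    unfolding ip_def q1_def q2_def complex_norm_square by (simp add: mult_ac)
  ultimately show ?thesis by simp
qed

text \<open>Powers of the peak function, normalised in norm. Outside a ball they decay at a rate
  \<rho> below 1, whereas near \<xi> the function exceeds any prescribed \<sigma> below 1 on a set
  of positive measure, so that the norms decay more slowly.\<close>

lemma concentrates_of_peak:
  assumes U: "open U" "bounded U" and \<xi>: "\<xi> \<in> closure U"
    and p: "p holomorphic_on U" "continuous_on (closure U) p" "p \<xi> = 1"
    and lt: "\<And>z. z \<in> closure U \<Longrightarrow> z \<noteq> \<xi> \<Longrightarrow> cmod (p z) < 1"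
  shows "\<exists>k. concentrates U \<xi> k"
proof -
  have S: "U \<in> sets borel" using U by simp
  have pc: "continuous_on U p" using p(1) by (rule holomorphic_on_imp_continuous_on)
  have le1: "cmod (p z) \<le> 1" if "z \<in> closure U" for z
    using lt[OF that] p(3) by (cases "z = \<xi>") auto
  have pl: "(\<lambda>z. p z ^ n) \<in> l2 (lb U)" for n
    using le1 closure_subset[of U] U
    by (intro l2_bounded_continuous[where B=1] continuous_intros pc) (auto simp: norm_power intro!: power_le_one)
  have mU: "emeasure lborel U < \<infinity>" using U by (intro emeasure_bounded_finite)
  define N where "N n = sq_norm (lb U) (\<lambda>z. p z ^ n)" for n
  have lower: "\<exists>m>0. \<forall>n. \<sigma> ^ (2 * n) * m \<le> N n" if \<sigma>: "0 < \<sigma>" "\<sigma> < 1" for \<sigma> :: real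
  proof -
    define A where "A = U \<inter> (\<lambda>z. cmod (p z)) -` {\<sigma><..}"
    have Ao: "open A" unfolding A_def
      by (rule continuous_open_preimage[OF _ U(1)]) (auto intro!: continuous_intros pc)
    have "continuous (at \<xi> within closure U) p"
      using p(2) \<xi> by (simp add: continuous_on_eq_continuous_within)
    then obtain d where d: "d > 0" "\<And>y. y \<in> closure U \<Longrightarrow> dist y \<xi> < d \<Longrightarrow> dist (p y) (p \<xi>) < 1 - \<sigma>"
      using \<sigma> unfolding continuous_within_eps_delta by (metis diff_gt_0_iff_gt)
    \<comment> \<open>The point \<xi> lies only in the closure; a nearby point of \<open>U\<close>
      supplies a whole ball on which the peak function exceeds \<sigma>.\<close>
    obtain y where y: "y \<in> U" "dist y \<xi> < d" using \<xi> d(1) unfolding closure_approachable by blast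
    have "dist (p y) 1 < 1 - \<sigma>" using d(2)[of y] y closure_subset[of U] p(3) by auto
    then have "\<sigma> < cmod (p y)" using norm_triangle_ineq2[of 1 "p y"] by (simp add: dist_norm norm_minus_commute)
    then have yA: "y \<in> A" using y by (simp add: A_def)
    have Af: "emeasure lborel A < \<infinity>" using U by (intro emeasure_bounded_finite) (auto simp: A_def intro: bounded_subset)
    obtain b where b: "b > 0" "ball y b \<subseteq> A" using Ao yA by (rule openE)
    have "0 < measure lborel (ball y b)" using b by (simp add: content_ball_pos)
    also have "\<dots> \<le> measure lborel A"
      using b Af Ao by (intro measure_mono_fmeasurable) (auto simp: fmeasurable_def)
    finally have mA: "0 < measure lborel A" .
    have "\<sigma> ^ (2 * n) * measure lborel A \<le> N n" for n
    proof -
      have iA: "integrable (lb U) (\<lambda>z. \<sigma> ^ (2 * n) * indicator A z :: real)"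
      proof (intro integrable_mult_right)
        have "integrable lborel (indicator A :: complex \<Rightarrow> real)" using Af Ao by (simp add: integrable_indicator_iff)
        then have "integrable lborel (\<lambda>z. indicator U z *\<^sub>R indicator A z :: real)"
          using S by (intro integrable_mult_indicator) auto
        then show "integrable (lb U) (\<lambda>z. indicator A z :: real)" using S by (simp add: integrable_restrict_space)
      qed
      have "(LINT z|lb U. \<sigma> ^ (2 * n) * indicator A z :: real) \<le> N n"
        unfolding N_def sq_norm_def
      proof (rule integral_mono[OF iA l2_integrable[OF pl]])
        fix z
        show "\<sigma> ^ (2 * n) * indicator A z \<le> (cmod (p z ^ n))\<^sup>2"
        proof (cases "z \<in> A")
          case True
          then have "\<sigma> ^ (2 * n) \<le> cmod (p z) ^ (2 * n)" using \<sigma> by (intro power_mono) (auto simp: A_def)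
          then show ?thesis using True by (simp add: norm_power power_mult[symmetric] mult.commute)
        qed simp
      qed
      moreover have "(LINT z|lb U. indicator A z :: real) = measure lborel A"
      proof -
        have eq: "(\<lambda>z. indicator U z *\<^sub>R indicator A z :: real) = indicator A"
          by (rule ext) (auto simp: A_def indicator_def)
        show ?thesis unfolding integral_lb[OF S] eq by simp
      qed
      ultimately show ?thesis by simp
    qed
    with mA show ?thesis by blast
  qed
  have Npos: "0 < N n" for n
  proof -
    obtain m where "m > 0" "(1/2) ^ (2 * n) * m \<le> N n" using lower[of "1/2"] by auto
    moreover from this have "0 < (1/2 :: real) ^ (2 * n) * m" by simp
    ultimately show ?thesis by linarith
  qed
  define k where "k n z = of_real (1 / sqrt (N n)) * p z ^ n" for n z
  have kl: "k n \<in> l2 (lb U)" for n unfolding k_def[abs_def] by (rule l2_scale[OF pl])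
  have "k n holomorphic_on U" for n unfolding k_def[abs_def] by (intro holomorphic_intros p(1))
  with kl have "k n \<in> bergman1 U" for n by (simp add: bergman1_def)
  moreover have "sq_norm (lb U) (k n) = 1" for n
  proof -
    have "sq_norm (lb U) (k n) = (cmod (of_real (1 / sqrt (N n))))\<^sup>2 * N n"
      unfolding k_def[abs_def] N_def by (rule sq_norm_scale)
    also have "(cmod (of_real (1 / sqrt (N n))))\<^sup>2 = 1 / N n"
      using Npos[of n] by (simp add: power_divide norm_divide)
    finally show ?thesis using Npos[of n] by simp
  qed
  moreover have "(\<lambda>n. sq_norm (lb U) (\<lambda>z. of_real (indicator (- ball \<xi> \<delta>) z) * k n z)) \<longlonglongrightarrow> 0" if \<delta>: "0 < \<delta>" for \<delta>
  proof -
    have comp: "compact (closure U - ball \<xi> \<delta>)" using U by (intro compact_diff) auto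
    have "\<exists>\<rho><1. 0 \<le> \<rho> \<and> (\<forall>z\<in>closure U - ball \<xi> \<delta>. cmod (p z) \<le> \<rho>)"
    proof (cases "closure U - ball \<xi> \<delta> = {}")
      case True then show ?thesis by (intro exI[of _ 0]) auto
    next
      case False
      have "continuous_on (closure U - ball \<xi> \<delta>) (\<lambda>z. cmod (p z))"
        by (intro continuous_intros continuous_on_subset[OF p(2)]) auto
      from continuous_attains_sup[OF comp False this] obtain z0
        where z0: "z0 \<in> closure U - ball \<xi> \<delta>" "\<And>z. z \<in> closure U - ball \<xi> \<delta> \<Longrightarrow> cmod (p z) \<le> cmod (p z0)"
        by blast
      have "cmod (p z0) < 1" using z0(1) \<delta> by (intro lt) auto
      with z0 show ?thesis by (intro exI[of _ "cmod (p z0)"]) auto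
    qed
    then obtain \<rho> where \<rho>: "0 \<le> \<rho>" "\<rho> < 1" "\<And>z. z \<in> closure U - ball \<xi> \<delta> \<Longrightarrow> cmod (p z) \<le> \<rho>" by blast
    \<comment> \<open>Strictly between \<rho> and 1: the quotient of the mass outside the ball by
      the squared norm is then dominated by powers of
      \<open>(\<rho> / \<sigma>)\<^sup>2\<close>.\<close>
    define \<sigma> where "\<sigma> = (\<rho> + 1) / 2"
    have \<sigma>: "0 < \<sigma>" "\<sigma> < 1" "\<rho> < \<sigma>" using \<rho> by (auto simp: \<sigma>_def)
    obtain m where m: "m > 0" "\<And>n. \<sigma> ^ (2 * n) * m \<le> N n" using lower[OF \<sigma>(1,2)] by blast
    define K where "K = measure lborel U / m"
    have bound: "sq_norm (lb U) (\<lambda>z. of_real (indicator (- ball \<xi> \<delta>) z) * k n z) \<le> ((\<rho> / \<sigma>)\<^sup>2) ^ n * K" for n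
    proof -
      interpret fin: finite_measure "lb U" using U by (intro finite_measure_lb) auto
      have "(cmod (of_real (indicator (- ball \<xi> \<delta>) z) * k n z))\<^sup>2 \<le> \<rho> ^ (2 * n) / N n" if z: "z \<in> U" for z
      proof (cases "z \<in> ball \<xi> \<delta>")
        case False
        then have "cmod (p z) \<le> \<rho>" using z closure_subset[of U] by (intro \<rho>) auto
        then have "cmod (p z) ^ (2 * n) \<le> \<rho> ^ (2 * n)" by (intro power_mono) auto
        moreover have "(cmod (of_real (indicator (- ball \<xi> \<delta>) z) * k n z))\<^sup>2 = cmod (p z) ^ (2 * n) / N n"
          using False Npos[of n] by (simp add: k_def norm_mult norm_divide norm_power power_mult_distrib power_divide
              power_mult[symmetric] mult.commute)
        ultimately show ?thesis using Npos[of n] by (simp add: divide_right_mono less_imp_le)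
      qed (use Npos[of n] \<rho> in simp)
      then have "sq_norm (lb U) (\<lambda>z. of_real (indicator (- ball \<xi> \<delta>) z) * k n z) \<le> (LINT z|lb U. \<rho> ^ (2 * n) / N n)"
        unfolding sq_norm_def using S
        by (intro integral_mono fin.integrable_const l2_integrable indicator_l2 indicator_measurable_lb kl) auto
      also have "\<dots> = \<rho> ^ (2 * n) / N n * measure lborel U"
        using S by (simp add: measure_restrict_space)
      also have "\<dots> \<le> \<rho> ^ (2 * n) / (\<sigma> ^ (2 * n) * m) * measure lborel U"
        using m \<sigma> \<rho> by (intro mult_right_mono divide_left_mono mult_pos_pos Npos) auto
      also have "\<dots> = ((\<rho> / \<sigma>)\<^sup>2) ^ n * K"
        by (simp add: K_def power_mult[symmetric] power_divide)
      finally show ?thesis .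
    qed
    have "(\<rho> / \<sigma>)\<^sup>2 < 1" using \<rho> \<sigma> by (intro power_less_one_iff[THEN iffD2]) auto
    then have "(\<lambda>n. ((\<rho> / \<sigma>)\<^sup>2) ^ n * K) \<longlonglongrightarrow> 0 * K"
      by (intro tendsto_mult tendsto_const LIMSEQ_realpow_zero) auto
    then have geom: "(\<lambda>n. ((\<rho> / \<sigma>)\<^sup>2) ^ n * K) \<longlonglongrightarrow> 0" by simp
    show ?thesis
      by (rule Lim_null_comparison[OF _ geom]) (simp add: bound always_eventually)
  qed
  ultimately show ?thesis unfolding concentrates_def by blast
qed

section \<open>Disks, annuli and the boundary of the product\<close>

text \<open>Strict convexity of the unit disk. Averaging with 1 turns a function of modulus one on
  an entire circle into one that peaks at a single point.\<close>

lemma norm_half_plus_one_less: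
  fixes t :: complex
  assumes t: "cmod t \<le> 1" "t \<noteq> 1" shows "cmod ((1 + t) / 2) < 1"
proof (rule ccontr)
  assume "\<not> ?thesis"
  then have "2 \<le> cmod (1 + t)" by (simp add: norm_divide)
  then have "2\<^sup>2 \<le> (cmod (1 + t))\<^sup>2" by (rule power_mono) simp
  also have "\<dots> = 1 + 2 * Re t + (cmod t)\<^sup>2"
    unfolding cmod_power2 by (simp add: power2_eq_square algebra_simps)
  finally have le: "3 \<le> 2 * Re t + (cmod t)\<^sup>2" by simp
  have t2: "(cmod t)\<^sup>2 \<le> 1" using t by (simp add: power_le_one)
  then have re: "1 \<le> Re t" using le by simp
  then have "1 \<le> (Re t)\<^sup>2" by (simp add: one_le_power)
  then have "(Im t)\<^sup>2 \<le> 0" using t2 unfolding cmod_power2 by linarith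
  then have "Im t = 0" by simp
  moreover have "Re t = 1" using re t(1) complex_Re_le_cmod[of t] by linarith
  ultimately show False using t(2) by (simp add: complex_eq_iff)
qed

lemma disk_or_annulus_eq:
  assumes "disk W \<or> annulus W"
  obtains a r R where "r < R" "0 < R" "r \<noteq> 0" "W = {z. z - a \<in> round_domain r R}"
  using assms
proof
  assume "disk W"
  then obtain a R where R: "0 < R" "W = {z. cmod (z - a) < R}" unfolding disk_def by blast
  have "-1 < cmod w" for w using norm_ge_zero[of w] by linarith
  \<comment> \<open>A negative inner radius imposes no condition, so the disk becomes a case of
    \<open>round_domain\<close>.\<close>
  then have "W = {z. z - a \<in> round_domain (-1) R}" unfolding R round_domain_def by simp
  then show thesis using R by (intro that[of "-1" R a]) auto
next
  assume "annulus W"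
  then obtain a r R where R: "0 < r" "r < R" "W = {z. r < cmod (z - a) \<and> cmod (z - a) < R}"
    unfolding annulus_def by blast
  have "W = {z. z - a \<in> round_domain r R}" unfolding R round_domain_def by simp
  then show thesis using R by (intro that[of r R a]) auto
qed

text \<open>The third claim serves the open mapping theorem. For the last one, the function to be
  averaged with 1 is \<open>(z - a) / (\<xi> - a)\<close> on the outer circle and its reciprocal on
  the inner one: both are bounded by 1 on the closure and equal 1 only at \<xi>.\<close>

lemma shifted_round_domain:
  fixes a :: complex
  assumes rR: "r < R" "0 < R" "r \<noteq> 0" and W: "W = {z. z - a \<in> round_domain r R}"
  shows "open W" "bounded W" "interior (closure W) \<subseteq> W"
    and "\<xi> \<in> frontier W \<Longrightarrow> \<exists>k. concentrates W \<xi> k"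
proof -
  have W': "W = {z. r < cmod (z - a) \<and> cmod (z - a) < R}" by (simp add: W round_domain_def)
  show o: "open W"
    unfolding W' by (intro open_Collect_conj open_Collect_less continuous_intros)
  show b: "bounded W"
    by (rule bounded_subset[OF bounded_ball[of a R]]) (auto simp: W' dist_norm norm_minus_commute)
  have cl: "closure W \<subseteq> {z. r \<le> cmod (z - a) \<and> cmod (z - a) \<le> R}"
    by (rule closure_minimal) (auto simp: W' intro!: closed_Collect_conj closed_Collect_le continuous_intros)
  show "interior (closure W) \<subseteq> W"
  proof -
    have "closure W \<subseteq> cball a R \<inter> - ball a r"
      using cl by (auto simp: dist_norm norm_minus_commute)
    then have "interior (closure W) \<subseteq> interior (cball a R \<inter> - ball a r)" by (rule interior_mono)
    also have "\<dots> = ball a R \<inter> - closure (ball a r)"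
      by (simp add: interior_Int interior_complement)
    also have "\<dots> \<subseteq> W"
    proof
      fix z assume z: "z \<in> ball a R \<inter> - closure (ball a r)"
      have "r < cmod (z - a)"
      proof (cases "0 < r")
        case True then show ?thesis using z by (simp add: dist_norm norm_minus_commute)
      next
        case False
        then have "r < 0" using rR by simp
        then show ?thesis using norm_ge_zero[of "z - a"] by linarith
      qed
      then show "z \<in> W" using z by (simp add: W' dist_norm norm_minus_commute)
    qed
    finally show ?thesis .
  qed
  show "\<exists>k. concentrates W \<xi> k" if \<xi>: "\<xi> \<in> frontier W"
  proof -
    have \<xi>c: "\<xi> \<in> closure W" "\<xi> \<notin> W" using \<xi> o by (auto simp: frontier_def interior_open)
    then have "cmod (\<xi> - a) = R \<or> cmod (\<xi> - a) = r" using cl by (auto simp: W')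
    then show ?thesis
    proof
      assume n: "cmod (\<xi> - a) = R"
      then have nz: "\<xi> - a \<noteq> 0" using rR by auto
      show ?thesis
      proof (rule concentrates_of_peak[OF o b \<xi>c(1)])
        let ?p = "\<lambda>z. (1 + (z - a) / (\<xi> - a)) / 2"
        show "?p holomorphic_on W" "continuous_on (closure W) ?p"
          using nz by (auto intro!: holomorphic_intros continuous_intros)
        show "?p \<xi> = 1" using nz by simp
        show "cmod (?p z) < 1" if "z \<in> closure W" "z \<noteq> \<xi>" for z
        proof (rule norm_half_plus_one_less)
          show "cmod ((z - a) / (\<xi> - a)) \<le> 1" using that cl n rR by (auto simp: norm_divide)
          show "(z - a) / (\<xi> - a) \<noteq> 1" using that nz by simp
        qed
      qed
    next
      assume n: "cmod (\<xi> - a) = r"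
      \<comment> \<open>A frontier point on the inner circle forces an annulus, whose closure avoids
        the centre, so the reciprocal is holomorphic.\<close>
      then have r0: "0 < r" using norm_ge_zero[of "\<xi> - a"] rR by linarith
      then have nz: "z - a \<noteq> 0" if "z \<in> closure W" for z using that cl by auto
      have nzW: "z - a \<noteq> 0" if "z \<in> W" for z using that closure_subset nz by blast
      show ?thesis
      proof (rule concentrates_of_peak[OF o b \<xi>c(1)])
        let ?p = "\<lambda>z. (1 + (\<xi> - a) / (z - a)) / 2"
        show "?p holomorphic_on W" "continuous_on (closure W) ?p"
          using nz nzW by (auto intro!: holomorphic_intros continuous_intros)
        show "?p \<xi> = 1" using nz[OF \<xi>c(1)] by simp
        show "cmod (?p z) < 1" if "z \<in> closure W" "z \<noteq> \<xi>" for z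
        proof (rule norm_half_plus_one_less)
          have "r \<le> cmod (z - a)" using that cl by auto
          then show "cmod ((\<xi> - a) / (z - a)) \<le> 1" using n r0 by (simp add: norm_divide divide_le_eq)
          show "(\<xi> - a) / (z - a) \<noteq> 1" using that nz[OF that(1)] by simp
        qed
      qed
    qed
  qed
qed

section \<open>Transport to shifted domains and boundary slices\<close>

lemma representer_translate:
  fixes a :: complex
  assumes V: "open V" and W: "W = {z. z - a \<in> V}" and k: "representer V v k"
  shows "representer W (a + v) (\<lambda>z. k (z - a))"
proof -
  have oW: "open W"
    unfolding W by (rule open_vimage[OF V, of "\<lambda>z. z - a", unfolded vimage_def]) (intro continuous_intros)
  have S: "V \<in> sets borel" "W \<in> sets borel" using V oW by auto
  have VW: "a + z \<in> W \<longleftrightarrow> z \<in> V" for z by (simp add: W)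
  have i: "integral\<^sup>L (lb V) (\<lambda>z. f (a + z)) = integral\<^sup>L (lb W) f"
    "integrable (lb V) (\<lambda>z. f (a + z)) \<longleftrightarrow> integrable (lb W) f"
    if "f \<in> borel_measurable (lb W)" for f :: "complex \<Rightarrow> 'b::{banach,second_countable_topology}"
    using integral_lb_translation[OF S(2) VW S(1) that] by auto
  have kb: "k \<in> bergman1 V" "k v = 1" and kr: "\<And>g. g \<in> bergman1 V \<Longrightarrow> ip (lb V) g k = g v * of_real (sq_norm (lb V) k)"
    using k by (auto simp: representer_def)
  define k' where "k' = (\<lambda>z. k (z - a))"
  have kh: "k' holomorphic_on W"
  proof -
    have "k \<circ> (\<lambda>z. z - a) holomorphic_on W"
      by (rule holomorphic_on_compose_gen[where t=V]) (use kb in \<open>auto simp: bergman1_def W intro!: holomorphic_intros\<close>)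
    then show ?thesis by (simp add: k'_def o_def)
  qed
  have kc: "continuous_on W k'" using kh by (rule holomorphic_on_imp_continuous_on)
  have km: "(\<lambda>z. (cmod (k' z))\<^sup>2) \<in> borel_measurable (lb W)" by (intro borel_measurable_lb continuous_intros kc)
  have k'b: "k' \<in> bergman1 W"
    using i(2)[OF km] kb(1) kh borel_measurable_lb[OF kc] by (simp add: bergman1_def l2_def k'_def)
  have nk: "sq_norm (lb W) k' = sq_norm (lb V) k"
    using i(1)[OF km] by (simp add: sq_norm_def k'_def)
  have "ip (lb W) g k' = g (a + v) * of_real (sq_norm (lb W) k')" if g: "g \<in> bergman1 W" for g
  proof -
    have gh: "g holomorphic_on W" using g by (simp add: bergman1_def)
    have gc: "continuous_on W g" using gh by (rule holomorphic_on_imp_continuous_on)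
    have g'h: "(\<lambda>z. g (a + z)) holomorphic_on V"
    proof -
      have "g \<circ> (\<lambda>z. a + z) holomorphic_on V"
        by (rule holomorphic_on_compose_gen[OF _ gh]) (auto simp: W intro!: holomorphic_intros)
      then show ?thesis by (simp add: o_def)
    qed
    have gm: "(\<lambda>z. (cmod (g z))\<^sup>2) \<in> borel_measurable (lb W)" by (intro borel_measurable_lb continuous_intros gc)
    have "(\<lambda>z. g (a + z)) \<in> bergman1 V"
      using i(2)[OF gm] g g'h borel_measurable_lb[OF holomorphic_on_imp_continuous_on[OF g'h]]
      by (simp add: bergman1_def l2_def)
    from kr[OF this] have "ip (lb V) (\<lambda>z. g (a + z)) k = g (a + v) * of_real (sq_norm (lb V) k)" .
    moreover have "ip (lb V) (\<lambda>z. g (a + z)) k = ip (lb W) g k'"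
    proof -
      have "(\<lambda>z. g z * cnj (k' z)) \<in> borel_measurable (lb W)" by (intro borel_measurable_lb continuous_intros kc gc)
      from i(1)[OF this] show ?thesis by (simp add: ip_def k'_def)
    qed
    ultimately show ?thesis by (simp add: nk)
  qed
  then show ?thesis using k'b kb by (simp add: representer_def k'_def)
qed

lemma shifted_round_domain_dichotomy:
  fixes a :: complex
  assumes rR: "r < R" "0 < R" "r \<noteq> 0" and W: "W = {z. z - a \<in> round_domain r R}"
    and h1: "h1 holomorphic_on W" "continuous_on (closure W) h1"
    and h2: "h2 holomorphic_on W" "continuous_on (closure W) h2"
    and hyp: "\<And>v k. representer W v k \<Longrightarrow>
      (LINT z|lb W. (h2 z - h2 v) * cnj (h1 z - h1 v) * of_real ((cmod (k z))\<^sup>2)) = 0"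
  shows "(\<exists>c. \<forall>z\<in>W. h1 z = c) \<or> (\<exists>c. \<forall>z\<in>W. h2 z = c)"
proof -
  let ?V = "round_domain r R"
  have oW: "open W" using shifted_round_domain(1)[OF rR W] .
  have S: "?V \<in> sets borel" "W \<in> sets borel" using round_domain_open oW by auto
  have VW: "a + z \<in> W \<longleftrightarrow> z \<in> ?V" for z by (simp add: W)
  have hs: "(\<lambda>z. h (a + z)) holomorphic_on ?V" "continuous_on (closure ?V) (\<lambda>z. h (a + z))"
    if "h holomorphic_on W" "continuous_on (closure W) h" for h
  proof -
    have "h \<circ> (\<lambda>z. a + z) holomorphic_on ?V"
      by (rule holomorphic_on_compose_gen[OF _ that(1)]) (auto simp: W intro!: holomorphic_intros)
    then show "(\<lambda>z. h (a + z)) holomorphic_on ?V" by (simp add: o_def)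
    have "(+) a ` closure ?V \<subseteq> closure ((+) a ` ?V)"
      by (rule continuous_image_closure_subset[of UNIV]) (auto intro!: continuous_intros)
    also have "\<dots> \<subseteq> closure W" by (rule closure_mono) (auto simp: W)
    finally show "continuous_on (closure ?V) (\<lambda>z. h (a + z))"
      by (intro continuous_on_compose2[OF that(2)] continuous_intros)
  qed
  have "(\<exists>c. \<forall>z\<in>?V. h1 (a + z) = c) \<or> (\<exists>c. \<forall>z\<in>?V. h2 (a + z) = c)"
  proof (rule round_domain_dichotomy[OF rR hs[OF h1] hs[OF h2]])
    fix v k assume k: "representer ?V v k"
    define k' where "k' = (\<lambda>z. k (z - a))"
    have r: "representer W (a + v) k'" unfolding k'_def by (rule representer_translate[OF round_domain_open W k])
    have kc: "continuous_on W k'" using r by (auto simp: representer_def bergman1_def intro: holomorphic_on_imp_continuous_on)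
    have hc: "continuous_on W h1" "continuous_on W h2" using h1 h2 by (auto intro: holomorphic_on_imp_continuous_on)
    have "(\<lambda>z. (h2 z - h2 (a + v)) * cnj (h1 z - h1 (a + v)) * of_real ((cmod (k' z))\<^sup>2)) \<in> borel_measurable (lb W)"
      by (intro borel_measurable_lb continuous_intros kc hc)
    from integral_lb_translation(1)[OF S(2) VW S(1) this] hyp[OF r]
    show "(LINT z|lb ?V. (h2 (a + z) - h2 (a + v)) * cnj (h1 (a + z) - h1 (a + v)) * of_real ((cmod (k z))\<^sup>2)) = 0"
      by (simp add: k'_def)
  qed
  moreover have "z - a \<in> ?V \<and> h (a + (z - a)) = h z" if "z \<in> W" for z and h :: "complex \<Rightarrow> complex"
    using that by (simp add: W)
  ultimately show ?thesis by metis
qed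

text \<open>If one of the conjugated parts is constant, the corresponding slice is a holomorphic
  function plus a constant.\<close>

lemma boundary_slice_holomorphic:
  assumes dU: "disk U \<or> annulus U" and dV: "disk V \<or> annulus V"
    and \<phi>: "continuous_on (closure (U \<times> V)) \<phi>" and \<psi>: "continuous_on (closure (U \<times> V)) \<psi>"
    and A: "asymptotically_orthogonal (U \<times> V) \<phi> \<psi>" and \<xi>: "\<xi> \<in> frontier U"
    and p1: "holo_plus_antiholo_on (\<lambda>w. \<phi> (\<xi>, w)) V" and p2: "holo_plus_antiholo_on (\<lambda>w. \<psi> (\<xi>, w)) V"
  shows "(\<lambda>w. \<phi> (\<xi>, w)) holomorphic_on V \<or> (\<lambda>w. \<psi> (\<xi>, w)) holomorphic_on V"
proof -
  obtain a r R where U: "r < R" "0 < R" "r \<noteq> 0" "U = {z. z - a \<in> round_domain r R}"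
    using dU by (rule disk_or_annulus_eq)
  obtain b s S where V: "s < S" "0 < S" "s \<noteq> 0" "V = {z. z - b \<in> round_domain s S}"
    using dV by (rule disk_or_annulus_eq)
  note U' = shifted_round_domain[OF U] and V' = shifted_round_domain[OF V]
  obtain k where k: "concentrates U \<xi> k" using U'(4)[OF \<xi>] by blast
  obtain f1 h1 where f1: "f1 holomorphic_on V" "continuous_on (closure V) f1"
    and h1: "h1 holomorphic_on V" "continuous_on (closure V) h1"
    and e1: "\<And>w. w \<in> V \<Longrightarrow> \<phi> (\<xi>, w) = f1 w + cnj (h1 w)"
    using p1 unfolding holo_plus_antiholo_on_def by blast
  obtain f2 h2 where f2: "f2 holomorphic_on V" "continuous_on (closure V) f2"
    and h2: "h2 holomorphic_on V" "continuous_on (closure V) h2"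
    and e2: "\<And>w. w \<in> V \<Longrightarrow> \<psi> (\<xi>, w) = f2 w + cnj (h2 w)"
    using p2 unfolding holo_plus_antiholo_on_def by blast
  have "(\<exists>c. \<forall>z\<in>V. h1 z = c) \<or> (\<exists>c. \<forall>z\<in>V. h2 z = c)"
    by (rule shifted_round_domain_dichotomy[OF V h1 h2])
      (rule boundary_berezin[OF U'(1,2) V'(1,2) \<xi> k \<phi> \<psi> A f1 h1 f2 h2 e1 e2])
  then show ?thesis
  proof
    assume "\<exists>c. \<forall>z\<in>V. h1 z = c"
    then obtain c where c: "\<And>z. z \<in> V \<Longrightarrow> h1 z = c" by blast
    have "(\<lambda>w. f1 w + cnj c) holomorphic_on V" by (intro holomorphic_intros f1)
    then have "(\<lambda>w. \<phi> (\<xi>, w)) holomorphic_on V" by (rule holomorphic_transform) (simp add: e1 c)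
    then show ?thesis ..
  next
    assume "\<exists>c. \<forall>z\<in>V. h2 z = c"
    then obtain c where c: "\<And>z. z \<in> V \<Longrightarrow> h2 z = c" by blast
    have "(\<lambda>w. f2 w + cnj c) holomorphic_on V" by (intro holomorphic_intros f2)
    then have "(\<lambda>w. \<psi> (\<xi>, w)) holomorphic_on V" by (rule holomorphic_transform) (simp add: e2 c)
    then show ?thesis ..
  qed
qed

text \<open>The image of a nonconstant function is open, hence contained in the interior of the
  closure, which adds no points to \<open>W\<close>.\<close>

lemma holomorphic_image_open_closure:
  assumes g: "g holomorphic_on ball 0 1" and nc: "\<not> g constant_on ball 0 1"
    and W: "interior (closure W) \<subseteq> W" and im: "\<And>z. z \<in> ball 0 1 \<Longrightarrow> g z \<in> closure W"
    and z: "z \<in> ball 0 1"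
  shows "g z \<in> W"
proof -
  have "open (g ` ball 0 1)"
    by (rule open_mapping_thm[OF g open_ball connected_ball open_ball order_refl nc])
  moreover have "g ` ball 0 1 \<subseteq> closure W" using im by blast
  ultimately have "g ` ball 0 1 \<subseteq> interior (closure W)" by (rule interior_maximal[rotated])
  then show ?thesis using W z by blast
qed

text \<open>A nonconstant component of \<open>g\<close> stays inside its open factor. As
  \<open>g\<close> avoids \<open>U \<times> V\<close>, some component is constant; if exactly one
  is, its value lies on a frontier and \<open>g\<close> runs inside one boundary slice, where the
  slice result applies.\<close>

theorem theorem3:
  fixes U V :: "complex set"
    and \<Omega> :: "(complex \<times> complex) set"
    and \<phi> \<psi> :: "complex \<times> complex \<Rightarrow> complex"
  assumes "disk U \<or> annulus U" and "disk V \<or> annulus V"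
    and "\<Omega> = U \<times> V"
    and "continuous_on (closure \<Omega>) \<phi>" and "continuous_on (closure \<Omega>) \<psi>"
    and "boundary_condition U V \<phi>" and "boundary_condition U V \<psi>"
    and "compact_on_bergman \<Omega> (hankel_adjoint \<Omega> \<psi> \<circ> hankel \<Omega> \<phi>)"
  shows "\<forall>g :: complex \<Rightarrow> complex \<times> complex.
           (fst \<circ> g) holomorphic_on ball 0 1 \<and> (snd \<circ> g) holomorphic_on ball 0 1 \<and>
           g ` ball 0 1 \<subseteq> frontier \<Omega> \<longrightarrow>
           (\<phi> \<circ> g) holomorphic_on ball 0 1 \<or> (\<psi> \<circ> g) holomorphic_on ball 0 1"
proof (intro allI impI, elim conjE)
  fix g :: "complex \<Rightarrow> complex \<times> complex"
  let ?D = "ball (0::complex) 1"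
  assume g1: "(fst \<circ> g) holomorphic_on ?D" and g2: "(snd \<circ> g) holomorphic_on ?D" and gf: "g ` ?D \<subseteq> frontier \<Omega>"
  obtain a r R where Ueq: "r < R" "0 < R" "r \<noteq> 0" "U = {z. z - a \<in> round_domain r R}"
    using assms(1) by (rule disk_or_annulus_eq)
  obtain b s S where Veq: "s < S" "0 < S" "s \<noteq> 0" "V = {z. z - b \<in> round_domain s S}"
    using assms(2) by (rule disk_or_annulus_eq)
  note U = shifted_round_domain(1-3)[OF Ueq] and V = shifted_round_domain(1-3)[OF Veq]
  have o: "open (U \<times> V)" using U V by (intro open_Times)
  have bd: "bounded (U \<times> V)" using U V by (intro bounded_Times)
  note \<phi> = assms(4)[unfolded assms(3)] and \<psi> = assms(5)[unfolded assms(3)]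
  have A: "asymptotically_orthogonal (U \<times> V) \<phi> \<psi>"
    using assms(8) unfolding assms(3) by (rule asymptotically_orthogonalI[OF o bd \<phi> \<psi>])
  have fr: "fst (g z) \<in> closure U" "snd (g z) \<in> closure V" "\<not> (fst (g z) \<in> U \<and> snd (g z) \<in> V)"
    if "z \<in> ?D" for z
  proof -
    have "g z \<in> frontier (U \<times> V)" using gf that assms(3) by blast
    then have "g z \<in> closure U \<times> closure V" "g z \<notin> U \<times> V"
      using o by (auto simp: frontier_def closure_Times interior_open)
    then show "fst (g z) \<in> closure U" "snd (g z) \<in> closure V" "\<not> (fst (g z) \<in> U \<and> snd (g z) \<in> V)"
      by (auto simp: mem_Times_iff)
  qed
  have in_U: "fst (g z) \<in> U" if "\<not> (fst \<circ> g) constant_on ?D" "z \<in> ?D" for z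
    using holomorphic_image_open_closure[OF g1 that(1) U(3) _ that(2)] fr(1) by simp
  have in_V: "snd (g z) \<in> V" if "\<not> (snd \<circ> g) constant_on ?D" "z \<in> ?D" for z
    using holomorphic_image_open_closure[OF g2 that(1) V(3) _ that(2)] fr(2) by simp
  have 0: "(0::complex) \<in> ?D" by simp
  \<comment> \<open>The full factor is itself one of the disks or annuli to which the boundary
    condition applies.\<close>
  have bc1: "holo_plus_antiholo_on (\<lambda>w. \<theta> (\<xi>, w)) V"
    if "boundary_condition U V \<theta>" "\<xi> \<in> frontier U" for \<theta> \<xi>
    using that assms(2) unfolding boundary_condition_def by (simp only: order_refl)
  have bc2: "holo_plus_antiholo_on (\<lambda>w. \<theta> (w, \<eta>)) U"
    if "boundary_condition U V \<theta>" "\<eta> \<in> frontier V" for \<theta> \<eta>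
    using that assms(1) unfolding boundary_condition_def by (simp only: order_refl)
  have comp: "(\<theta> \<circ> g) holomorphic_on ?D"
    if "(\<lambda>w. \<theta> (c w)) holomorphic_on W" "h holomorphic_on ?D" "\<And>z. z \<in> ?D \<Longrightarrow> h z \<in> W"
      "\<And>z. z \<in> ?D \<Longrightarrow> g z = c (h z)" for \<theta> :: "complex \<times> complex \<Rightarrow> complex" and c h W
  proof -
    have "(\<lambda>w. \<theta> (c w)) \<circ> h holomorphic_on ?D"
      by (rule holomorphic_on_compose_gen[OF that(2,1)]) (use that(3) in auto)
    then show ?thesis by (rule holomorphic_transform) (simp add: that(4))
  qed
  consider "(fst \<circ> g) constant_on ?D" "(snd \<circ> g) constant_on ?D"
    | "(fst \<circ> g) constant_on ?D" "\<not> (snd \<circ> g) constant_on ?D"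
    | "\<not> (fst \<circ> g) constant_on ?D" "(snd \<circ> g) constant_on ?D"
    | "\<not> (fst \<circ> g) constant_on ?D" "\<not> (snd \<circ> g) constant_on ?D"
    by blast
  then show "(\<phi> \<circ> g) holomorphic_on ?D \<or> (\<psi> \<circ> g) holomorphic_on ?D"
  proof cases
    case 1
    then obtain c d where "\<And>z. z \<in> ?D \<Longrightarrow> g z = (c, d)"
      unfolding constant_on_def by (metis comp_apply prod.collapse)
    then have "(\<phi> \<circ> g) holomorphic_on ?D"
      by (intro holomorphic_transform[OF holomorphic_on_const[of "\<phi> (c, d)"]]) simp
    then show ?thesis ..
  next
    case 2
    then obtain \<xi> where \<xi>: "\<And>z. z \<in> ?D \<Longrightarrow> fst (g z) = \<xi>" unfolding constant_on_def by auto
    \<comment> \<open>Since the second component lies in \<open>V\<close> and \<open>g\<close>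
      avoids the product, the constant first component cannot lie in \<open>U\<close>.\<close>
    have "\<xi> \<in> closure U" "\<xi> \<notin> U" using fr[OF 0] in_V[OF 2(2) 0] \<xi>[OF 0] by auto
    then have \<xi>f: "\<xi> \<in> frontier U" using U(1) by (simp add: frontier_def interior_open)
    have "holo_plus_antiholo_on (\<lambda>w. \<phi> (\<xi>, w)) V" "holo_plus_antiholo_on (\<lambda>w. \<psi> (\<xi>, w)) V"
      using bc1[OF assms(6) \<xi>f] bc1[OF assms(7) \<xi>f] by simp_all
    from boundary_slice_holomorphic[OF assms(1,2) \<phi> \<psi> A \<xi>f this]
    have "(\<lambda>w. \<phi> (\<xi>, w)) holomorphic_on V \<or> (\<lambda>w. \<psi> (\<xi>, w)) holomorphic_on V" .
    moreover have "(\<theta> \<circ> g) holomorphic_on ?D" if "(\<lambda>w. \<theta> (\<xi>, w)) holomorphic_on V" for \<theta>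
    proof (rule comp[where c="\<lambda>w. (\<xi>, w)", OF that g2])
      fix z assume z: "z \<in> ?D"
      show "(snd \<circ> g) z \<in> V" using in_V[OF 2(2) z] by simp
      show "g z = (\<xi>, (snd \<circ> g) z)" using \<xi>[OF z] by (simp add: prod_eq_iff)
    qed
    ultimately show ?thesis by blast
  next
    case 3
    then obtain \<eta> where \<eta>: "\<And>z. z \<in> ?D \<Longrightarrow> snd (g z) = \<eta>" unfolding constant_on_def by auto
    have "\<eta> \<in> closure V" "\<eta> \<notin> V" using fr[OF 0] in_U[OF 3(1) 0] \<eta>[OF 0] by auto
    then have \<eta>f: "\<eta> \<in> frontier V" using V(1) by (simp add: frontier_def interior_open)
    \<comment> \<open>The exchanged symbols have the constant coordinate in first place, the form
      the slice result expects.\<close>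
    have p: "holo_plus_antiholo_on (\<lambda>w. \<phi> (prod.swap (\<eta>, w))) U" "holo_plus_antiholo_on (\<lambda>w. \<psi> (prod.swap (\<eta>, w))) U"
      using bc2[OF assms(6) \<eta>f] bc2[OF assms(7) \<eta>f] by simp_all
    have sc: "continuous_on (closure (V \<times> U)) (\<lambda>x. \<theta> (prod.swap x))"
      if "continuous_on (closure (U \<times> V)) \<theta>" for \<theta> :: "complex \<times> complex \<Rightarrow> complex"
      by (rule continuous_on_compose2[OF that continuous_on_swap]) (auto simp: closure_Times)
    have "asymptotically_orthogonal (V \<times> U) (\<lambda>x. \<phi> (prod.swap x)) (\<lambda>x. \<psi> (prod.swap x))"
      by (rule asymptotically_orthogonal_swap[OF U(1,2) V(1,2) \<phi> \<psi> A])
    from boundary_slice_holomorphic[OF assms(2,1) sc[OF \<phi>] sc[OF \<psi>] this \<eta>f p]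
    have "(\<lambda>w. \<phi> (w, \<eta>)) holomorphic_on U \<or> (\<lambda>w. \<psi> (w, \<eta>)) holomorphic_on U" by simp
    moreover have "(\<theta> \<circ> g) holomorphic_on ?D" if "(\<lambda>w. \<theta> (w, \<eta>)) holomorphic_on U" for \<theta>
    proof (rule comp[where c="\<lambda>w. (w, \<eta>)", OF that g1])
      fix z assume z: "z \<in> ?D"
      show "(fst \<circ> g) z \<in> U" using in_U[OF 3(1) z] by simp
      show "g z = ((fst \<circ> g) z, \<eta>)" using \<eta>[OF z] by (simp add: prod_eq_iff)
    qed
    ultimately show ?thesis by blast
  next
    case 4
    \<comment> \<open>Two nonconstant components would place \<open>g 0\<close> inside the open
      product.\<close>
    then show ?thesis using in_U[OF 4(1) 0] in_V[OF 4(2) 0] fr(3)[OF 0] by blast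
  qed
qed

end
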